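(* Let $\mathbf H=(\mathcal H_1,\dots,\mathcal H_m)$ be a vector of species in the sorts $(\mathcal Z,\mathcal Y_1,\dots,\mathcal Y_m)$. The combinatorial system $\mathbf Y=\mathbf H(\mathcal Z,\mathbf Y)$ is well founded if and only if (1) its companion system $\mathbf Y=\mathbf K(\mathcal Z_1,\mathcal Z,\mathbf Y)$ is well founded at $\mathbf 0$, and (2) the solution $\mathbf S_1(\mathcal Z_1,\mathcal Z)$ of the companion system with $\mathbf S_1(0,\mathbf 0)=\mathbf 0$ is polynomial in $\mathcal Z_1$. In this case, the limit of the iteration $\mathbf Y^{[0]}=\mathbf 0$, $\mathbf Y^{[n+1]}=\mathbf H(\mathcal Z,\mathbf Y^{[n]})$ is $\mathbf S_1(1,\mathcal Z)$.
   Context: Species (multisort) are functorial assignments of finite sets of structures to tuples of finite sets, taken up to isomorphism, with the standard operations of sum, product, composition ($\mathcal F$-assemblies of $\mathcal G_i$-structures on blocks of a partition) and partial derivative. $0$ has no structures, $1$ has a single structure on the empty set, $\mathcal F(\mathbf 0)$ is the subspecies of size-$0$ structures. Ordinary composition $\mathcal F(\mathcal G_1,\dots)$ requires $\mathcal G_i$ to have no structures on the empty set. A multisort species $\mathcal F(\mathcal Z_1,\mathbf Z_2)$ is \emph{polynomial in $\mathcal Z_1$} (or in a sort $\mathcal Y_i$) if for each $n$ there are only finitely many $\mathcal F$-structures whose total size in the remaining sorts is $n$. If $\mathcal F$ is polynomial in $\mathcal Z_1$, its composition with $1$ is defined by $\mathcal F(1,\mathbf Z_2)[U_2]=$ the set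 of isomorphism classes (under relabeling of the first set only) of $\mathcal F$-structures on $(\{1,\dots,k\},U_2)$, $k\ge0$; composition $\mathcal F(\dots,\mathcal G_i,\dots)$ with $\mathcal G_i(0)\ne0$ is defined through this (writing $\mathcal G_i=\mathcal G_i(0)+(\mathcal G_i-\mathcal G_i(0))$) when $\mathcal F$ is polynomial in $\mathcal Y_i$. Contact of order $p$: isomorphism of restrictions to size $\le p$; convergence: eventual contact of every order. \emph{Well founded at $\mathbf 0$}: $\mathbf H(\mathbf 0,\mathbf 0)=\mathbf 0$ and the iteration $\mathbf Y^{[0]}=\mathbf 0$, $\mathbf Y^{[n+1]}=\mathbf H(\mathcal Z,\mathbf Y^{[n]})$ converges to a limit with no zero coordinate. \emph{Well founded}: that iteration is well defined (for each $i$, either $\mathbf H$ is polynomial in $\mathcal Y_i$ or $\mathcal Y_i^{[n]}(0)=0$ for all $n$), converges, and its limit has no coordinate equal to $0$. The \emph{companion system} uses a new sort $\mathcal Z_1$ and $\mathbf K(\mathcal Z_1,\mathcal Z,\mathbf Y)=\mathbf H(\mathcal Z,\mathbf Y)-\mathbf H(\mathbf 0,\mathbf 0)+\mathcal Z_1\mathbf H(\mathbf 0,\mathbf 0)$ (for $\mathbf F\subset\mathbf G$, $\mathbf G-\mathbf F$ is the species with $\mathbf G=\mathbf F+(\mathbf G-\mathbf F)$). *)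

theory Defs
  imports Main "HOL-Library.FSet" "HOL-Library.Countable" "HOL-Combinatorics.Permutations"
begin

text \<open>
  A multisort species with sorts indexed by a finite type is a functor from tuples of finite sets
  and bijections to finite sets. Labels and structures are natural numbers: every finite set is in
  bijection with a finite set of naturals, so up to isomorphism no species is lost. Derived
  structures (pairs, assemblies, isomorphism classes) are coded by the injection
  \<^const>\<open>to_nat\<close> of their countable type.

  \<open>str F U\<close> is the set of structures on the tuple \<open>U\<close>. \<open>transport F U \<sigma>\<close> is the transport of the
  structures on \<open>U\<close> along the tuple of bijections \<open>\<sigma> i : U i \<rightarrow> \<sigma> i ` U i\<close>. The record itself
  imposes nothing; the axioms of a species, including finiteness of the sets of structures, are
  collected in the predicate \<open>species\<close>.
\<close>

type_synonym 'i labels = "'i \<Rightarrow> nat fset"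

record 'i spec =
  str :: "'i labels \<Rightarrow> nat set"
  transport :: "'i labels \<Rightarrow> ('i \<Rightarrow> nat \<Rightarrow> nat) \<Rightarrow> nat \<Rightarrow> nat"

definition relabel :: "('i \<Rightarrow> nat \<Rightarrow> nat) \<Rightarrow> 'i labels \<Rightarrow> 'i labels" where
  "relabel \<sigma> U = (\<lambda>i. \<sigma> i |`| U i)"

definition bij_tuple :: "'i labels \<Rightarrow> ('i \<Rightarrow> nat \<Rightarrow> nat) \<Rightarrow> bool" where
  "bij_tuple U \<sigma> \<longleftrightarrow> (\<forall>i. inj_on (\<sigma> i) (fset (U i)))"

definition no_labels :: "'i labels" where
  "no_labels = (\<lambda>_. {||})"

definition total_size :: "'i::finite labels \<Rightarrow> nat" where
  "total_size U = (\<Sum>i\<in>UNIV. fcard (U i))"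

definition species :: "'i spec \<Rightarrow> bool" where
  "species F \<longleftrightarrow>
     (\<forall>U. finite (str F U)) \<and>
     (\<forall>U \<sigma> s. bij_tuple U \<sigma> \<and> s \<in> str F U \<longrightarrow> transport F U \<sigma> s \<in> str F (relabel \<sigma> U)) \<and>
     (\<forall>U \<sigma> \<tau> s. bij_tuple U \<sigma> \<and> (\<forall>i. \<forall>x\<in>fset (U i). \<sigma> i x = \<tau> i x) \<and> s \<in> str F U
        \<longrightarrow> transport F U \<sigma> s = transport F U \<tau> s) \<and>
     (\<forall>U s. s \<in> str F U \<longrightarrow> transport F U (\<lambda>_. id) s = s) \<and>
     (\<forall>U \<sigma> \<tau> s. bij_tuple U \<sigma> \<and> bij_tuple (relabel \<sigma> U) \<tau> \<and> s \<in> str F U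
        \<longrightarrow> transport F U (\<lambda>i. \<tau> i \<circ> \<sigma> i) s = transport F (relabel \<sigma> U) \<tau> (transport F U \<sigma> s))"

definition iso_sp :: "'i spec \<Rightarrow> 'i spec \<Rightarrow> bool" (infix "\<cong>\<^sub>s" 50) where
  "F \<cong>\<^sub>s G \<longleftrightarrow> (\<exists>\<phi>.
     (\<forall>U. bij_betw (\<phi> U) (str F U) (str G U)) \<and>
     (\<forall>U \<sigma> s. bij_tuple U \<sigma> \<and> s \<in> str F U
        \<longrightarrow> \<phi> (relabel \<sigma> U) (transport F U \<sigma> s) = transport G U \<sigma> (\<phi> U s)))"

definition zero_sp :: "'i spec" where
  "zero_sp = \<lparr>str = \<lambda>_. {}, transport = \<lambda>_ _ s. s\<rparr>"

definition is_zero :: "'i spec \<Rightarrow> bool" where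
  "is_zero F \<longleftrightarrow> (\<forall>U. str F U = {})"

definition sort_sp :: "'i \<Rightarrow> 'i spec" where
  "sort_sp i =
     \<lparr>str = \<lambda>U. if fcard (U i) = 1 \<and> (\<forall>j. j \<noteq> i \<longrightarrow> U j = {||}) then {0} else {},
      transport = \<lambda>_ _ s. s\<rparr>"

definition plus_sp :: "'i spec \<Rightarrow> 'i spec \<Rightarrow> 'i spec" where
  "plus_sp F G =
     \<lparr>str = \<lambda>U. to_nat ` (str F U <+> str G U),
      transport = \<lambda>U \<sigma> s. to_nat (map_sum (transport F U \<sigma>) (transport G U \<sigma>) (from_nat s))\<rparr>"

definition times_sp :: "'i::finite spec \<Rightarrow> 'i spec \<Rightarrow> 'i spec" where
  "times_sp F G =
     \<lparr>str = \<lambda>U. {to_nat (V, W, f, g) | V W f g.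
          (\<forall>i. V i |\<union>| W i = U i \<and> V i |\<inter>| W i = {||}) \<and> f \<in> str F V \<and> g \<in> str G W},
      transport = \<lambda>U \<sigma> s. (case from_nat s of (V, W, f, g) \<Rightarrow>
          to_nat (relabel \<sigma> V, relabel \<sigma> W, transport F V \<sigma> f, transport G W \<sigma> g))\<rparr>"

text \<open>\<open>minus_sp G F\<close> is only meaningful when \<open>F\<close> is a subspecies of \<open>G\<close>, that is
  \<open>str F U \<subseteq> str G U\<close> for all \<open>U\<close>, with the same transport.\<close>

definition minus_sp :: "'i spec \<Rightarrow> 'i spec \<Rightarrow> 'i spec" where
  "minus_sp G F = \<lparr>str = \<lambda>U. str G U - str F U, transport = transport G\<rparr>"

definition at_zero :: "'i spec \<Rightarrow> 'i spec" where
  "at_zero F = \<lparr>str = \<lambda>U. if U = no_labels then str F U else {}, transport = transport F\<rparr>"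

definition restrict_sp :: "nat \<Rightarrow> 'i::finite spec \<Rightarrow> 'i spec" where
  "restrict_sp p F = \<lparr>str = \<lambda>U. if total_size U \<le> p then str F U else {}, transport = transport F\<rparr>"

text \<open>A species in the sorts \<open>'a\<close>, regarded as a species in the sorts \<open>'b\<close> via an injection
  \<open>\<iota>\<close> of the sorts; its structures use no label of the additional sorts.\<close>

definition embed_sp :: "('a \<Rightarrow> 'b) \<Rightarrow> 'a spec \<Rightarrow> 'b spec" where
  "embed_sp \<iota> F =
     \<lparr>str = \<lambda>U. if \<forall>j. j \<notin> range \<iota> \<longrightarrow> U j = {||} then str F (U \<circ> \<iota>) else {},
      transport = \<lambda>U \<sigma>. transport F (U \<circ> \<iota>) (\<sigma> \<circ> \<iota>)\<rparr>"

text \<open>A partition of the tuple \<open>U\<close> into nonempty blocks, each block (itself a tuple of sets)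
  being assigned a sort \<open>i\<close>.\<close>

definition sorted_partition :: "'k labels \<Rightarrow> ('i \<Rightarrow> 'k labels fset) \<Rightarrow> bool" where
  "sorted_partition U \<pi> \<longleftrightarrow>
     (\<forall>i B. B |\<in>| \<pi> i \<longrightarrow> B \<noteq> no_labels \<and> (\<forall>k. B k |\<subseteq>| U k)) \<and>
     (\<forall>k u. u |\<in>| U k \<longrightarrow> (\<exists>!(i, B). B |\<in>| \<pi> i \<and> u |\<in>| B k))"

text \<open>
  Ordinary composition \<open>F(G\<^sub>1, G\<^sub>2, \<dots>)\<close>, to be used when no \<open>G i\<close> has a structure on the empty set.
  A structure is a pair \<open>(\<gamma>, f)\<close>: \<open>\<gamma> i\<close> is the finite set of pairs of a block of sort \<open>i\<close>
  and the \<open>G i\<close>-structure on it, and \<open>f\<close> is an \<open>F\<close>-structure on the tuple of sets of blocks.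
\<close>

definition blocks :: "('i \<Rightarrow> ('k::finite labels \<times> nat) fset) \<Rightarrow> 'i labels" where
  "blocks \<gamma> = (\<lambda>i. (\<lambda>m. to_nat (fst m)) |`| \<gamma> i)"

definition comp_sp :: "'i::finite spec \<Rightarrow> ('i \<Rightarrow> 'k::finite spec) \<Rightarrow> 'k spec" where
  "comp_sp F G =
     \<lparr>str = \<lambda>U. {to_nat (\<gamma>, f) | (\<gamma> :: 'i \<Rightarrow> ('k labels \<times> nat) fset) f.
          sorted_partition U (\<lambda>i. fst |`| \<gamma> i) \<and>
          (\<forall>i. inj_on fst (fset (\<gamma> i))) \<and>
          (\<forall>i B g. (B, g) |\<in>| \<gamma> i \<longrightarrow> g \<in> str (G i) B) \<and>
          f \<in> str F (blocks \<gamma>)},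
      transport = \<lambda>U \<sigma> s. (case from_nat s of (\<gamma> :: 'i \<Rightarrow> ('k labels \<times> nat) fset, f) \<Rightarrow>
          to_nat (\<lambda>i. (\<lambda>(B, g). (relabel \<sigma> B, transport (G i) B \<sigma> g)) |`| \<gamma> i,
                  transport F (blocks \<gamma>)
                    (\<lambda>_ b. to_nat (relabel \<sigma> (from_nat b :: 'k labels))) f))\<rparr>"

definition polynomial_in :: "'i::finite \<Rightarrow> 'i spec \<Rightarrow> bool" where
  "polynomial_in x F \<longleftrightarrow>
     (\<forall>n. finite {(k :: 'i \<Rightarrow> nat, s).
        (\<Sum>j\<in>UNIV - {x}. k j) = n \<and> s \<in> str F (\<lambda>j. fset_of_list [1..<Suc (k j)])})"

text \<open>
  \<open>F(1, Z\<^sub>2)\<close>, where \<open>None\<close> is the sort replaced by 1: a structure on \<open>U\<close> is a pair of some \<open>k\<close> and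
  an orbit of the \<open>F\<close>-structures on \<open>({1,\<dots>,k}, U)\<close> under the permutations of \<open>{1,\<dots>,k}\<close>.
  Its sets of structures can be infinite if \<open>F\<close> is not polynomial in \<open>None\<close>.
\<close>

definition std_ext :: "nat \<Rightarrow> 'k labels \<Rightarrow> 'k option labels" where
  "std_ext k U = case_option (fset_of_list [1..<Suc k]) U"

definition at_one :: "'k option spec \<Rightarrow> 'k spec" where
  "at_one F =
     \<lparr>str = \<lambda>U. {to_nat (k, Abs_fset {transport F (std_ext k U) (case_option \<rho> (\<lambda>_. id)) s | \<rho>.
                               \<rho> permutes {1..k}}) | k s. s \<in> str F (std_ext k U)},
      transport = \<lambda>U \<sigma> c. (case from_nat c of (k, S :: nat fset) \<Rightarrow>
          to_nat (k, transport F (std_ext k U) (case_option id \<sigma>) |`| S))\<rparr>"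

text \<open>\<open>F - F(0) + X \<cdot> F(0)\<close>, for a new sort \<open>X\<close>.\<close>

definition mark_zero :: "('a \<Rightarrow> 'b) \<Rightarrow> 'b \<Rightarrow> 'a spec \<Rightarrow> 'b::finite spec" where
  "mark_zero \<iota> X F =
     plus_sp (embed_sp \<iota> (minus_sp F (at_zero F)))
             (times_sp (sort_sp X) (embed_sp \<iota> (at_zero F)))"

text \<open>
  Composition \<open>F(G\<^sub>1, G\<^sub>2, \<dots>)\<close> where the \<open>G i\<close> may have structures on the empty set:
  \<open>G i = (G i - G i(0)) + 1 \<cdot> G i(0)\<close>, so it is the ordinary composition of \<open>F\<close> with the species
  \<open>(G i - G i(0)) + X \<cdot> G i(0)\<close>, in which then \<open>X\<close> is replaced by 1. If \<open>F\<close> is not polynomial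
  in the sorts concerned, the result can have infinite sets of structures.
\<close>

definition gcomp_sp :: "'i::finite spec \<Rightarrow> ('i \<Rightarrow> 'k::finite spec) \<Rightarrow> 'k spec" where
  "gcomp_sp F G = at_one (comp_sp F (\<lambda>i. mark_zero Some None (G i)))"

definition contact :: "nat \<Rightarrow> 'i::finite spec \<Rightarrow> 'i spec \<Rightarrow> bool" where
  "contact p F G \<longleftrightarrow> restrict_sp p F \<cong>\<^sub>s restrict_sp p G"

definition has_limit :: "(nat \<Rightarrow> 'm \<Rightarrow> 'z::finite spec) \<Rightarrow> ('m \<Rightarrow> 'z spec) \<Rightarrow> bool" where
  "has_limit Y L \<longleftrightarrow>
     (\<forall>i. species (L i)) \<and> (\<forall>p. \<exists>N. \<forall>n\<ge>N. \<forall>i. contact p (Y n i) (L i))"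

text \<open>Systems \<open>Y = H(Z, Y)\<close>: the sorts \<open>Inl z\<close> are those of \<open>Z\<close>, the sorts \<open>Inr i\<close> those of
  \<open>Y\<close>.\<close>

primrec iteration_at_0 ::
  "('m::finite \<Rightarrow> ('z::finite + 'm) spec) \<Rightarrow> nat \<Rightarrow> 'm \<Rightarrow> 'z spec" where
  "iteration_at_0 H 0 = (\<lambda>i. zero_sp)"
| "iteration_at_0 H (Suc n) = (\<lambda>i. comp_sp (H i) (case_sum sort_sp (iteration_at_0 H n)))"

primrec iteration :: "('m::finite \<Rightarrow> ('z::finite + 'm) spec) \<Rightarrow> nat \<Rightarrow> 'm \<Rightarrow> 'z spec" where
  "iteration H 0 = (\<lambda>i. zero_sp)"
| "iteration H (Suc n) = (\<lambda>i. gcomp_sp (H i) (case_sum sort_sp (iteration H n)))"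

definition well_founded_at_0 :: "('m::finite \<Rightarrow> ('z::finite + 'm) spec) \<Rightarrow> bool" where
  "well_founded_at_0 H \<longleftrightarrow>
     (\<forall>i. is_zero (at_zero (H i))) \<and>
     (\<exists>L. has_limit (iteration_at_0 H) L \<and> (\<forall>i. \<not> is_zero (L i)))"

text \<open>
  Being polynomial in \<open>Y\<^sub>1\<close> and in \<open>Y\<^sub>2\<close> separately does not make \<open>F(1, 1)\<close> a species (take the sum
  over \<open>k\<close> of \<open>Y\<^sub>1\<^sup>k Y\<^sub>2\<^sup>k\<close>): after the substitution of 1 for \<open>Y\<^sub>1\<close>, polynomiality in \<open>Y\<^sub>2\<close> is required
  of the result. The first conjunct states that the iterated compositions do define species.
\<close>

definition iteration_well_defined :: "('m::finite \<Rightarrow> ('z::finite + 'm) spec) \<Rightarrow> bool" where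
  "iteration_well_defined H \<longleftrightarrow>
     (\<forall>n i. species (iteration H n i)) \<and>
     (\<forall>i. (\<forall>j. polynomial_in (Inr i) (H j)) \<or> (\<forall>n. is_zero (at_zero (iteration H n i))))"

definition well_founded :: "('m::finite \<Rightarrow> ('z::finite + 'm) spec) \<Rightarrow> bool" where
  "well_founded H \<longleftrightarrow>
     iteration_well_defined H \<and>
     (\<exists>L. has_limit (iteration H) L \<and> (\<forall>i. \<not> is_zero (L i)))"

text \<open>The companion system; its new sort is \<open>Inl None\<close>.\<close>

definition companion ::
  "('m::finite \<Rightarrow> ('z::finite + 'm) spec) \<Rightarrow> 'm \<Rightarrow> ('z option + 'm) spec" where
  "companion H = (\<lambda>i. mark_zero (map_sum Some id) (Inl None) (H i))"

definition solution_at_0 ::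
  "('m::finite \<Rightarrow> ('z::finite + 'm) spec) \<Rightarrow> ('m \<Rightarrow> 'z spec) \<Rightarrow> bool" where
  "solution_at_0 H S \<longleftrightarrow>
     (\<forall>i. species (S i)) \<and>
     (\<forall>i. is_zero (at_zero (S i))) \<and>
     (\<forall>i. S i \<cong>\<^sub>s comp_sp (H i) (case_sum sort_sp S))"

text \<open>``The'' solution: unique up to isomorphism.\<close>

definition the_solution_at_0 ::
  "('m::finite \<Rightarrow> ('z::finite + 'm) spec) \<Rightarrow> ('m \<Rightarrow> 'z spec) \<Rightarrow> bool" where
  "the_solution_at_0 H S \<longleftrightarrow>
     solution_at_0 H S \<and> (\<forall>T. solution_at_0 H T \<longrightarrow> (\<forall>i. T i \<cong>\<^sub>s S i))"

end

theory Submission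
  imports Defs
begin

text \<open>
  Let \<open>X\<^sub>n\<close> be the iterates of the companion system and \<open>Y\<^sub>n\<close> those of the system itself. Then \<open>Y\<^sub>n\<close> is
  \<open>X\<^sub>n(1, Z)\<close>: a composition in which a sort is replaced by 1 only depends on the components up to
  relabelling of that sort, because the labels of different blocks can be permuted independently.
  As the \<open>X\<^sub>n\<close> form an increasing sequence, convergence of the numbers of orbits, that is of \<open>Y\<^sub>n\<close>, forces
  convergence of \<open>X\<^sub>n\<close> uniformly in the number of labels of the new sort, which gives a limit polynomial
  in it. Conversely, polynomiality of the limit bounds these numbers, so that contact of \<open>X\<^sub>n\<close> with the
  limit yields contact of \<open>Y\<^sub>n\<close>. Uniqueness of the solution holds since a limit without zero coordinate
  excludes infinite chains of linear terms \<open>Y\<^sub>j\<close> in \<open>K\<^sub>i\<close>, so that a solution is determined by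
  induction on the size and, for fixed size, along these chains.
\<close>

section \<open>Labels and transport\<close>

text \<open>Three obstacles shape the development. A general composition is defined through
  \<open>at_one\<close>, which codes orbits as finite sets on standard labels, and iterating such
  codes directly is unwieldy. The predicate \<open>quot F Q q\<close> therefore describes
  \<open>F(1, Z)\<close> by a projection \<open>q\<close>, so that one \<open>Q\<close> can be a
  quotient of several species: \<open>H(Z, Y\<^sub>n)\<close> is by definition a quotient of
  \<open>H\<close> composed with marked copies of \<open>Y\<^sub>n\<close>, hence of
  \<open>H(Z, X\<^sub>n)\<close>, hence of the next companion iterate. Moreover, sets of orbits may
  be infinite until polynomiality is known, so quotients are handled with \<open>functorial\<close>,
  and finiteness enters separately. Finally, contact bounds the total size, whereas a quotient over
  \<open>U\<close> collects structures with any number of new labels. Comparisons are hence made in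
  one shape at a time, with only the old sorts bounded. There counting does the work: an embedding
  whose induced injection of finite sets of orbits is onto is itself onto, because its image is
  closed under relabelling.\<close>

definition shape :: "'i labels \<Rightarrow> 'i \<Rightarrow> nat" where
  "shape U = (\<lambda>i. fcard (U i))"

text \<open>The label tuples over which \<open>polynomial_in\<close> counts structures.\<close>

definition std_labels :: "('i \<Rightarrow> nat) \<Rightarrow> 'i labels" where
  "std_labels k = (\<lambda>i. fset_of_list [1..<Suc (k i)])"

lemma fset_std: "fset (fset_of_list [1..<Suc n]) = {1..n}"
  by (auto simp: fset_of_list.rep_eq)

lemma fcard_std [simp]: "fcard (fset_of_list [1..<Suc n]) = n"
  by (simp only: fcard.rep_eq fset_std card_atLeastAtMost diff_Suc_1)

lemma shape_std [simp]: "shape (std_labels k) = k"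
  unfolding shape_def std_labels_def by (rule ext) (rule fcard_std)

lemma total_size_shape: "total_size U = (\<Sum>i\<in>UNIV. shape U i)"
  by (simp add: total_size_def shape_def)

lemma fset_relabel [simp]: "fset (relabel \<sigma> U i) = \<sigma> i ` fset (U i)"
  by (simp add: relabel_def)

lemma labels_eqI: "(\<And>i. fset (U i) = fset (V i)) \<Longrightarrow> U = V"
  by (rule ext) (simp add: fset_inject)

lemma relabel_id [simp]: "relabel (\<lambda>_. id) U = U"
  by (rule labels_eqI) simp

lemma relabel_comp: "relabel \<tau> (relabel \<sigma> U) = relabel (\<lambda>i. \<tau> i \<circ> \<sigma> i) U"
  by (rule labels_eqI) (simp add: image_comp)

lemma relabel_cong: "(\<And>i x. x \<in> fset (U i) \<Longrightarrow> \<sigma> i x = \<tau> i x) \<Longrightarrow> relabel \<sigma> U = relabel \<tau> U"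
  by (rule labels_eqI) auto

lemma relabel_eq_self: "(\<And>i x. x \<in> fset (U i) \<Longrightarrow> \<sigma> i x = x) \<Longrightarrow> relabel \<sigma> U = U"
  by (rule labels_eqI) auto

lemma relabel_no_labels [simp]: "relabel \<sigma> no_labels = no_labels"
  by (simp add: relabel_def no_labels_def)

lemma relabel_eq_no_labels [simp]: "relabel \<sigma> U = no_labels \<longleftrightarrow> U = no_labels"
  by (auto simp: relabel_def no_labels_def fun_eq_iff)

lemma bij_tuple_id [simp]: "bij_tuple U (\<lambda>_. id)"
  by (simp add: bij_tuple_def)

lemma bij_tuple_comp:
  "bij_tuple U \<sigma> \<Longrightarrow> bij_tuple (relabel \<sigma> U) \<tau> \<Longrightarrow> bij_tuple U (\<lambda>i. \<tau> i \<circ> \<sigma> i)"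
  by (simp add: bij_tuple_def comp_inj_on)

lemma bij_tuple_no_labels [simp]: "bij_tuple no_labels \<sigma>"
  by (simp add: bij_tuple_def no_labels_def)

lemma bij_tuple_mono: "bij_tuple U \<sigma> \<Longrightarrow> (\<And>i. fset (B i) \<subseteq> fset (U i)) \<Longrightarrow> bij_tuple B \<sigma>"
  unfolding bij_tuple_def by (meson inj_on_subset)

lemma shape_relabel [simp]: "bij_tuple U \<sigma> \<Longrightarrow> shape (relabel \<sigma> U) = shape U"
  by (auto simp: shape_def bij_tuple_def fcard.rep_eq card_image)

lemma shape_zero_iff: "shape U = (\<lambda>_. 0) \<longleftrightarrow> U = no_labels"
  by (auto simp: shape_def no_labels_def fun_eq_iff)

lemma bij_tuple_inverse:
  assumes "bij_tuple U \<sigma>"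
  obtains \<tau> where "bij_tuple (relabel \<sigma> U) \<tau>" "relabel \<tau> (relabel \<sigma> U) = U"
    "\<And>i x. x \<in> fset (U i) \<Longrightarrow> \<tau> i (\<sigma> i x) = x"
proof
  let ?\<tau> = "\<lambda>i. inv_into (fset (U i)) (\<sigma> i)"
  have inj: "inj_on (\<sigma> i) (fset (U i))" for i using assms by (simp add: bij_tuple_def)
  show inv: "?\<tau> i (\<sigma> i x) = x" if "x \<in> fset (U i)" for i x
    using inj that by (simp add: inv_into_f_f)
  show "bij_tuple (relabel \<sigma> U) ?\<tau>"
    by (simp add: bij_tuple_def inj_on_inv_into)
  show "relabel ?\<tau> (relabel \<sigma> U) = U"
    unfolding relabel_comp by (rule relabel_eq_self) (simp add: inv)
qed

lemma same_shape_relabel: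
  assumes "shape U = shape V"
  obtains \<sigma> where "bij_tuple U \<sigma>" "relabel \<sigma> U = V"
proof -
  have "\<exists>f. bij_betw f (fset (U i)) (fset (V i))" for i
    using fun_cong[OF assms, of i] by (intro finite_same_card_bij) (auto simp: shape_def fcard.rep_eq)
  then obtain \<sigma> where \<sigma>: "\<And>i. bij_betw (\<sigma> i) (fset (U i)) (fset (V i))" by metis
  show thesis
  proof
    show "bij_tuple U \<sigma>" using \<sigma> by (auto simp: bij_tuple_def bij_betw_def)
    show "relabel \<sigma> U = V" using \<sigma> by (intro labels_eqI) (auto simp: bij_betw_def)
  qed
qed

text \<open>The axioms of a species other than finiteness; \<^const>\<open>at_one\<close> preserves only these.\<close>

definition functorial :: "'i spec \<Rightarrow> bool" where
  "functorial F \<longleftrightarrow>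
     (\<forall>U \<sigma> s. bij_tuple U \<sigma> \<and> s \<in> str F U \<longrightarrow> transport F U \<sigma> s \<in> str F (relabel \<sigma> U)) \<and>
     (\<forall>U \<sigma> \<tau> s. bij_tuple U \<sigma> \<and> (\<forall>i. \<forall>x\<in>fset (U i). \<sigma> i x = \<tau> i x) \<and> s \<in> str F U
        \<longrightarrow> transport F U \<sigma> s = transport F U \<tau> s) \<and>
     (\<forall>U s. s \<in> str F U \<longrightarrow> transport F U (\<lambda>_. id) s = s) \<and>
     (\<forall>U \<sigma> \<tau> s. bij_tuple U \<sigma> \<and> bij_tuple (relabel \<sigma> U) \<tau> \<and> s \<in> str F U
        \<longrightarrow> transport F U (\<lambda>i. \<tau> i \<circ> \<sigma> i) s = transport F (relabel \<sigma> U) \<tau> (transport F U \<sigma> s))"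

lemma species_iff: "species F \<longleftrightarrow> functorial F \<and> (\<forall>U. finite (str F U))"
  unfolding species_def functorial_def by blast

lemma species_functorial: "species F \<Longrightarrow> functorial F"
  by (simp add: species_iff)

lemma species_finite: "species F \<Longrightarrow> finite (str F U)"
  by (simp add: species_iff)

lemma functorialI:
  assumes "\<And>U \<sigma> s. bij_tuple U \<sigma> \<Longrightarrow> s \<in> str F U \<Longrightarrow> transport F U \<sigma> s \<in> str F (relabel \<sigma> U)"
    and "\<And>U \<sigma> \<tau> s. bij_tuple U \<sigma> \<Longrightarrow> (\<And>i x. x \<in> fset (U i) \<Longrightarrow> \<sigma> i x = \<tau> i x) \<Longrightarrow> s \<in> str F U
      \<Longrightarrow> transport F U \<sigma> s = transport F U \<tau> s"
    and "\<And>U s. s \<in> str F U \<Longrightarrow> transport F U (\<lambda>_. id) s = s"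
    and "\<And>U \<sigma> \<tau> s. bij_tuple U \<sigma> \<Longrightarrow> bij_tuple (relabel \<sigma> U) \<tau> \<Longrightarrow> s \<in> str F U
      \<Longrightarrow> transport F U (\<lambda>i. \<tau> i \<circ> \<sigma> i) s = transport F (relabel \<sigma> U) \<tau> (transport F U \<sigma> s)"
  shows "functorial F"
  unfolding functorial_def using assms by (intro conjI allI impI) blast+

lemma transport_in:
  "functorial F \<Longrightarrow> bij_tuple U \<sigma> \<Longrightarrow> s \<in> str F U \<Longrightarrow> transport F U \<sigma> s \<in> str F (relabel \<sigma> U)"
  unfolding functorial_def by blast

lemma transport_cong:
  "functorial F \<Longrightarrow> bij_tuple U \<sigma> \<Longrightarrow> s \<in> str F U \<Longrightarrow> (\<And>i x. x \<in> fset (U i) \<Longrightarrow> \<sigma> i x = \<tau> i x)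
    \<Longrightarrow> transport F U \<sigma> s = transport F U \<tau> s"
  unfolding functorial_def by blast

lemma transport_id: "functorial F \<Longrightarrow> s \<in> str F U \<Longrightarrow> transport F U (\<lambda>_. id) s = s"
  unfolding functorial_def by blast

lemma transport_comp:
  "functorial F \<Longrightarrow> bij_tuple U \<sigma> \<Longrightarrow> bij_tuple (relabel \<sigma> U) \<tau> \<Longrightarrow> s \<in> str F U
    \<Longrightarrow> transport F (relabel \<sigma> U) \<tau> (transport F U \<sigma> s) = transport F U (\<lambda>i. \<tau> i \<circ> \<sigma> i) s"
  unfolding functorial_def by metis

lemma bij_tuple_fix: "(\<And>i x. x \<in> fset (U i) \<Longrightarrow> \<sigma> i x = x) \<Longrightarrow> bij_tuple U \<sigma>"
  by (auto simp: bij_tuple_def inj_on_def)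

lemma transport_fix:
  assumes "functorial F" "s \<in> str F U" "\<And>i x. x \<in> fset (U i) \<Longrightarrow> \<sigma> i x = x"
  shows "transport F U \<sigma> s = s"
  using transport_cong[OF assms(1) bij_tuple_fix assms(2), of \<sigma> "\<lambda>_. id"] assms
  by (simp add: transport_id)

lemma transport_inverse:
  assumes "functorial F" "s \<in> str F U" "bij_tuple U \<sigma>" "bij_tuple (relabel \<sigma> U) \<tau>"
    "\<And>i x. x \<in> fset (U i) \<Longrightarrow> \<tau> i (\<sigma> i x) = x"
  shows "transport F (relabel \<sigma> U) \<tau> (transport F U \<sigma> s) = s"
  using assms by (simp add: transport_comp transport_fix)

lemma transport_inj:
  assumes "functorial F" "bij_tuple U \<sigma>"
  shows "inj_on (transport F U \<sigma>) (str F U)"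
proof -
  obtain \<tau> where "bij_tuple (relabel \<sigma> U) \<tau>" "\<And>i x. x \<in> fset (U i) \<Longrightarrow> \<tau> i (\<sigma> i x) = x"
    using bij_tuple_inverse[OF assms(2)] by blast
  thus ?thesis
    by (intro inj_on_inverseI[of _ "transport F (relabel \<sigma> U) \<tau>"] transport_inverse assms)
qed

lemma transport_bij:
  assumes F: "functorial F" and \<sigma>: "bij_tuple U \<sigma>"
  shows "bij_betw (transport F U \<sigma>) (str F U) (str F (relabel \<sigma> U))"
proof -
  obtain \<tau> where \<tau>: "bij_tuple (relabel \<sigma> U) \<tau>" "relabel \<tau> (relabel \<sigma> U) = U"
    "\<And>i x. x \<in> fset (U i) \<Longrightarrow> \<tau> i (\<sigma> i x) = x"
    using bij_tuple_inverse[OF \<sigma>] by blast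
  have "t \<in> transport F U \<sigma> ` str F U" if t: "t \<in> str F (relabel \<sigma> U)" for t
  proof
    show "transport F (relabel \<sigma> U) \<tau> t \<in> str F U" using transport_in[OF F \<tau>(1) t] \<tau>(2) by simp
    show "t = transport F U \<sigma> (transport F (relabel \<sigma> U) \<tau> t)"
    proof (rule transport_inverse[OF F t \<tau>(1), of \<sigma>, unfolded \<tau>(2), symmetric])
      show "\<sigma> i (\<tau> i x) = x" if "x \<in> fset (relabel \<sigma> U i)" for i x
        using that \<tau>(3) by auto
    qed (use \<sigma> in simp)
  qed
  thus ?thesis
    using transport_inj[OF F \<sigma>] transport_in[OF F \<sigma>] unfolding bij_betw_def by blast
qed

text \<open>Equal shapes are joined by a tuple of bijections, along which transport is bijective.
  Inhabitedness can thus be tested on any convenient labels.\<close>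

lemma str_empty_shape:
  assumes "functorial F" "shape U = shape V" "str F U = {}"
  shows "str F V = {}"
proof -
  obtain \<sigma> where "bij_tuple U \<sigma>" "relabel \<sigma> U = V" using same_shape_relabel[OF assms(2)] .
  thus ?thesis using transport_bij[OF assms(1), of U \<sigma>] assms(3) by (simp add: bij_betw_def)
qed

section \<open>Natural injections and isomorphisms in a fixed shape\<close>

text \<open>A natural embedding of \<open>F\<close> into \<open>G\<close> on the tuples of shape
  \<open>k\<close>. Relabelling preserves the shape, so naturality never compares different shapes,
  and embeddings given shape by shape can be glued.\<close>

definition natural_at :: "('i \<Rightarrow> nat) \<Rightarrow> 'i spec \<Rightarrow> 'i spec \<Rightarrow> ('i labels \<Rightarrow> nat \<Rightarrow> nat) \<Rightarrow> bool" where
  "natural_at k F G \<phi> \<longleftrightarrow> (\<forall>U. shape U = k \<longrightarrow>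
     inj_on (\<phi> U) (str F U) \<and> (\<forall>s\<in>str F U. \<phi> U s \<in> str G U) \<and>
     (\<forall>\<sigma> s. bij_tuple U \<sigma> \<and> s \<in> str F U
        \<longrightarrow> \<phi> (relabel \<sigma> U) (transport F U \<sigma> s) = transport G U \<sigma> (\<phi> U s)))"

lemma natural_atI:
  assumes "\<And>U. shape U = k \<Longrightarrow> inj_on (\<phi> U) (str F U)"
    "\<And>U s. shape U = k \<Longrightarrow> s \<in> str F U \<Longrightarrow> \<phi> U s \<in> str G U"
    "\<And>U \<sigma> s. shape U = k \<Longrightarrow> bij_tuple U \<sigma> \<Longrightarrow> s \<in> str F U
        \<Longrightarrow> \<phi> (relabel \<sigma> U) (transport F U \<sigma> s) = transport G U \<sigma> (\<phi> U s)"
  shows "natural_at k F G \<phi>"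
  unfolding natural_at_def using assms by simp

lemma
  assumes "natural_at k F G \<phi>" "shape U = k"
  shows natural_at_inj: "inj_on (\<phi> U) (str F U)"
    and natural_at_in: "s \<in> str F U \<Longrightarrow> \<phi> U s \<in> str G U"
    and natural_at_transport: "bij_tuple U \<sigma> \<Longrightarrow> s \<in> str F U
        \<Longrightarrow> \<phi> (relabel \<sigma> U) (transport F U \<sigma> s) = transport G U \<sigma> (\<phi> U s)"
  using assms unfolding natural_at_def by simp_all

definition emb_at :: "('i \<Rightarrow> nat) \<Rightarrow> 'i spec \<Rightarrow> 'i spec \<Rightarrow> bool" where
  "emb_at k F G \<longleftrightarrow> (\<exists>\<phi>. natural_at k F G \<phi>)"

definition iso_at :: "('i \<Rightarrow> nat) \<Rightarrow> 'i spec \<Rightarrow> 'i spec \<Rightarrow> bool" where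
  "iso_at k F G \<longleftrightarrow>
     (\<exists>\<phi>. natural_at k F G \<phi> \<and> (\<forall>U. shape U = k \<longrightarrow> \<phi> U ` str F U = str G U))"

lemma iso_atI:
  assumes "natural_at k F G \<phi>" "\<And>U t. shape U = k \<Longrightarrow> t \<in> str G U \<Longrightarrow> t \<in> \<phi> U ` str F U"
  shows "iso_at k F G"
  unfolding iso_at_def
proof (intro exI[of _ \<phi>] conjI allI impI)
  fix U assume "shape U = k"
  thus "\<phi> U ` str F U = str G U" using assms natural_at_in[OF assms(1)] by blast
qed (rule assms)

lemma iso_at_bij:
  assumes "iso_at k F G"
  obtains \<phi> where "natural_at k F G \<phi>" "\<And>U. shape U = k \<Longrightarrow> bij_betw (\<phi> U) (str F U) (str G U)"
proof -
  obtain \<phi> where \<phi>: "natural_at k F G \<phi>" "\<And>U. shape U = k \<Longrightarrow> \<phi> U ` str F U = str G U"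
    using assms unfolding iso_at_def by blast
  show thesis
    by (rule that[OF \<phi>(1)]) (simp add: bij_betw_def \<phi>(2) natural_at_inj[OF \<phi>(1)])
qed

lemma emb_at_glue:
  assumes "\<And>k. k \<in> D \<Longrightarrow> emb_at k F G"
  obtains \<phi> where "\<And>k. k \<in> D \<Longrightarrow> natural_at k F G \<phi>"
proof -
  obtain \<phi> where \<phi>: "\<And>k. k \<in> D \<Longrightarrow> natural_at k F G (\<phi> k)"
    using assms unfolding emb_at_def by metis
  have "natural_at k F G (\<lambda>U. \<phi> (shape U) U)" if "k \<in> D" for k
    using \<phi>[OF that] by (simp add: natural_at_def)
  thus thesis by (rule that)
qed

text \<open>One isomorphism per shape suffices: \<open>\<phi> (shape U) U\<close> is natural, as
  both ends of a relabelling have the same shape.\<close>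

lemma iso_sp_iff: "F \<cong>\<^sub>s G \<longleftrightarrow> (\<forall>k. iso_at k F G)"
proof
  assume "F \<cong>\<^sub>s G"
  then obtain \<phi> where b: "\<And>U. bij_betw (\<phi> U) (str F U) (str G U)"
    and n: "\<And>U \<sigma> s. bij_tuple U \<sigma> \<and> s \<in> str F U
        \<longrightarrow> \<phi> (relabel \<sigma> U) (transport F U \<sigma> s) = transport G U \<sigma> (\<phi> U s)"
    unfolding iso_sp_def by auto
  have "iso_at k F G" for k
  proof (rule iso_atI[of _ _ _ \<phi>])
    show "natural_at k F G \<phi>"
      using b n by (intro natural_atI) (auto simp: bij_betw_def)
  qed (use b in \<open>auto simp: bij_betw_def\<close>)
  thus "\<forall>k. iso_at k F G" ..
next
  assume "\<forall>k. iso_at k F G"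
  then obtain \<phi> where n: "\<And>k. natural_at k F G (\<phi> k)" "\<And>U. \<phi> (shape U) U ` str F U = str G U"
    unfolding iso_at_def by metis
  show "F \<cong>\<^sub>s G" unfolding iso_sp_def
  proof (intro exI[of _ "\<lambda>U. \<phi> (shape U) U"] conjI allI impI; (elim conjE)?)
    fix U
    show "bij_betw (\<phi> (shape U) U) (str F U) (str G U)"
      using n natural_at_inj[OF n(1) refl] by (simp add: bij_betw_def)
    fix \<sigma> s assume "bij_tuple U \<sigma>" "s \<in> str F U"
    thus "\<phi> (shape (relabel \<sigma> U)) (relabel \<sigma> U) (transport F U \<sigma> s) = transport G U \<sigma> (\<phi> (shape U) U s)"
      by (simp add: natural_at_transport[OF n(1)])
  qed
qed

lemma restrict_sp_simps:
  "str (restrict_sp p F) U = (if (\<Sum>i\<in>UNIV. shape U i) \<le> p then str F U else {})"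
  "transport (restrict_sp p F) = transport F"
  by (simp_all add: restrict_sp_def total_size_shape)

text \<open>Above total size \<open>p\<close> both restrictions are empty, and any map is an
  isomorphism there.\<close>

lemma contact_iff: "contact p F G \<longleftrightarrow> (\<forall>k. (\<Sum>i\<in>UNIV. k i) \<le> p \<longrightarrow> iso_at k F G)"
proof -
  have "iso_at k (restrict_sp p F) (restrict_sp p G) \<longleftrightarrow>
      ((\<Sum>i\<in>UNIV. k i) \<le> p \<longrightarrow> iso_at k F G)" for k
    by (cases "(\<Sum>i\<in>UNIV. k i) \<le> p")
      (simp_all add: iso_at_def natural_at_def restrict_sp_simps cong: conj_cong imp_cong)
  thus ?thesis unfolding contact_def iso_sp_iff by blast
qed

lemma iso_at_refl [simp]: "iso_at k F F"
  by (rule iso_atI[of _ _ _ "\<lambda>_ s. s"]) (simp_all add: natural_at_def)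

lemma emb_at_iso: "iso_at k F G \<Longrightarrow> emb_at k F G"
  unfolding iso_at_def emb_at_def by blast

lemma iso_at_sym:
  assumes F: "functorial F" and "iso_at k F G"
  shows "iso_at k G F"
proof -
  obtain \<phi> where n: "natural_at k F G \<phi>" and b: "\<And>U. shape U = k \<Longrightarrow> bij_betw (\<phi> U) (str F U) (str G U)"
    using iso_at_bij[OF assms(2)] by blast
  let ?\<psi> = "\<lambda>U. inv_into (str F U) (\<phi> U)"
  have inv: "bij_betw (?\<psi> U) (str G U) (str F U)" if "shape U = k" for U
    by (rule bij_betw_inv_into[OF b[OF that]])
  show ?thesis
  proof (rule iso_atI[of _ _ _ ?\<psi>], rule natural_atI)
    fix U assume U: "shape U = k"
    show "inj_on (?\<psi> U) (str G U)" using inv[OF U] by (simp add: bij_betw_def)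
    show "?\<psi> U t \<in> str F U" if "t \<in> str G U" for t using inv[OF U] that by (rule bij_betw_apply)
    show "s \<in> ?\<psi> U ` str G U" if "s \<in> str F U" for s using inv[OF U] that by (simp add: bij_betw_def)
    fix \<sigma> t assume \<sigma>: "bij_tuple U \<sigma>" and t: "t \<in> str G U"
    obtain s where s: "s \<in> str F U" "t = \<phi> U s" using b[OF U] t by (auto simp: bij_betw_def)
    have "transport G U \<sigma> t = \<phi> (relabel \<sigma> U) (transport F U \<sigma> s)"
      using natural_at_transport[OF n U \<sigma>] s by simp
    thus "?\<psi> (relabel \<sigma> U) (transport G U \<sigma> t) = transport F U \<sigma> (?\<psi> U t)"
      using s b[OF U] b[of "relabel \<sigma> U"] U \<sigma> transport_in[OF F \<sigma> s(1)]
      by (simp add: bij_betw_inv_into_left)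
  qed
qed

lemma natural_at_comp:
  assumes n: "natural_at k F G \<phi>" "natural_at k G E \<psi>"
  shows "natural_at k F E (\<lambda>U. \<psi> U \<circ> \<phi> U)"
proof (rule natural_atI)
  fix U assume U: "shape U = k"
  note i = natural_at_in[OF n(1) U]
  show "inj_on (\<psi> U \<circ> \<phi> U) (str F U)"
    using natural_at_inj[OF n(1) U] natural_at_inj[OF n(2) U] i
    by (intro comp_inj_on) (auto intro: inj_on_subset)
  show "(\<psi> U \<circ> \<phi> U) s \<in> str E U" if "s \<in> str F U" for s
    using natural_at_in[OF n(2) U] i that by simp
  show "(\<psi> (relabel \<sigma> U) \<circ> \<phi> (relabel \<sigma> U)) (transport F U \<sigma> s) = transport E U \<sigma> ((\<psi> U \<circ> \<phi> U) s)"
    if "bij_tuple U \<sigma>" "s \<in> str F U" for \<sigma> s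
    using natural_at_transport[OF n(1) U] natural_at_transport[OF n(2) U] i that by simp
qed

lemma emb_at_trans: "emb_at k F G \<Longrightarrow> emb_at k G E \<Longrightarrow> emb_at k F E"
  unfolding emb_at_def using natural_at_comp by blast

lemma iso_at_trans:
  assumes "iso_at k F G" "iso_at k G E"
  shows "iso_at k F E"
proof -
  obtain \<phi> where n: "natural_at k F G \<phi>" and b: "\<And>U. shape U = k \<Longrightarrow> \<phi> U ` str F U = str G U"
    using assms(1) unfolding iso_at_def by blast
  obtain \<psi> where n': "natural_at k G E \<psi>" and b': "\<And>U. shape U = k \<Longrightarrow> \<psi> U ` str G U = str E U"
    using assms(2) unfolding iso_at_def by blast
  show ?thesis
    by (rule iso_atI[OF natural_at_comp[OF n n']]) (simp only: image_comp[symmetric] b b')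
qed

lemma emb_at_card:
  assumes "emb_at k F G" "shape U = k" "finite (str G U)"
  shows "card (str F U) \<le> card (str G U)"
proof -
  obtain \<phi> where n: "natural_at k F G \<phi>" using assms(1) unfolding emb_at_def ..
  show ?thesis using assms(3) natural_at_inj[OF n assms(2)] natural_at_in[OF n assms(2)]
    by (intro card_inj_on_le[of "\<phi> U"]) auto
qed

lemma emb_at_empty:
  assumes "emb_at k F G" "shape U = k" "str G U = {}"
  shows "str F U = {}"
proof -
  obtain \<phi> where n: "natural_at k F G \<phi>" using assms(1) unfolding emb_at_def ..
  show ?thesis using natural_at_in[OF n assms(2)] assms(3) by blast
qed

lemma iso_at_card: "iso_at k F G \<Longrightarrow> shape U = k \<Longrightarrow> card (str F U) = card (str G U)"
  by (erule iso_at_bij) (auto dest: bij_betw_same_card)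

lemma iso_at_empty: "iso_at k F G \<Longrightarrow> shape U = k \<Longrightarrow> str F U = {} \<longleftrightarrow> str G U = {}"
  by (erule iso_at_bij) (auto simp: bij_betw_def)

text \<open>Injections into finite sets that are no larger are onto, and naturality is already part
  of the embedding. This is how counting produces isomorphisms.\<close>

lemma emb_at_card_iso:
  assumes "emb_at k F G" "\<And>U. shape U = k \<Longrightarrow> finite (str G U) \<and> card (str G U) \<le> card (str F U)"
  shows "iso_at k F G"
proof -
  obtain \<phi> where n: "natural_at k F G \<phi>" using assms(1) unfolding emb_at_def ..
  have "\<phi> U ` str F U = str G U" if U: "shape U = k" for U
    using assms(2)[OF U] natural_at_inj[OF n U] natural_at_in[OF n U]
    by (intro card_seteq) (auto simp: card_image)
  thus ?thesis by (intro iso_atI[OF n]) simp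
qed

text \<open>Structure sets are finite, so embeddings both ways give equal cardinalities and the
  first embedding is onto. Isomorphisms of compositions are obtained in this way from
  \<open>comp_emb_at\<close>.\<close>

lemma emb_at_antisym:
  assumes "species F" "species G" "emb_at k F G" "emb_at k G F"
  shows "iso_at k F G"
  using assms(3)
  by (rule emb_at_card_iso) (simp add: species_finite assms(1,2) emb_at_card[OF assms(4)])

section \<open>Composition\<close>

lemma sorted_partition_nonempty: "sorted_partition U P \<Longrightarrow> B |\<in>| P j \<Longrightarrow> B \<noteq> no_labels"
  unfolding sorted_partition_def by blast

lemma sorted_partition_subset: "sorted_partition U P \<Longrightarrow> B |\<in>| P j \<Longrightarrow> fset (B k) \<subseteq> fset (U k)"
  unfolding sorted_partition_def by (simp add: less_eq_fset.rep_eq)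

lemma sorted_partition_cover:
  assumes "sorted_partition U P" "u |\<in>| U k"
  obtains j B where "B |\<in>| P j" "u |\<in>| B k"
  using assms unfolding sorted_partition_def by blast

lemma sorted_partition_unique:
  assumes "sorted_partition U P" "B |\<in>| P j" "B' |\<in>| P j'" "u |\<in>| B k" "u |\<in>| B' k"
  shows "j = j' \<and> B = B'"
proof -
  have "u |\<in>| U k" using sorted_partition_subset[OF assms(1,2)] assms(4) by auto
  hence "\<exists>!x. case x of (i, B) \<Rightarrow> B |\<in>| P i \<and> u |\<in>| B k"
    using assms(1) unfolding sorted_partition_def by blast
  hence "(j, B) = (j', B')" using assms by blast
  thus ?thesis by simp
qed

lemma sorted_partitionI:
  assumes "\<And>j B. B |\<in>| P j \<Longrightarrow> B \<noteq> no_labels"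
    and "\<And>j B k. B |\<in>| P j \<Longrightarrow> fset (B k) \<subseteq> fset (U k)"
    and "\<And>k u. u |\<in>| U k \<Longrightarrow> \<exists>j B. B |\<in>| P j \<and> u |\<in>| B k"
    and "\<And>k u j B j' B'. B |\<in>| P j \<Longrightarrow> B' |\<in>| P j' \<Longrightarrow> u |\<in>| B k \<Longrightarrow> u |\<in>| B' k \<Longrightarrow> j = j' \<and> B = B'"
  shows "sorted_partition U P"
  unfolding sorted_partition_def
proof (intro conjI allI impI)
  fix k u assume "u |\<in>| U k"
  then obtain j B where "B |\<in>| P j" "u |\<in>| B k" using assms(3) by blast
  thus "\<exists>!(i, B). B |\<in>| P i \<and> u |\<in>| B k"
    using assms(4) by (intro ex1I[of _ "(j, B)"]) auto
qed (use assms(1,2) in \<open>auto simp: less_eq_fset.rep_eq\<close>)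

lemma relabel_inj:
  assumes "bij_tuple U \<sigma>" "\<And>k. fset (B k) \<subseteq> fset (U k)" "\<And>k. fset (B' k) \<subseteq> fset (U k)"
    "relabel \<sigma> B = relabel \<sigma> B'"
  shows "B = B'"
proof (rule labels_eqI)
  fix k
  have "\<sigma> k ` fset (B k) = \<sigma> k ` fset (B' k)" using fset_relabel assms(4) by metis
  thus "fset (B k) = fset (B' k)"
    using assms(1) inj_on_image_eq_iff[of "\<sigma> k" "fset (U k)", OF _ assms(2,3)]
    by (simp add: bij_tuple_def)
qed

lemma relabel_inj_on_blocks:
  assumes "sorted_partition U P" "bij_tuple U \<sigma>"
  shows "inj_on (relabel \<sigma>) (fset (P j))"
  using relabel_inj[OF assms(2)] sorted_partition_subset[OF assms(1)] by (intro inj_onI) blast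

lemma sorted_partition_relabel:
  assumes P: "sorted_partition U P" and \<sigma>: "bij_tuple U \<sigma>"
  shows "sorted_partition (relabel \<sigma> U) (\<lambda>j. relabel \<sigma> |`| P j)"
proof (rule sorted_partitionI)
  fix k u assume "u |\<in>| relabel \<sigma> U k"
  then obtain x where x: "x |\<in>| U k" "u = \<sigma> k x" by auto
  then obtain j B where "B |\<in>| P j" "x |\<in>| B k" using sorted_partition_cover[OF P] by blast
  with x show "\<exists>j B. B |\<in>| relabel \<sigma> |`| P j \<and> u |\<in>| B k"
    by (intro exI[of _ j] exI[of _ "relabel \<sigma> B"]) auto
next
  fix k u j C j' C'
  assume a: "C |\<in>| relabel \<sigma> |`| P j" "C' |\<in>| relabel \<sigma> |`| P j'" "u |\<in>| C k" "u |\<in>| C' k"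
  then obtain B B' x x' where *: "B |\<in>| P j" "B' |\<in>| P j'" "C = relabel \<sigma> B" "C' = relabel \<sigma> B'"
    "x |\<in>| B k" "x' |\<in>| B' k" "u = \<sigma> k x" "u = \<sigma> k x'" by auto
  have "x \<in> fset (U k)" "x' \<in> fset (U k)"
    using sorted_partition_subset[OF P *(1)] sorted_partition_subset[OF P *(2)] * by auto
  hence "x = x'" using \<sigma> * by (auto simp: bij_tuple_def dest: inj_onD)
  thus "j = j' \<and> C = C'" using sorted_partition_unique[OF P *(1,2)] * by auto
next
  fix j C k assume "C |\<in>| relabel \<sigma> |`| P j"
  then obtain B where "B |\<in>| P j" "C = relabel \<sigma> B" by auto
  thus "fset (C k) \<subseteq> fset (relabel \<sigma> U k)"
    using sorted_partition_subset[OF P, of B j k] by (simp add: image_mono)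
next
  fix j C assume "C |\<in>| relabel \<sigma> |`| P j"
  thus "C \<noteq> no_labels" using sorted_partition_nonempty[OF P] by auto
qed

section \<open>Structures of a composition as partitions with a function on the blocks\<close>

definition codes :: "('i \<Rightarrow> 'k::finite labels fset) \<Rightarrow> 'i labels" where
  "codes P = (\<lambda>j. to_nat |`| P j)"

definition on_codes :: "('i \<Rightarrow> 'k::finite labels \<Rightarrow> 'l::finite labels) \<Rightarrow> 'i \<Rightarrow> nat \<Rightarrow> nat" where
  "on_codes b = (\<lambda>j x. to_nat (b j (from_nat x)))"

lemma fset_codes: "fset (codes P j) = to_nat ` fset (P j)"
  by (simp add: codes_def)

lemma on_codes_to_nat [simp]: "on_codes b j (to_nat B) = to_nat (b j B)"
  by (simp add: on_codes_def)

lemma relabel_on_codes: "relabel (on_codes b) (codes P) = codes (\<lambda>j. b j |`| P j)"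
  by (rule labels_eqI) (simp add: fset_codes image_image)

lemma bij_tuple_on_codes: "bij_tuple (codes P) (on_codes b) \<longleftrightarrow> (\<forall>j. inj_on (b j) (fset (P j)))"
  by (auto simp: bij_tuple_def fset_codes inj_on_def)

lemma shape_codes: "shape (codes P) = (\<lambda>j. fcard (P j))"
  by (rule ext) (simp add: shape_def fcard.rep_eq fset_codes card_image)

text \<open>Unlike in \<open>comp_sp\<close>, the inner structures form a function \<open>g\<close>
  on blocks rather than a finite set of pairs. The values of \<open>g\<close> off the blocks are
  arbitrary, hence \<open>enc\<close> determines \<open>g\<close> only on the blocks of
  \<open>P\<close>.\<close>

definition assembly ::
  "'i spec \<Rightarrow> ('i \<Rightarrow> 'k::finite spec) \<Rightarrow> 'k labels \<Rightarrow>
     ('i \<Rightarrow> 'k labels fset) \<Rightarrow> ('i \<Rightarrow> 'k labels \<Rightarrow> nat) \<Rightarrow> nat \<Rightarrow> bool" where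
  "assembly F G U P g f \<longleftrightarrow>
     sorted_partition U P \<and> (\<forall>j B. B |\<in>| P j \<longrightarrow> g j B \<in> str (G j) B) \<and> f \<in> str F (codes P)"

definition enc :: "('i::finite \<Rightarrow> 'k::finite labels fset) \<Rightarrow> ('i \<Rightarrow> 'k labels \<Rightarrow> nat) \<Rightarrow> nat \<Rightarrow> nat" where
  "enc P g f = to_nat (\<lambda>j. (\<lambda>B. (B, g j B)) |`| P j, f)"

lemma enc_eq_iff:
  "enc P g f = enc P' g' f' \<longleftrightarrow> P = P' \<and> f = f' \<and> (\<forall>j B. B |\<in>| P j \<longrightarrow> g j B = g' j B)"
proof
  assume "enc P g f = enc P' g' f'"
  hence "((\<lambda>j. (\<lambda>B. (B, g j B)) |`| P j) , f) = ((\<lambda>j. (\<lambda>B. (B, g' j B)) |`| P' j), f')"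
    unfolding enc_def using inj_to_nat by (auto dest: injD)
  hence e: "\<And>j. (\<lambda>B. (B, g j B)) |`| P j = (\<lambda>B. (B, g' j B)) |`| P' j" and f: "f = f'"
    by (simp_all only: prod.inject) (drule conjunct1, erule fun_cong)
  have "P j = P' j" for j
    using arg_cong[OF e[of j], of "fimage fst"] by (simp add: fimage_fimage comp_def)
  moreover have "g j B = g' j B" if "B |\<in>| P j" for j B
  proof -
    have "(B, g j B) |\<in>| (\<lambda>B. (B, g' j B)) |`| P' j" using that e[of j] by (metis fimageI)
    thus ?thesis by auto
  qed
  ultimately show "P = P' \<and> f = f' \<and> (\<forall>j B. B |\<in>| P j \<longrightarrow> g j B = g' j B)" using f by auto
next
  assume "P = P' \<and> f = f' \<and> (\<forall>j B. B |\<in>| P j \<longrightarrow> g j B = g' j B)"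
  moreover from this have "(\<lambda>B. (B, g j B)) |`| P j = (\<lambda>B. (B, g' j B)) |`| P j" for j
    by (intro fset.map_cong) auto
  ultimately show "enc P g f = enc P' g' f'" unfolding enc_def by simp
qed

text \<open>Since \<open>fst\<close> is injective on \<open>\<gamma> i\<close>, this finite set of
  pairs is the graph of a function on the blocks of sort \<open>i\<close>.\<close>

lemma str_comp_iff:
  "s \<in> str (comp_sp F G) U \<longleftrightarrow> (\<exists>P g f. s = enc P g f \<and> assembly F G U P g f)"
proof
  assume "s \<in> str (comp_sp F G) U"
  then obtain \<gamma> f where s: "s = to_nat (\<gamma>, f)" and p: "sorted_partition U (\<lambda>i. fst |`| \<gamma> i)"
    and i: "\<And>i. inj_on fst (fset (\<gamma> i))" and g: "\<And>i B g. (B, g) |\<in>| \<gamma> i \<Longrightarrow> g \<in> str (G i) B"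
    and f: "f \<in> str F (blocks \<gamma>)"
    unfolding comp_sp_def by auto
  define P where "P = (\<lambda>i. fst |`| \<gamma> i)"
  define h where "h = (\<lambda>j B. snd (inv_into (fset (\<gamma> j)) fst B))"
  have h: "h j (fst m) = snd m" if "m |\<in>| \<gamma> j" for j m
    unfolding h_def using i that by (simp add: inv_into_f_f)
  have "(\<lambda>B. (B, h j B)) |`| P j = id |`| \<gamma> j" for j
    unfolding P_def fset.map_comp by (intro fset.map_cong) (auto simp: h)
  hence "s = enc P h f" unfolding s enc_def by simp
  moreover have "assembly F G U P h f"
    unfolding assembly_def
  proof (intro conjI allI impI)
    show "sorted_partition U P" using p by (simp add: P_def)
    show "f \<in> str F (codes P)"
      using f by (simp add: blocks_def codes_def P_def fimage_fimage comp_def)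
    show "h j B \<in> str (G j) B" if "B |\<in>| P j" for j B
      using that h g by (fastforce simp: P_def)
  qed
  ultimately show "\<exists>P g f. s = enc P g f \<and> assembly F G U P g f" by blast
next
  assume "\<exists>P g f. s = enc P g f \<and> assembly F G U P g f"
  then obtain P g f where s: "s = enc P g f" and a: "assembly F G U P g f" by blast
  let ?\<gamma> = "\<lambda>j. (\<lambda>B. (B, g j B)) |`| P j"
  have 1: "(\<lambda>i. fst |`| ?\<gamma> i) = P" by (simp add: fimage_fimage comp_def)
  have 2: "blocks ?\<gamma> = codes P" by (simp add: blocks_def codes_def fimage_fimage comp_def)
  have "sorted_partition U (\<lambda>i. fst |`| ?\<gamma> i)" "f \<in> str F (blocks ?\<gamma>)"
    unfolding 1 2 using a by (auto simp: assembly_def)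
  moreover have "h \<in> str (G j) B" if "(B, h) |\<in>| ?\<gamma> j" for j B h
    using a that by (auto simp: assembly_def)
  moreover have "inj_on fst (fset (?\<gamma> j))" for j by (auto simp: inj_on_def)
  ultimately show "s \<in> str (comp_sp F G) U"
    unfolding s enc_def comp_sp_def spec.simps
    by (intro CollectI exI[of _ ?\<gamma>] exI[of _ f]) blast
qed

lemma enc_in_comp: "assembly F G U P g f \<Longrightarrow> enc P g f \<in> str (comp_sp F G) U"
  unfolding str_comp_iff by blast

lemma transport_enc:
  assumes "\<And>j B. B |\<in>| P j \<Longrightarrow> g' j (relabel \<sigma> B) = transport (G j) B \<sigma> (g j B)"
  shows "transport (comp_sp F G) U \<sigma> (enc P g f) =
    enc (\<lambda>j. relabel \<sigma> |`| P j) g' (transport F (codes P) (on_codes (\<lambda>_. relabel \<sigma>)) f)"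
proof -
  have 1: "(\<lambda>(B, g). (relabel \<sigma> B, transport (G j) B \<sigma> g)) |`| (\<lambda>B. (B, g j B)) |`| P j
     = (\<lambda>B. (B, g' j B)) |`| relabel \<sigma> |`| P j" for j
    unfolding fset.map_comp by (intro fset.map_cong) (auto simp: assms)
  have 2: "blocks (\<lambda>j. (\<lambda>B. (B, g j B)) |`| P j) = codes P"
    by (simp add: blocks_def codes_def fimage_fimage comp_def)
  show ?thesis
    unfolding enc_def comp_sp_def spec.simps from_nat_to_nat prod.case 1 2 on_codes_def ..
qed

text \<open>The transported inner structures as a function of the new blocks: \<open>B\<close> is
  the old block behind \<open>C\<close>, unique because \<open>relabel \<sigma>\<close> is injective
  on the blocks of a partition.\<close>

definition transport_blocks ::
  "('i \<Rightarrow> 'k spec) \<Rightarrow> ('k \<Rightarrow> nat \<Rightarrow> nat) \<Rightarrow> ('i \<Rightarrow> 'k labels fset) \<Rightarrow> ('i \<Rightarrow> 'k labels \<Rightarrow> nat)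
     \<Rightarrow> 'i \<Rightarrow> 'k labels \<Rightarrow> nat" where
  "transport_blocks G \<sigma> P g = (\<lambda>j C. let B = inv_into (fset (P j)) (relabel \<sigma>) C in transport (G j) B \<sigma> (g j B))"

lemma transport_blocks_eq:
  assumes "sorted_partition U P" "bij_tuple U \<sigma>" "B |\<in>| P j"
  shows "transport_blocks G \<sigma> P g j (relabel \<sigma> B) = transport (G j) B \<sigma> (g j B)"
  using relabel_inj_on_blocks[OF assms(1,2)] assms(3)
  by (simp add: transport_blocks_def inv_into_f_f)

lemma assembly_transport:
  assumes F: "functorial F" and G: "\<And>j. functorial (G j)"
    and a: "assembly F G U P g f" and \<sigma>: "bij_tuple U \<sigma>"
    and g': "\<And>j B. B |\<in>| P j \<Longrightarrow> g' j (relabel \<sigma> B) = transport (G j) B \<sigma> (g j B)"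
  shows "assembly F G (relabel \<sigma> U) (\<lambda>j. relabel \<sigma> |`| P j) g'
    (transport F (codes P) (on_codes (\<lambda>_. relabel \<sigma>)) f)"
proof -
  have P: "sorted_partition U P" and g: "\<And>j B. B |\<in>| P j \<Longrightarrow> g j B \<in> str (G j) B"
    and f: "f \<in> str F (codes P)" using a by (auto simp: assembly_def)
  show ?thesis unfolding assembly_def
  proof (intro conjI allI impI)
    show "sorted_partition (relabel \<sigma> U) (\<lambda>j. relabel \<sigma> |`| P j)"
      by (rule sorted_partition_relabel[OF P \<sigma>])
    fix j C assume "C |\<in>| relabel \<sigma> |`| P j"
    then obtain B where B: "B |\<in>| P j" "C = relabel \<sigma> B" by auto
    have "bij_tuple B \<sigma>" using bij_tuple_mono[OF \<sigma>] sorted_partition_subset[OF P B(1)] .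
    thus "g' j C \<in> str (G j) C"
      using B g[OF B(1)] transport_in[OF G] by (simp add: g')
  next
    have "bij_tuple (codes P) (on_codes (\<lambda>_. relabel \<sigma>))"
      unfolding bij_tuple_on_codes using relabel_inj_on_blocks[OF P \<sigma>] by blast
    from transport_in[OF F this f]
    show "transport F (codes P) (on_codes (\<lambda>_. relabel \<sigma>)) f \<in> str F (codes (\<lambda>j. relabel \<sigma> |`| P j))"
      by (simp add: relabel_on_codes)
  qed
qed

text \<open>Every law is checked on encodings: the two sides have the same blocks, the outer
  structures agree by the corresponding law of \<open>F\<close>, and the inner ones by that of
  \<open>G j\<close> on each block.\<close>

lemma functorial_comp:
  fixes G :: "'i::finite \<Rightarrow> 'k::finite spec"
  assumes F: "functorial F" and G: "\<And>j. functorial (G j)"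
  shows "functorial (comp_sp F G)"
proof (rule functorialI)
  fix U s \<sigma> assume \<sigma>: "bij_tuple U \<sigma>" and "s \<in> str (comp_sp F G) U"
  then obtain P g f where s: "s = enc P g f" and a: "assembly F G U P g f"
    unfolding str_comp_iff by blast
  have P: "sorted_partition U P" and g: "\<And>j B. B |\<in>| P j \<Longrightarrow> g j B \<in> str (G j) B"
    and f: "f \<in> str F (codes P)" using a by (auto simp: assembly_def)
  have inj: "bij_tuple (codes P) (on_codes (\<lambda>_. relabel \<sigma>))"
    unfolding bij_tuple_on_codes using relabel_inj_on_blocks[OF P \<sigma>] by blast
  let ?g = "transport_blocks G \<sigma> P g"
  note eq = transport_blocks_eq[OF P \<sigma>, of _ _ G g]
  have T: "transport (comp_sp F G) U \<sigma> s = enc (\<lambda>j. relabel \<sigma> |`| P j) ?g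
      (transport F (codes P) (on_codes (\<lambda>_. relabel \<sigma>)) f)"
    unfolding s by (rule transport_enc) (rule eq)
  show "transport (comp_sp F G) U \<sigma> s \<in> str (comp_sp F G) (relabel \<sigma> U)"
    unfolding T by (rule enc_in_comp[OF assembly_transport[OF F G a \<sigma> eq]])
  show "transport (comp_sp F G) U \<sigma> s = transport (comp_sp F G) U \<tau> s"
    if \<tau>: "\<And>i x. x \<in> fset (U i) \<Longrightarrow> \<sigma> i x = \<tau> i x" for \<tau>
  proof -
    have same: "relabel \<sigma> B = relabel \<tau> B" if "B |\<in>| P j" for j B
      using sorted_partition_subset[OF P that] \<tau> by (intro relabel_cong) blast
    have eq': "?g j (relabel \<tau> B) = transport (G j) B \<tau> (g j B)" if B: "B |\<in>| P j" for j B
    proof -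
      have "transport (G j) B \<sigma> (g j B) = transport (G j) B \<tau> (g j B)"
        using sorted_partition_subset[OF P B] \<tau>
        by (intro transport_cong[OF G _ g[OF B]] bij_tuple_mono[OF \<sigma>]) blast+
      thus ?thesis using eq[OF B] same[OF B] by simp
    qed
    have "(\<lambda>j. relabel \<sigma> |`| P j) = (\<lambda>j. relabel \<tau> |`| P j)"
      using same by (intro ext fset.map_cong) auto
    moreover have "transport F (codes P) (on_codes (\<lambda>_. relabel \<sigma>)) f
        = transport F (codes P) (on_codes (\<lambda>_. relabel \<tau>)) f"
      by (intro transport_cong[OF F inj f]) (auto simp: fset_codes same)
    moreover have "transport (comp_sp F G) U \<tau> s = enc (\<lambda>j. relabel \<tau> |`| P j) ?g
        (transport F (codes P) (on_codes (\<lambda>_. relabel \<tau>)) f)"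
      unfolding s by (rule transport_enc) (rule eq')
    ultimately show ?thesis unfolding T by simp
  qed
  show "transport (comp_sp F G) U (\<lambda>i. \<tau> i \<circ> \<sigma> i) s =
      transport (comp_sp F G) (relabel \<sigma> U) \<tau> (transport (comp_sp F G) U \<sigma> s)"
    if \<tau>: "bij_tuple (relabel \<sigma> U) \<tau>" for \<tau>
  proof -
    let ?P = "\<lambda>j. relabel \<sigma> |`| P j"
    note P' = sorted_partition_relabel[OF P \<sigma>]
    note eq2 = transport_blocks_eq[OF P' \<tau>, of _ _ G ?g]
    have inj2: "bij_tuple (relabel (on_codes (\<lambda>_. relabel \<sigma>)) (codes P)) (on_codes (\<lambda>_. relabel \<tau>))"
      unfolding relabel_on_codes bij_tuple_on_codes using relabel_inj_on_blocks[OF P' \<tau>] by blast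
    \<comment> \<open>The inner structures obtained by two successive transports also serve for the
      composite relabelling, so that both encodings become literally equal.\<close>
    have eq3: "transport_blocks G \<tau> ?P ?g j (relabel (\<lambda>i. \<tau> i \<circ> \<sigma> i) B) =
        transport (G j) B (\<lambda>i. \<tau> i \<circ> \<sigma> i) (g j B)" if B: "B |\<in>| P j" for j B
    proof -
      have "bij_tuple B \<sigma>" using bij_tuple_mono[OF \<sigma>] sorted_partition_subset[OF P B] .
      moreover have "bij_tuple (relabel \<sigma> B) \<tau>"
        using sorted_partition_subset[OF P B] by (intro bij_tuple_mono[OF \<tau>]) auto
      ultimately show ?thesis
        using eq2[of "relabel \<sigma> B" j] eq[OF B] B transport_comp[OF G _ _ g[OF B]]
        by (simp add: relabel_comp)
    qed
    have P3: "(\<lambda>j. relabel \<tau> |`| ?P j) = (\<lambda>j. relabel (\<lambda>i. \<tau> i \<circ> \<sigma> i) |`| P j)"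
      by (simp add: fimage_fimage comp_def relabel_comp)
    have "transport F (codes ?P) (on_codes (\<lambda>_. relabel \<tau>))
            (transport F (codes P) (on_codes (\<lambda>_. relabel \<sigma>)) f)
        = transport F (codes P) (\<lambda>i. on_codes (\<lambda>_. relabel \<tau>) i \<circ> on_codes (\<lambda>_. relabel \<sigma>) i) f"
      using transport_comp[OF F inj inj2 f] by (simp only: relabel_on_codes)
    also have "\<dots> = transport F (codes P) (on_codes (\<lambda>_. relabel (\<lambda>i. \<tau> i \<circ> \<sigma> i))) f"
      by (intro transport_cong[OF F bij_tuple_comp[OF inj inj2] f]) (auto simp: fset_codes relabel_comp)
    finally have "transport F (codes ?P) (on_codes (\<lambda>_. relabel \<tau>))
            (transport F (codes P) (on_codes (\<lambda>_. relabel \<sigma>)) f)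
      = transport F (codes P) (on_codes (\<lambda>_. relabel (\<lambda>i. \<tau> i \<circ> \<sigma> i))) f" .
    moreover have "transport (comp_sp F G) (relabel \<sigma> U) \<tau> (transport (comp_sp F G) U \<sigma> s) =
        enc (\<lambda>j. relabel \<tau> |`| ?P j) (transport_blocks G \<tau> ?P ?g)
         (transport F (codes ?P) (on_codes (\<lambda>_. relabel \<tau>))
            (transport F (codes P) (on_codes (\<lambda>_. relabel \<sigma>)) f))"
      unfolding T by (rule transport_enc) (rule eq2)
    moreover have "transport (comp_sp F G) U (\<lambda>i. \<tau> i \<circ> \<sigma> i) s =
        enc (\<lambda>j. relabel (\<lambda>i. \<tau> i \<circ> \<sigma> i) |`| P j) (transport_blocks G \<tau> ?P ?g)
         (transport F (codes P) (on_codes (\<lambda>_. relabel (\<lambda>i. \<tau> i \<circ> \<sigma> i))) f)"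
      unfolding s by (rule transport_enc) (rule eq3)
    ultimately show ?thesis unfolding P3 by simp
  qed
next
  fix U s assume "s \<in> str (comp_sp F G) U"
  then obtain P g f where s: "s = enc P g f" and a: "assembly F G U P g f"
    unfolding str_comp_iff by blast
  have P: "sorted_partition U P" and g: "\<And>j B. B |\<in>| P j \<Longrightarrow> g j B \<in> str (G j) B"
    and f: "f \<in> str F (codes P)" using a by (auto simp: assembly_def)
  have eq: "g j (relabel (\<lambda>_. id) B) = transport (G j) B (\<lambda>_. id) (g j B)" if "B |\<in>| P j" for j B
    using transport_id[OF G g[OF that]] by simp
  have "transport F (codes P) (on_codes (\<lambda>_. relabel (\<lambda>_::'k. id))) f = f"
    by (intro transport_fix[OF F f]) (auto simp: fset_codes)
  moreover have "transport (comp_sp F G) U (\<lambda>_. id) s = enc (\<lambda>j. relabel (\<lambda>_. id) |`| P j) g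
      (transport F (codes P) (on_codes (\<lambda>_. relabel (\<lambda>_::'k. id))) f)"
    unfolding s by (rule transport_enc) (rule eq)
  moreover have "relabel (\<lambda>_. id) |`| P j = P j" for j
    by (rule fset_eqI) (auto simp: image_iff)
  ultimately show "transport (comp_sp F G) U (\<lambda>_. id) s = s" by (simp add: s)
qed

text \<open>Blocks are subtuples of \<open>U\<close>, so only finitely many sets of pairs
  \<open>\<gamma>\<close> can occur, and each of them leaves finitely many outer structures.\<close>

lemma species_comp:
  fixes G :: "'i::finite \<Rightarrow> 'k::finite spec"
  assumes F: "species F" and G: "\<And>j. species (G j)"
  shows "species (comp_sp F G)"
  unfolding species_iff
proof (intro conjI allI)
  show "functorial (comp_sp F G)"
    by (intro functorial_comp species_functorial F G)
  fix U
  have finite_below: "finite {B :: 'k labels. \<forall>k. fset (B k) \<subseteq> fset (U k)}"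
  proof -
    have "{B. \<forall>k. fset (B k) \<subseteq> fset (U k)} = Pi UNIV (\<lambda>k. fset (fPow (U k)))"
      by (auto simp: less_eq_fset.rep_eq)
    also have "\<dots> = Pi\<^sub>E UNIV (\<lambda>k. fset (fPow (U k)))" by (simp add: PiE_def)
    also have "finite \<dots>" by (intro finite_PiE) auto
    finally show ?thesis .
  qed
  define A where "A = (\<lambda>j. Sigma {B. \<forall>k. fset (B k) \<subseteq> fset (U k)} (str (G j)))"
  have A: "finite (A j)" for j
    unfolding A_def using finite_below species_finite[OF G] by (intro finite_SigmaI) auto
  define \<Gamma> where "\<Gamma> = {\<gamma> :: 'i \<Rightarrow> ('k labels \<times> nat) fset. \<forall>j. fset (\<gamma> j) \<subseteq> A j}"
  have "finite \<Gamma>"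
  proof -
    have "finite {X. fset X \<subseteq> A j}" for j
    proof -
      have a: "fset (Abs_fset (A j)) = A j" using A by (simp add: Abs_fset_inverse)
      have "{X. fset X \<subseteq> A j} = fset (fPow (Abs_fset (A j)))"
        by (simp add: set_eq_iff less_eq_fset.rep_eq a)
      thus ?thesis by simp
    qed
    moreover have "\<Gamma> = Pi\<^sub>E UNIV (\<lambda>j. {X. fset X \<subseteq> A j})" by (auto simp: \<Gamma>_def PiE_def)
    ultimately show ?thesis by (simp add: finite_PiE)
  qed
  moreover have "str (comp_sp F G) U \<subseteq> to_nat ` (Sigma \<Gamma> (\<lambda>\<gamma>. str F (blocks \<gamma>)))"
  proof
    fix s assume "s \<in> str (comp_sp F G) U"
    then obtain \<gamma> f where s: "s = to_nat (\<gamma>, f)" and p: "sorted_partition U (\<lambda>i. fst |`| \<gamma> i)"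
      and g: "\<And>i B g. (B, g) |\<in>| \<gamma> i \<Longrightarrow> g \<in> str (G i) B" and f: "f \<in> str F (blocks \<gamma>)"
      unfolding comp_sp_def by auto
    have "\<gamma> \<in> \<Gamma>" unfolding \<Gamma>_def A_def
    proof (intro CollectI allI subsetI)
      fix j m assume m: "m |\<in>| \<gamma> j"
      obtain B h where Bh: "m = (B, h)" by force
      have "B |\<in>| fst |`| \<gamma> j" using m Bh by force
      thus "m \<in> Sigma {B. \<forall>k. fset (B k) \<subseteq> fset (U k)} (str (G j))"
        using g m Bh sorted_partition_subset[OF p] by simp
    qed
    thus "s \<in> to_nat ` (Sigma \<Gamma> (\<lambda>\<gamma>. str F (blocks \<gamma>)))" using s f by auto
  qed
  ultimately show "finite (str (comp_sp F G) U)"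
    by (meson finite_SigmaI finite_imageI finite_subset species_finite[OF F])
qed

text \<open>The hypothesis on \<open>D\<close> isolates the block shapes that can occur, so that hypotheses on the
  components are only needed there.\<close>

lemma comp_emb_at:
  assumes F: "functorial F" and G: "\<And>j. functorial (G j)"
    and emb: "\<And>j k'. k' \<in> D j \<Longrightarrow> emb_at k' (G j) (G' j)"
    and D: "\<And>U P f j B. shape U = k \<Longrightarrow> sorted_partition U P \<Longrightarrow> f \<in> str F (codes P)
      \<Longrightarrow> B |\<in>| P j \<Longrightarrow> shape B \<in> D j"
  shows "emb_at k (comp_sp F G) (comp_sp F G')"
proof -
  have "\<exists>\<phi>. \<forall>k'\<in>D j. natural_at k' (G j) (G' j) \<phi>" for j
    using emb_at_glue[of "D j" "G j" "G' j"] emb by metis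
  then obtain \<phi> where \<phi>: "\<And>j k'. k' \<in> D j \<Longrightarrow> natural_at k' (G j) (G' j) (\<phi> j)" by metis
  let ?g = "\<lambda>g j B. \<phi> j B (g j B)"
  \<comment> \<open>A structure fixes its decomposition only up to values of \<open>g\<close> off
    the blocks; these do not affect the new encoding, so the choice is harmless.\<close>
  define \<Phi> where "\<Phi> = (\<lambda>U s. SOME t. \<exists>P g f. s = enc P g f \<and> assembly F G U P g f \<and> t = enc P (?g g) f)"
  have \<Phi>: "\<Phi> U (enc P g f) = enc P (?g g) f" if "assembly F G U P g f" for U P g f
    unfolding \<Phi>_def
  proof (rule someI2_ex)
    show "\<exists>t P' g' f'. enc P g f = enc P' g' f' \<and> assembly F G U P' g' f' \<and> t = enc P' (?g g') f'"
      using that by blast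
  qed (auto simp: enc_eq_iff)
  have "natural_at k (comp_sp F G) (comp_sp F G') \<Phi>"
  proof (rule natural_atI)
    fix U assume U: "shape U = k"
    show "inj_on (\<Phi> U) (str (comp_sp F G) U)"
    proof (rule inj_onI)
      fix s t assume st: "s \<in> str (comp_sp F G) U" "t \<in> str (comp_sp F G) U" "\<Phi> U s = \<Phi> U t"
      obtain P g f where s: "s = enc P g f" "assembly F G U P g f"
        using st(1) unfolding str_comp_iff by blast
      obtain P' g' f' where t: "t = enc P' g' f'" "assembly F G U P' g' f'"
        using st(2) unfolding str_comp_iff by blast
      have eq: "P = P'" "f = f'" "\<And>j B. B |\<in>| P j \<Longrightarrow> \<phi> j B (g j B) = \<phi> j B (g' j B)"
        using st(3) by (simp_all add: s t \<Phi> enc_eq_iff)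
      have "g j B = g' j B" if B: "B |\<in>| P j" for j B
      proof -
        have "shape B \<in> D j" using D[OF U, of P f B j] B s(2) by (auto simp: assembly_def)
        from natural_at_inj[OF \<phi>[OF this] refl] eq(3)[OF B] show ?thesis
          using s(2) t(2) B eq(1) by (auto simp: assembly_def dest: inj_onD)
      qed
      thus "s = t" by (simp add: s t eq enc_eq_iff)
    qed
    fix s assume "s \<in> str (comp_sp F G) U"
    then obtain P g f where s: "s = enc P g f" and a: "assembly F G U P g f"
      unfolding str_comp_iff by blast
    have P: "sorted_partition U P" and g: "\<And>j B. B |\<in>| P j \<Longrightarrow> g j B \<in> str (G j) B"
      and f: "f \<in> str F (codes P)" using a by (auto simp: assembly_def)
    note nat = \<phi>[OF D[OF U P f]]
    show "\<Phi> U s \<in> str (comp_sp F G') U"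
      unfolding s \<Phi>[OF a]
      by (rule enc_in_comp) (auto simp: assembly_def P f g intro: natural_at_in[OF nat refl])
    fix \<sigma> assume \<sigma>: "bij_tuple U \<sigma>"
    let ?h = "transport_blocks G \<sigma> P g"
    note eq = transport_blocks_eq[OF P \<sigma>, of _ _ G g]
    have T: "transport (comp_sp F G) U \<sigma> s = enc (\<lambda>j. relabel \<sigma> |`| P j) ?h
      (transport F (codes P) (on_codes (\<lambda>_. relabel \<sigma>)) f)"
      unfolding s by (rule transport_enc) (rule eq)
    have "transport (comp_sp F G') U \<sigma> (\<Phi> U s) = enc (\<lambda>j. relabel \<sigma> |`| P j) (?g ?h)
      (transport F (codes P) (on_codes (\<lambda>_. relabel \<sigma>)) f)"
      unfolding s \<Phi>[OF a]
    proof (rule transport_enc)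
      fix j B assume B: "B |\<in>| P j"
      have "bij_tuple B \<sigma>" using bij_tuple_mono[OF \<sigma>] sorted_partition_subset[OF P B] .
      from natural_at_transport[OF nat[OF B] refl this g[OF B]]
      show "\<phi> j (relabel \<sigma> B) (?h j (relabel \<sigma> B)) = transport (G' j) B \<sigma> (\<phi> j B (g j B))"
        using eq[OF B] by simp
    qed
    moreover have "\<Phi> (relabel \<sigma> U) (transport (comp_sp F G) U \<sigma> s) = enc (\<lambda>j. relabel \<sigma> |`| P j) (?g ?h)
      (transport F (codes P) (on_codes (\<lambda>_. relabel \<sigma>)) f)"
      unfolding T by (rule \<Phi>[OF assembly_transport[OF F G a \<sigma> eq]])
    ultimately show "\<Phi> (relabel \<sigma> U) (transport (comp_sp F G) U \<sigma> s) = transport (comp_sp F G') U \<sigma> (\<Phi> U s)"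
      by simp
  qed
  thus ?thesis unfolding emb_at_def by blast
qed

lemma comp_iso_at:
  assumes F: "species F" and G: "\<And>j. species (G j)" and G': "\<And>j. species (G' j)"
    and iso: "\<And>j k'. k' \<in> D j \<Longrightarrow> iso_at k' (G j) (G' j)"
    and D: "\<And>U P f j B. shape U = k \<Longrightarrow> sorted_partition U P \<Longrightarrow> f \<in> str F (codes P)
      \<Longrightarrow> B |\<in>| P j \<Longrightarrow> shape B \<in> D j"
  shows "iso_at k (comp_sp F G) (comp_sp F G')"
proof (rule emb_at_antisym)
  show "species (comp_sp F G)" "species (comp_sp F G')" by (intro species_comp F G G')+
  show "emb_at k (comp_sp F G) (comp_sp F G')"
    by (rule comp_emb_at[where D = D]) (simp_all add: species_functorial F G emb_at_iso[OF iso] D)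
  show "emb_at k (comp_sp F G') (comp_sp F G)"
    by (rule comp_emb_at[where D = D])
      (simp_all add: species_functorial F G G' emb_at_iso[OF iso_at_sym[OF _ iso]] D)
qed

section \<open>Quotients by the relabellings of one sort\<close>

lemma option_labels_eqI:
  assumes "W None = V None" "W \<circ> Some = V \<circ> Some"
  shows "W = (V :: 'k option labels)"
proof
  fix i show "W i = V i" using assms by (cases i) (auto simp: fun_eq_iff)
qed

lemma relabel_o: "relabel \<sigma> V \<circ> \<iota> = relabel (\<sigma> \<circ> \<iota>) (V \<circ> \<iota>)"
  by (simp add: relabel_def fun_eq_iff)

lemma bij_tuple_o: "bij_tuple V \<sigma> \<Longrightarrow> bij_tuple (V \<circ> \<iota>) (\<sigma> \<circ> \<iota>)"
  by (simp add: bij_tuple_def)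

lemma bij_tuple_option:
  "bij_tuple W \<sigma> \<longleftrightarrow> inj_on (\<sigma> None) (fset (W None)) \<and> bij_tuple (W \<circ> Some) (\<sigma> \<circ> Some)"
  by (auto simp: bij_tuple_def split: option.split) (metis option.exhaust)

lemma case_option_Some [simp]: "case_option a f \<circ> Some = f"
  by (simp add: fun_eq_iff)

abbreviation on_None :: "(nat \<Rightarrow> nat) \<Rightarrow> 'k option \<Rightarrow> nat \<Rightarrow> nat" where
  "on_None \<beta> \<equiv> case_option \<beta> (\<lambda>_. id)"

text \<open>\<open>W\<close> and \<open>W'\<close> may have different labels of sort
  \<open>None\<close>, so one relation covers the isomorphism classes over all choices of these
  labels. Their number and all other labels are kept.\<close>

definition same_orbit ::
  "'k option spec \<Rightarrow> 'k option labels \<Rightarrow> nat \<Rightarrow> 'k option labels \<Rightarrow> nat \<Rightarrow> bool" where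
  "same_orbit F W s W' s' \<longleftrightarrow> (\<exists>\<beta>. inj_on \<beta> (fset (W None)) \<and>
     relabel (on_None \<beta>) W = W' \<and> transport F W (on_None \<beta>) s = s')"

lemma bij_tuple_on_None [simp]: "bij_tuple W (on_None \<beta>) \<longleftrightarrow> inj_on \<beta> (fset (W None))"
  by (simp add: bij_tuple_option)

lemma relabel_on_None_Some [simp]: "relabel (on_None \<beta>) W \<circ> Some = W \<circ> Some"
  by (simp add: relabel_o)

lemma relabel_on_None_None [simp]: "relabel (on_None \<beta>) W None = \<beta> |`| W None"
  by (simp add: relabel_def)

lemma same_orbit_Some: "same_orbit F W s W' s' \<Longrightarrow> W' \<circ> Some = W \<circ> Some"
  unfolding same_orbit_def by (metis relabel_on_None_Some)

lemma same_orbit_fcard: "same_orbit F W s W' s' \<Longrightarrow> fcard (W' None) = fcard (W None)"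
  unfolding same_orbit_def by (auto simp: fcard.rep_eq card_image)

lemma same_orbit_in: "functorial F \<Longrightarrow> same_orbit F W s W' s' \<Longrightarrow> s \<in> str F W \<Longrightarrow> s' \<in> str F W'"
  unfolding same_orbit_def using transport_in bij_tuple_on_None by metis

text \<open>If \<open>\<beta>\<close> joins the structures, then \<open>\<sigma>'\<close> after
  \<open>\<beta>\<close> after the inverse of \<open>\<sigma>\<close> joins the transported ones.
  This is the identity on the other sorts because \<open>\<sigma>\<close> and
  \<open>\<sigma>'\<close> agree there.\<close>

lemma same_orbit_transport:
  assumes F: "functorial F" and s: "s \<in> str F W" and o: "same_orbit F W s W' s'"
    and \<sigma>: "bij_tuple W \<sigma>" and \<sigma>': "bij_tuple W' \<sigma>'" and eq: "\<sigma> \<circ> Some = \<sigma>' \<circ> Some"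
  shows "same_orbit F (relabel \<sigma> W) (transport F W \<sigma> s) (relabel \<sigma>' W') (transport F W' \<sigma>' s')"
proof -
  obtain \<beta> where \<beta>: "inj_on \<beta> (fset (W None))" and W': "W' = relabel (on_None \<beta>) W"
    and s': "s' = transport F W (on_None \<beta>) s"
    using o unfolding same_orbit_def by blast
  obtain \<tau> where \<tau>: "bij_tuple (relabel \<sigma> W) \<tau>" "\<And>i x. x \<in> fset (W i) \<Longrightarrow> \<tau> i (\<sigma> i x) = x"
    using bij_tuple_inverse[OF \<sigma>] by metis
  define \<gamma> where "\<gamma> = (\<lambda>x. \<sigma>' None (\<beta> (\<tau> None x)))"
  have eqS: "\<sigma>' (Some i) = \<sigma> (Some i)" for i using eq by (simp add: fun_eq_iff)
  have \<gamma>: "on_None \<gamma> i (\<sigma> i x) = \<sigma>' i (on_None \<beta> i x)" if "x \<in> fset (W i)" for i x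
    using that \<tau>(2) eqS by (cases i) (auto simp: \<gamma>_def)
  have inj: "inj_on \<gamma> (fset (relabel \<sigma> W None))"
  proof (rule inj_onI)
    fix x y assume "x \<in> fset (relabel \<sigma> W None)" "y \<in> fset (relabel \<sigma> W None)" and e: "\<gamma> x = \<gamma> y"
    then obtain u v where uv: "x = \<sigma> None u" "y = \<sigma> None v" "u \<in> fset (W None)" "v \<in> fset (W None)"
      by auto
    have "\<sigma>' None (\<beta> u) = \<sigma>' None (\<beta> v)" using e uv \<tau>(2) by (simp add: \<gamma>_def)
    moreover have "inj_on (\<sigma>' None) (\<beta> ` fset (W None))" using \<sigma>' by (simp add: bij_tuple_option W')
    ultimately show "x = y" using \<beta> uv by (auto dest: inj_onD)
  qed
  have bij: "bij_tuple (relabel \<sigma> W) (on_None \<gamma>)" using inj by simp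
  have R: "relabel (on_None \<gamma>) (relabel \<sigma> W) = relabel \<sigma>' W'"
    unfolding W' relabel_comp using \<gamma> by (intro relabel_cong) simp
  have "transport F (relabel \<sigma> W) (on_None \<gamma>) (transport F W \<sigma> s)
      = transport F W (\<lambda>i. on_None \<gamma> i \<circ> \<sigma> i) s"
    by (rule transport_comp[OF F \<sigma> bij s])
  also have "\<dots> = transport F W (\<lambda>i. \<sigma>' i \<circ> on_None \<beta> i) s"
    using \<gamma> by (intro transport_cong[OF F bij_tuple_comp[OF \<sigma> bij] s]) simp
  also have "\<dots> = transport F W' \<sigma>' s'"
    unfolding W' s' using \<beta> \<sigma>' by (intro transport_comp[OF F _ _ s, symmetric]) (auto simp: W')
  finally show ?thesis unfolding same_orbit_def using inj R by blast
qed

lemma same_orbit_refl: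
  assumes "functorial F" "s \<in> str F W"
  shows "same_orbit F W s W s"
proof -
  have 1: "on_None id i x = x" for i :: "'a option" and x by (cases i) auto
  show ?thesis unfolding same_orbit_def
    using transport_fix[OF assms, of "on_None id"] relabel_eq_self[of W "on_None id"] 1
    by (intro exI[of _ id]) auto
qed

lemma same_orbit_trans:
  assumes F: "functorial F" and s: "s \<in> str F W"
    and o: "same_orbit F W s W' s'" "same_orbit F W' s' V t"
  shows "same_orbit F W s V t"
proof -
  obtain \<beta> where \<beta>: "inj_on \<beta> (fset (W None))" and W': "W' = relabel (on_None \<beta>) W"
    and s': "s' = transport F W (on_None \<beta>) s"
    using o(1) unfolding same_orbit_def by blast
  obtain \<gamma> where \<gamma>: "inj_on \<gamma> (fset (W' None))" and V: "V = relabel (on_None \<gamma>) W'"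
    and t: "t = transport F W' (on_None \<gamma>) s'"
    using o(2) unfolding same_orbit_def by blast
  have e: "(\<lambda>i. on_None \<gamma> i \<circ> on_None \<beta> i) = (on_None (\<gamma> \<circ> \<beta>) :: 'a option \<Rightarrow> _)"
    by (auto simp: fun_eq_iff split: option.split)
  show ?thesis unfolding same_orbit_def
  proof (intro exI[of _ "\<gamma> \<circ> \<beta>"] conjI)
    show "inj_on (\<gamma> \<circ> \<beta>) (fset (W None))" using \<beta> \<gamma> by (simp add: W' comp_inj_on)
    show "relabel (on_None (\<gamma> \<circ> \<beta>)) W = V" unfolding V W' relabel_comp e ..
    show "transport F W (on_None (\<gamma> \<circ> \<beta>)) s = t"
      using transport_comp[OF F, of W "on_None \<beta>" "on_None \<gamma>" s] \<beta> \<gamma> s by (simp add: t s' W' e)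
  qed
qed

lemma same_orbit_sym:
  assumes F: "functorial F" and s: "s \<in> str F W" and o: "same_orbit F W s W' s'"
  shows "same_orbit F W' s' W s"
proof -
  obtain \<beta> where \<beta>: "inj_on \<beta> (fset (W None))" and W': "W' = relabel (on_None \<beta>) W"
    and s': "s' = transport F W (on_None \<beta>) s"
    using o unfolding same_orbit_def by blast
  let ?\<gamma> = "inv_into (fset (W None)) \<beta>"
  have i: "on_None ?\<gamma> i (on_None \<beta> i x) = x" if "x \<in> fset (W i)" for i x
    using that \<beta> by (cases i) (auto simp: inv_into_f_f)
  have inj: "inj_on ?\<gamma> (fset (W' None))" by (simp add: W' inj_on_inv_into)
  show ?thesis unfolding same_orbit_def
  proof (intro exI[of _ ?\<gamma>] conjI)
    show "relabel (on_None ?\<gamma>) W' = W" unfolding W' relabel_comp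
      using i by (intro relabel_eq_self) simp
    show "transport F W' (on_None ?\<gamma>) s' = s" unfolding W' s'
      using i \<beta> inj W' by (intro transport_inverse[OF F s]) auto
  qed (rule inj)
qed

text \<open>\<open>Q\<close> is \<open>F(1, Z)\<close>, known through a projection \<open>q\<close>
  that is onto, equivariant, and has the orbits as fibres over each \<open>U\<close>. As
  \<open>Q\<close> is not tied to one coding of orbits, it can be a quotient of different species.
  Finiteness of its structure sets is deliberately left out.\<close>

definition quot :: "'k option spec \<Rightarrow> 'k spec \<Rightarrow> ('k option labels \<Rightarrow> nat \<Rightarrow> nat) \<Rightarrow> bool" where
  "quot F Q q \<longleftrightarrow>
     (\<forall>W s. s \<in> str F W \<longrightarrow> q W s \<in> str Q (W \<circ> Some)) \<and>
     (\<forall>U c. c \<in> str Q U \<longrightarrow> (\<exists>W s. W \<circ> Some = U \<and> s \<in> str F W \<and> q W s = c)) \<and>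
     (\<forall>W s W' s'. s \<in> str F W \<and> s' \<in> str F W' \<and> W \<circ> Some = W' \<circ> Some
        \<longrightarrow> (q W s = q W' s' \<longleftrightarrow> same_orbit F W s W' s')) \<and>
     (\<forall>W \<sigma> s. bij_tuple W \<sigma> \<and> s \<in> str F W
        \<longrightarrow> q (relabel \<sigma> W) (transport F W \<sigma> s) = transport Q (W \<circ> Some) (\<sigma> \<circ> Some) (q W s))"

lemma quotI:
  assumes "\<And>W s. s \<in> str F W \<Longrightarrow> q W s \<in> str Q (W \<circ> Some)"
    "\<And>U c. c \<in> str Q U \<Longrightarrow> \<exists>W s. W \<circ> Some = U \<and> s \<in> str F W \<and> q W s = c"
    "\<And>W s W' s'. s \<in> str F W \<Longrightarrow> s' \<in> str F W' \<Longrightarrow> W \<circ> Some = W' \<circ> Some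
        \<Longrightarrow> q W s = q W' s' \<longleftrightarrow> same_orbit F W s W' s'"
    "\<And>W \<sigma> s. bij_tuple W \<sigma> \<Longrightarrow> s \<in> str F W
        \<Longrightarrow> q (relabel \<sigma> W) (transport F W \<sigma> s) = transport Q (W \<circ> Some) (\<sigma> \<circ> Some) (q W s)"
  shows "quot F Q q"
  unfolding quot_def
  by (intro conjI allI impI; (elim conjE)?) (use assms in blast)+

lemma
  assumes "quot F Q q"
  shows quot_in: "s \<in> str F W \<Longrightarrow> q W s \<in> str Q (W \<circ> Some)"
    and quot_surj: "c \<in> str Q U \<Longrightarrow> \<exists>W s. W \<circ> Some = U \<and> s \<in> str F W \<and> q W s = c"
    and quot_eq_iff: "s \<in> str F W \<Longrightarrow> s' \<in> str F W' \<Longrightarrow> W \<circ> Some = W' \<circ> Some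
        \<Longrightarrow> q W s = q W' s' \<longleftrightarrow> same_orbit F W s W' s'"
    and quot_transport: "bij_tuple W \<sigma> \<Longrightarrow> s \<in> str F W
        \<Longrightarrow> q (relabel \<sigma> W) (transport F W \<sigma> s) = transport Q (W \<circ> Some) (\<sigma> \<circ> Some) (q W s)"
  using assms unfolding quot_def by blast+

text \<open>Each class has a representative, and a bijection of the remaining labels lifts by the
  identity on sort \<open>None\<close>; the laws then descend from \<open>F\<close>.\<close>

lemma quot_functorial:
  assumes F: "functorial F" and q: "quot F Q q"
  shows "functorial Q"
proof (rule functorialI)
  fix U c \<tau> assume \<tau>: "bij_tuple U \<tau>" and "c \<in> str Q U"
  then obtain W s where W: "U = W \<circ> Some" and s: "s \<in> str F W" and c: "c = q W s"
    using quot_surj[OF q] by metis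
  let ?e = "case_option id"
  have \<sigma>: "bij_tuple W (?e \<tau>)" using \<tau> by (simp add: bij_tuple_option W)
  have T: "transport Q U \<tau> c = q (relabel (?e \<tau>) W) (transport F W (?e \<tau>) s)"
    using quot_transport[OF q \<sigma> s] by (simp add: W c)
  show "transport Q U \<tau> c \<in> str Q (relabel \<tau> U)"
    unfolding T using quot_in[OF q transport_in[OF F \<sigma> s]] by (simp add: W relabel_o)
  show "transport Q U \<tau> c = transport Q U \<tau>' c" if e: "\<And>i x. x \<in> fset (U i) \<Longrightarrow> \<tau> i x = \<tau>' i x" for \<tau>'
  proof -
    have e': "?e \<tau> i x = ?e \<tau>' i x" if "x \<in> fset (W i)" for i x
      using that e by (cases i) (auto simp: W)
    have "bij_tuple U \<tau>'" using \<tau> e unfolding bij_tuple_def by (metis inj_on_cong)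
    hence "bij_tuple W (?e \<tau>')" by (simp add: bij_tuple_option W)
    hence "transport Q U \<tau>' c = q (relabel (?e \<tau>') W) (transport F W (?e \<tau>') s)"
      using quot_transport[OF q _ s] by (simp add: W c)
    thus ?thesis unfolding T
      using relabel_cong[of W "?e \<tau>" "?e \<tau>'"] transport_cong[OF F \<sigma> s, of "?e \<tau>'"] e' by simp
  qed
  show "transport Q U (\<lambda>i. \<tau>' i \<circ> \<tau> i) c = transport Q (relabel \<tau> U) \<tau>' (transport Q U \<tau> c)"
    if \<tau>': "bij_tuple (relabel \<tau> U) \<tau>'" for \<tau>'
  proof -
    have \<sigma>': "bij_tuple (relabel (?e \<tau>) W) (?e \<tau>')"
      using \<tau>' by (simp add: bij_tuple_option relabel_o W)
    have e: "(\<lambda>i. ?e \<tau>' i \<circ> ?e \<tau> i) = ?e (\<lambda>i. \<tau>' i \<circ> \<tau> i)"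
      by (auto simp: fun_eq_iff split: option.split)
    have "transport Q (relabel \<tau> U) \<tau>' (transport Q U \<tau> c)
        = q (relabel (?e \<tau>') (relabel (?e \<tau>) W)) (transport F (relabel (?e \<tau>) W) (?e \<tau>') (transport F W (?e \<tau>) s))"
      unfolding T using quot_transport[OF q \<sigma>' transport_in[OF F \<sigma> s]] by (simp add: relabel_o W)
    also have "\<dots> = q (relabel (?e (\<lambda>i. \<tau>' i \<circ> \<tau> i)) W) (transport F W (?e (\<lambda>i. \<tau>' i \<circ> \<tau> i)) s)"
      using transport_comp[OF F \<sigma> \<sigma>' s] by (simp add: relabel_comp e)
    also have "\<dots> = transport Q U (\<lambda>i. \<tau>' i \<circ> \<tau> i) c"
      using quot_transport[OF q bij_tuple_comp[OF \<sigma> \<sigma>'] s] by (simp add: W c e)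
    finally show ?thesis ..
  qed
next
  fix U c assume "c \<in> str Q U"
  then obtain W s where W: "U = W \<circ> Some" and s: "s \<in> str F W" and c: "c = q W s"
    using quot_surj[OF q] by metis
  have e: "(\<lambda>_. id) \<circ> Some = (\<lambda>_. id)" by (simp add: fun_eq_iff)
  show "transport Q U (\<lambda>_. id) c = c"
    using quot_transport[OF q bij_tuple_id s] transport_id[OF F s] by (simp add: W c e)
qed

text \<open>An embedding that is natural for all numbers of new labels acts on orbits. It stays
  injective there: a bijection \<open>\<beta>\<close> joining two images also joins the structures
  themselves, by naturality and injectivity of \<open>\<phi>\<close>.\<close>

lemma quot_map:
  assumes F: "functorial F" and F': "functorial F'" and q: "quot F Q q" and q': "quot F' Q' q'"
    and n: "\<And>a. natural_at (case_option a z) F F' \<phi>"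
  obtains \<psi> where "natural_at z Q Q' \<psi>"
    "\<And>W s. shape (W \<circ> Some) = z \<Longrightarrow> s \<in> str F W \<Longrightarrow> \<psi> (W \<circ> Some) (q W s) = q' W (\<phi> W s)"
proof -
  have n: "natural_at (shape W) F F' \<phi>" if "shape (W \<circ> Some) = z" for W
  proof -
    have "shape W = case_option (fcard (W None)) z"
      using that by (auto simp: fun_eq_iff shape_def split: option.split)
    thus ?thesis using n by simp
  qed
  define \<psi> where "\<psi> = (\<lambda>U c. SOME d. \<exists>W s. W \<circ> Some = U \<and> s \<in> str F W \<and> q W s = c \<and> d = q' W (\<phi> W s))"
  have orb: "same_orbit F' W (\<phi> W s) V (\<phi> V t) \<longleftrightarrow> same_orbit F W s V t"
    if z: "shape (W \<circ> Some) = z" and e: "V \<circ> Some = W \<circ> Some" and s: "s \<in> str F W" and t: "t \<in> str F V"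
    for W s V t
  proof -
    note zV = n[OF z[folded e]] and zW = n[OF z]
    have tr: "\<phi> (relabel (on_None \<beta>) W) (transport F W (on_None \<beta>) s) = transport F' W (on_None \<beta>) (\<phi> W s)"
      if "inj_on \<beta> (fset (W None))" for \<beta>
      using natural_at_transport[OF zW refl _ s] that by simp
    show ?thesis
    proof
      assume "same_orbit F' W (\<phi> W s) V (\<phi> V t)"
      then obtain \<beta> where \<beta>: "inj_on \<beta> (fset (W None))" "relabel (on_None \<beta>) W = V"
        "transport F' W (on_None \<beta>) (\<phi> W s) = \<phi> V t" unfolding same_orbit_def by blast
      have "\<phi> V (transport F W (on_None \<beta>) s) = \<phi> V t" using tr[OF \<beta>(1)] \<beta> by simp
      moreover have "transport F W (on_None \<beta>) s \<in> str F V"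
        using transport_in[OF F _ s, of "on_None \<beta>"] \<beta> by simp
      ultimately have "transport F W (on_None \<beta>) s = t"
        using natural_at_inj[OF zV refl] t by (auto dest: inj_onD)
      thus "same_orbit F W s V t" unfolding same_orbit_def using \<beta> by blast
    next
      assume "same_orbit F W s V t"
      then obtain \<beta> where \<beta>: "inj_on \<beta> (fset (W None))" "relabel (on_None \<beta>) W = V"
        "transport F W (on_None \<beta>) s = t" unfolding same_orbit_def by blast
      thus "same_orbit F' W (\<phi> W s) V (\<phi> V t)" unfolding same_orbit_def using tr[OF \<beta>(1)] by auto
    qed
  qed
  have \<psi>: "\<psi> (W \<circ> Some) (q W s) = q' W (\<phi> W s)" if z: "shape (W \<circ> Some) = z" and s: "s \<in> str F W" for W s
    unfolding \<psi>_def
  proof (rule someI2_ex)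
    show "\<exists>d W' s'. W' \<circ> Some = W \<circ> Some \<and> s' \<in> str F W' \<and> q W' s' = q W s \<and> d = q' W' (\<phi> W' s')"
      using s by blast
    fix d assume "\<exists>W' s'. W' \<circ> Some = W \<circ> Some \<and> s' \<in> str F W' \<and> q W' s' = q W s \<and> d = q' W' (\<phi> W' s')"
    then obtain V t where V: "V \<circ> Some = W \<circ> Some" "t \<in> str F V" "q V t = q W s" "d = q' V (\<phi> V t)"
      by blast
    have "same_orbit F W s V t" using quot_eq_iff[OF q s V(2)] V by simp
    hence "same_orbit F' W (\<phi> W s) V (\<phi> V t)" using orb[OF z V(1) s V(2)] by simp
    moreover have "\<phi> V t \<in> str F' V" using natural_at_in[OF n refl V(2)] z unfolding V(1) .
    ultimately have "q' W (\<phi> W s) = q' V (\<phi> V t)"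
      using quot_eq_iff[OF q' natural_at_in[OF n[OF z] refl s] _ V(1)[symmetric]] by blast
    thus "d = q' W (\<phi> W s)" unfolding V(4) ..
  qed
  have "natural_at z Q Q' \<psi>"
  proof (rule natural_atI)
    fix U assume z: "shape U = z"
    show "inj_on (\<psi> U) (str Q U)"
    proof (rule inj_onI)
      fix c d assume cd: "c \<in> str Q U" "d \<in> str Q U" "\<psi> U c = \<psi> U d"
      obtain W s where W: "W \<circ> Some = U" "s \<in> str F W" "q W s = c" using quot_surj[OF q cd(1)] by blast
      obtain V t where V: "V \<circ> Some = U" "t \<in> str F V" "q V t = d" using quot_surj[OF q cd(2)] by blast
      have "q' W (\<phi> W s) = q' V (\<phi> V t)" using \<psi>[of W s] \<psi>[of V t] W V z cd(3) by simp
      hence "same_orbit F' W (\<phi> W s) V (\<phi> V t)"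
        using quot_eq_iff[OF q' natural_at_in[OF n[of W] refl W(2)] natural_at_in[OF n[of V] refl V(2)]] W V z
        by simp
      hence "same_orbit F W s V t" using orb[of W V s t] W V z by simp
      thus "c = d" using quot_eq_iff[OF q W(2) V(2)] W V by simp
    qed
    fix c assume c: "c \<in> str Q U"
    obtain W s where W: "W \<circ> Some = U" "s \<in> str F W" "q W s = c" using quot_surj[OF q c] by blast
    have W': "shape (W \<circ> Some) = z" using W z by simp
    show "\<psi> U c \<in> str Q' U"
      using \<psi>[OF W' W(2)] quot_in[OF q' natural_at_in[OF n[OF W'] refl W(2)]] W by simp
    fix \<tau> assume \<tau>: "bij_tuple U \<tau>"
    let ?\<sigma> = "case_option id \<tau>"
    have \<sigma>: "bij_tuple W ?\<sigma>" using \<tau> W by (simp add: bij_tuple_option)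
    have "transport Q U \<tau> c = q (relabel ?\<sigma> W) (transport F W ?\<sigma> s)"
      using quot_transport[OF q \<sigma> W(2)] W by simp
    moreover have "\<psi> (relabel \<tau> U) (q (relabel ?\<sigma> W) (transport F W ?\<sigma> s))
        = q' (relabel ?\<sigma> W) (\<phi> (relabel ?\<sigma> W) (transport F W ?\<sigma> s))"
      using \<psi>[OF _ transport_in[OF F \<sigma> W(2)]] W \<tau> z by (simp add: relabel_o)
    ultimately show "\<psi> (relabel \<tau> U) (transport Q U \<tau> c) = transport Q' U \<tau> (\<psi> U c)"
      using natural_at_transport[OF n[OF W'] refl \<sigma> W(2)] \<psi>[OF W' W(2)] W
        quot_transport[OF q' \<sigma> natural_at_in[OF n[OF W'] refl W(2)]] by simp
  qed
  thus thesis using \<psi> by (rule that)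
qed

text \<open>Surjectivity descends as well. The hypothesis ranges over all \<open>a\<close>, since
  the classes over \<open>U\<close> come from structures with any number of new labels.\<close>

lemma quot_iso_at:
  assumes F: "functorial F" and F': "functorial F'" and q: "quot F Q q" and q': "quot F' Q' q'"
    and iso: "\<And>a. iso_at (case_option a z) F F'"
  shows "iso_at z Q Q'"
proof -
  obtain \<phi>0 where \<phi>0: "\<And>a. natural_at (case_option a z) F F' (\<phi>0 a)"
    "\<And>a W. shape W = case_option a z \<Longrightarrow> \<phi>0 a W ` str F W = str F' W"
    using iso unfolding iso_at_def by metis
  define \<phi> where "\<phi> = (\<lambda>W. \<phi>0 (shape W None) W)"
  have n: "natural_at (case_option a z) F F' \<phi>" for a
    using \<phi>0(1)[of a] by (simp add: natural_at_def \<phi>_def)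
  obtain \<psi> where \<psi>: "natural_at z Q Q' \<psi>"
    "\<And>W s. shape (W \<circ> Some) = z \<Longrightarrow> s \<in> str F W \<Longrightarrow> \<psi> (W \<circ> Some) (q W s) = q' W (\<phi> W s)"
    using quot_map[OF F F' q q' n] by blast
  show ?thesis
  proof (rule iso_atI[OF \<psi>(1)])
    fix U c assume U: "shape U = z" and "c \<in> str Q' U"
    then obtain W t where W: "W \<circ> Some = U" "t \<in> str F' W" "q' W t = c" using quot_surj[OF q'] by blast
    have "shape W = case_option (shape W None) z"
      using W(1) U by (auto simp: fun_eq_iff shape_def split: option.split)
    hence "\<phi> W ` str F W = str F' W" unfolding \<phi>_def by (rule \<phi>0(2))
    then obtain s where "s \<in> str F W" "\<phi> W s = t" using W(2) by (metis imageE)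
    thus "c \<in> \<psi> U ` str Q U"
      using \<psi>(2)[of W s] W U quot_in[OF q, of s W] by (intro image_eqI[of _ _ "q W s"]) auto
  qed
qed

text \<open>The bound on the number of orbits makes the induced injection of orbits onto, so every
  \<open>t\<close> lies in the orbit of some image \<open>\<phi> V s\<close>. Images are closed
  under relabelling, hence \<open>t\<close> is itself an image. The count at \<open>z\<close> thus
  controls every \<open>a\<close> at once.\<close>

lemma quot_emb_iso_at:
  assumes F: "functorial F" and F': "functorial F'" and q: "quot F Q q" and q': "quot F' Q' q'"
    and emb: "\<And>a. emb_at (case_option a z) F F'"
    and card: "\<And>U. shape U = z \<Longrightarrow> finite (str Q' U) \<and> card (str Q' U) \<le> card (str Q U)"
  shows "iso_at (case_option a z) F F'"
proof -
  obtain \<phi> where n': "\<And>k. k \<in> range (\<lambda>a. case_option a z) \<Longrightarrow> natural_at k F F' \<phi>"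
    using emb_at_glue[of "range (\<lambda>a. case_option a z)" F F'] emb by blast
  have n: "natural_at (case_option a z) F F' \<phi>" for a using n' by blast
  obtain \<psi> where \<psi>: "natural_at z Q Q' \<psi>"
    "\<And>W s. shape (W \<circ> Some) = z \<Longrightarrow> s \<in> str F W \<Longrightarrow> \<psi> (W \<circ> Some) (q W s) = q' W (\<phi> W s)"
    using quot_map[OF F F' q q' n] by blast
  show ?thesis
  proof (rule iso_atI[OF n])
    fix W t assume W: "shape W = case_option a z" and t: "t \<in> str F' W"
    have U: "shape (W \<circ> Some) = z" using W by (auto simp: shape_def fun_eq_iff)
    have "\<psi> (W \<circ> Some) ` str Q (W \<circ> Some) = str Q' (W \<circ> Some)"
      using card[OF U] natural_at_inj[OF \<psi>(1) U] natural_at_in[OF \<psi>(1) U]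
      by (intro card_seteq) (auto simp: card_image)
    hence "q' W t \<in> \<psi> (W \<circ> Some) ` str Q (W \<circ> Some)" using quot_in[OF q' t] by simp
    then obtain c where c: "c \<in> str Q (W \<circ> Some)" "\<psi> (W \<circ> Some) c = q' W t" by (metis imageE)
    obtain V s where V: "V \<circ> Some = W \<circ> Some" "s \<in> str F V" "q V s = c"
      using quot_surj[OF q c(1)] by blast
    have zV: "shape V = case_option (shape V None) z"
      using V(1) U by (auto simp: fun_eq_iff shape_def split: option.split)
    have "q' V (\<phi> V s) = q' W t" using \<psi>(2)[of V s] V c U by simp
    hence "same_orbit F' V (\<phi> V s) W t"
      using quot_eq_iff[OF q' natural_at_in[OF n zV V(2)] t] V by simp
    then obtain \<beta> where \<beta>: "inj_on \<beta> (fset (V None))" "relabel (on_None \<beta>) V = W"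
        "transport F' V (on_None \<beta>) (\<phi> V s) = t" unfolding same_orbit_def by blast
    have "\<phi> W (transport F V (on_None \<beta>) s) = t"
      using natural_at_transport[OF n zV _ V(2), of "on_None \<beta>"] \<beta> by simp
    moreover have "transport F V (on_None \<beta>) s \<in> str F W"
      using transport_in[OF F _ V(2), of "on_None \<beta>"] \<beta> by simp
    ultimately show "t \<in> \<phi> W ` str F W" by blast
  qed
qed

text \<open>\<open>R\<close> is a correspondence over the same remaining labels, total on both
  sides, that matches orbits with orbits and lifts transports. The class of \<open>s'\<close> is
  defined as that of any partner \<open>s\<close>. Partners may differ in their labels of sort
  \<open>None\<close>, even in the number of these.\<close>

lemma quot_transfer:
  assumes F: "functorial F" and F': "functorial F'" and q: "quot F Q q"
    and R: "\<And>W s W' s'. R W s W' s' \<Longrightarrow> s \<in> str F W \<and> s' \<in> str F' W' \<and> W \<circ> Some = W' \<circ> Some"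
    and L: "\<And>W s. s \<in> str F W \<Longrightarrow> \<exists>W' s'. R W s W' s'"
    and L': "\<And>W' s'. s' \<in> str F' W' \<Longrightarrow> \<exists>W s. R W s W' s'"
    and orb: "\<And>W s W' s' V t V' t'. R W s W' s' \<Longrightarrow> R V t V' t' \<Longrightarrow> W \<circ> Some = V \<circ> Some
      \<Longrightarrow> same_orbit F W s V t \<longleftrightarrow> same_orbit F' W' s' V' t'"
    and tr: "\<And>W s W' s' \<sigma>'. R W s W' s' \<Longrightarrow> bij_tuple W' \<sigma>' \<Longrightarrow>
      \<exists>\<sigma>. bij_tuple W \<sigma> \<and> \<sigma> \<circ> Some = \<sigma>' \<circ> Some \<and>
        R (relabel \<sigma> W) (transport F W \<sigma> s) (relabel \<sigma>' W') (transport F' W' \<sigma>' s')"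
  shows "\<exists>q'. quot F' Q q'"
proof -
  define q' where "q' = (\<lambda>W' s'. SOME c. \<exists>W s. R W s W' s' \<and> c = q W s)"
  have q'_eq: "q' W' s' = q W s" if r: "R W s W' s'" for W s W' s'
    unfolding q'_def
  proof (rule someI2_ex)
    show "\<exists>c W s. R W s W' s' \<and> c = q W s" using r by blast
    fix c assume "\<exists>W s. R W s W' s' \<and> c = q W s"
    then obtain V t where V: "R V t W' s'" "c = q V t" by blast
    have "same_orbit F W s V t"
      using orb[OF r V(1)] R[OF r] R[OF V(1)] same_orbit_refl[OF F'] by simp
    thus "c = q W s" using quot_eq_iff[OF q, of s W t V] R[OF r] R[OF V(1)] V by simp
  qed
  show ?thesis
  proof (intro exI[of _ q'] quotI)
    fix W' s' assume "s' \<in> str F' W'"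
    then obtain W s where r: "R W s W' s'" using L' by blast
    show "q' W' s' \<in> str Q (W' \<circ> Some)" using q'_eq[OF r] quot_in[OF q, of s W] R[OF r] by simp
    show "q' W' s' = q' V' t' \<longleftrightarrow> same_orbit F' W' s' V' t'" if t': "t' \<in> str F' V'" and e: "W' \<circ> Some = V' \<circ> Some"
      for V' t'
    proof -
      obtain V t where r2: "R V t V' t'" using L' t' by blast
      show ?thesis
        using q'_eq[OF r] q'_eq[OF r2] quot_eq_iff[OF q, of s W t V] R[OF r] R[OF r2] e orb[OF r r2] by simp
    qed
    show "q' (relabel \<sigma>' W') (transport F' W' \<sigma>' s') = transport Q (W' \<circ> Some) (\<sigma>' \<circ> Some) (q' W' s')"
      if \<sigma>': "bij_tuple W' \<sigma>'" for \<sigma>'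
    proof -
      obtain \<sigma> where \<sigma>: "bij_tuple W \<sigma>" and e: "\<sigma> \<circ> Some = \<sigma>' \<circ> Some"
        and r2: "R (relabel \<sigma> W) (transport F W \<sigma> s) (relabel \<sigma>' W') (transport F' W' \<sigma>' s')"
        using tr[OF r \<sigma>'] by blast
      show ?thesis using q'_eq[OF r] q'_eq[OF r2] quot_transport[OF q \<sigma>, of s] R[OF r] e by simp
    qed
  next
    fix U c assume "c \<in> str Q U"
    then obtain W s where W: "W \<circ> Some = U" "s \<in> str F W" "q W s = c" using quot_surj[OF q] by blast
    then obtain W' s' where r: "R W s W' s'" using L by blast
    thus "\<exists>W' s'. W' \<circ> Some = U \<and> s' \<in> str F' W' \<and> q' W' s' = c" using q'_eq[OF r] R[OF r] W by auto
  qed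
qed

section \<open>The concrete quotient \<open>at_one\<close> on standard labels\<close>

lemma fcard_eq_1E:
  assumes "fcard A = 1"
  obtains a where "A = {|a|}"
proof -
  obtain a where "fset A = {a}" using assms by (auto simp: fcard.rep_eq card_1_singleton_iff)
  thus thesis by (intro that[of a]) (simp add: fset_inject[symmetric])
qed

lemma std_ext_simps [simp]:
  "fset (std_ext k U None) = {1..k}" "std_ext k U (Some i) = U i" "std_ext k U \<circ> Some = U"
  "fcard (std_ext k U None) = k"
proof -
  show *: "fset (std_ext k U None) = {1..k}" unfolding std_ext_def option.case by (rule fset_std)
  show "fcard (std_ext k U None) = k" by (simp add: fcard.rep_eq *)
qed (simp_all add: std_ext_def)

lemma ex_same_orbit_std:
  assumes "functorial F" "s \<in> str F W"
  obtains t where "same_orbit F W s (std_ext (fcard (W None)) (W \<circ> Some)) t"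
proof -
  obtain \<beta> where \<beta>: "bij_betw \<beta> (fset (W None)) {1..fcard (W None)}"
    using finite_same_card_bij[of "fset (W None)" "{1..fcard (W None)}"]
    unfolding fcard.rep_eq by auto
  have "relabel (on_None \<beta>) W = std_ext (fcard (W None)) (W \<circ> Some)"
  proof (rule option_labels_eqI)
    show "relabel (on_None \<beta>) W None = std_ext (fcard (W None)) (W \<circ> Some) None"
      by (rule fset_inject[THEN iffD1]) (use \<beta> in \<open>simp add: bij_betw_def\<close>)
  qed simp
  moreover have "inj_on \<beta> (fset (W None))" using \<beta> by (simp add: bij_betw_def)
  ultimately show thesis
    by (intro that[of "transport F W (on_None \<beta>) s"]) (unfold same_orbit_def, blast)
qed

text \<open>A bijection of \<open>{1..k}\<close> onto itself becomes a permutation when extended by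
  the identity, with the same transport. So the orbits coded by \<open>at_one\<close> are those of
  \<open>same_orbit\<close>.\<close>

lemma orbit_permutations:
  assumes F: "functorial F" and s: "s \<in> str F (std_ext k U)"
  shows "{transport F (std_ext k U) (on_None \<rho>) s | \<rho>. \<rho> permutes {1..k}}
    = {t. same_orbit F (std_ext k U) s (std_ext k U) t}" (is "?L = ?R")
proof
  show "?L \<subseteq> ?R"
  proof
    fix t assume "t \<in> ?L"
    then obtain \<rho> where \<rho>: "\<rho> permutes {1..k}" "t = transport F (std_ext k U) (on_None \<rho>) s" by blast
    have "relabel (on_None \<rho>) (std_ext k U) = std_ext k U"
    proof (rule option_labels_eqI)
      show "relabel (on_None \<rho>) (std_ext k U) None = std_ext k U None"
        by (rule fset_inject[THEN iffD1]) (use permutes_image[OF \<rho>(1)] in simp)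
    qed simp
    thus "t \<in> ?R" using \<rho> permutes_inj_on[OF \<rho>(1)] unfolding same_orbit_def by auto
  qed
  show "?R \<subseteq> ?L"
  proof
    fix t assume "t \<in> ?R"
    then obtain \<beta> where \<beta>: "inj_on \<beta> {1..k}" "relabel (on_None \<beta>) (std_ext k U) = std_ext k U"
      "t = transport F (std_ext k U) (on_None \<beta>) s" unfolding same_orbit_def by auto
    have im: "\<beta> ` {1..k} = {1..k}"
      using arg_cong[OF \<beta>(2), of "\<lambda>W. fset (W None)"] by simp
    let ?\<rho> = "\<lambda>x. if x \<in> {1..k} then \<beta> x else x"
    have "bij_betw \<beta> {1..k} {1..k}" using \<beta>(1) im by (simp add: bij_betw_def)
    hence "bij_betw ?\<rho> {1..k} {1..k}" by (rule bij_betw_cong[THEN iffD1, rotated]) simp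
    hence "?\<rho> permutes {1..k}" by (rule bij_imp_permutes) auto
    moreover have "transport F (std_ext k U) (on_None \<beta>) s = transport F (std_ext k U) (on_None ?\<rho>) s"
    proof (rule transport_cong[OF F _ s])
      show "on_None \<beta> i x = on_None ?\<rho> i x" if "x \<in> fset (std_ext k U i)" for i x
        using that by (cases i) auto
    qed (use \<beta> in simp)
    ultimately show "t \<in> ?L" using \<beta>(3) by blast
  qed
qed

text \<open>The part of the orbit of \<open>s\<close> that lies on the standard labels. As
  \<open>W\<close> is arbitrary, pairing it with the number of labels of sort \<open>None\<close>
  gives a projection onto \<open>at_one\<close>.\<close>

definition std_orbit :: "'k option spec \<Rightarrow> 'k option labels \<Rightarrow> nat \<Rightarrow> nat set" where
  "std_orbit F W s = {t. same_orbit F W s (std_ext (fcard (W None)) (W \<circ> Some)) t}"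

lemma std_orbit_cong:
  assumes F: "functorial F" and s: "s \<in> str F W" and o: "same_orbit F W s W' s'"
  shows "std_orbit F W' s' = std_orbit F W s"
proof -
  have s': "s' \<in> str F W'" by (rule same_orbit_in[OF F o s])
  show ?thesis unfolding std_orbit_def same_orbit_Some[OF o] same_orbit_fcard[OF o]
    using same_orbit_trans[OF F s o] same_orbit_trans[OF F s' same_orbit_sym[OF F s o]] by blast
qed

lemma finite_std_orbit:
  assumes F: "functorial F" and s: "s \<in> str F W"
  shows "finite (std_orbit F W s)"
proof -
  let ?W = "std_ext (fcard (W None)) (W \<circ> Some)"
  obtain t where t: "same_orbit F W s ?W t" using ex_same_orbit_std[OF assms] .
  have t': "t \<in> str F ?W" by (rule same_orbit_in[OF F t s])
  have "std_orbit F W s = std_orbit F ?W t" by (rule std_orbit_cong[OF F s t, symmetric])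
  also have "\<dots> = {transport F ?W (on_None \<rho>) t | \<rho>. \<rho> permutes {1..fcard (W None)}}"
    unfolding std_orbit_def using orbit_permutations[OF F t'] by simp
  also have "finite \<dots>" by (simp add: finite_permutations setcompr_eq_image)
  finally show ?thesis .
qed

lemma str_at_one:
  assumes F: "functorial F"
  shows "str (at_one F) U =
    {to_nat (k, Abs_fset (std_orbit F (std_ext k U) s)) | k s. s \<in> str F (std_ext k U)}"
proof -
  have *: "std_orbit F (std_ext k U) s =
      {transport F (std_ext k U) (on_None \<rho>) s | \<rho>. \<rho> permutes {1..k}}" if "s \<in> str F (std_ext k U)" for k s
    using orbit_permutations[OF F that] by (simp add: std_orbit_def)
  show ?thesis
  proof (intro set_eqI iffI)
    fix c assume "c \<in> str (at_one F) U"
    then obtain k s where c: "c = to_nat (k, Abs_fset {transport F (std_ext k U) (on_None \<rho>) s | \<rho>. \<rho> permutes {1..k}})"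
      and s: "s \<in> str F (std_ext k U)" unfolding at_one_def spec.simps by blast
    have "c = to_nat (k, Abs_fset (std_orbit F (std_ext k U) s))" by (simp only: c *[OF s])
    thus "c \<in> {to_nat (k, Abs_fset (std_orbit F (std_ext k U) s)) | k s. s \<in> str F (std_ext k U)}"
      using s by blast
  next
    fix c assume "c \<in> {to_nat (k, Abs_fset (std_orbit F (std_ext k U) s)) | k s. s \<in> str F (std_ext k U)}"
    then obtain k s where c: "c = to_nat (k, Abs_fset (std_orbit F (std_ext k U) s))"
      and s: "s \<in> str F (std_ext k U)" by blast
    have "c = to_nat (k, Abs_fset {transport F (std_ext k U) (on_None \<rho>) s | \<rho>. \<rho> permutes {1..k}})"
      by (simp only: c *[OF s])
    thus "c \<in> str (at_one F) U" unfolding at_one_def spec.simps using s by blast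
  qed
qed

text \<open>An orbit meets the standard labels in a finite nonempty set, and this set determines the
  orbit. Finiteness is what makes \<open>Abs_fset\<close> injective on these sets.\<close>

lemma quot_at_one:
  assumes F: "functorial F"
  shows "quot F (at_one F) (\<lambda>W s. to_nat (fcard (W None), Abs_fset (std_orbit F W s)))" (is "quot _ _ ?q")
proof (rule quotI)
  fix W s assume s: "s \<in> str F W"
  let ?W = "std_ext (fcard (W None)) (W \<circ> Some)"
  obtain t where t: "same_orbit F W s ?W t" using ex_same_orbit_std[OF F s] .
  have t': "t \<in> str F ?W" by (rule same_orbit_in[OF F t s])
  show "?q W s \<in> str (at_one F) (W \<circ> Some)"
    unfolding str_at_one[OF F] std_orbit_cong[OF F s t, symmetric] using t' by blast
  show "?q W s = ?q W' s' \<longleftrightarrow> same_orbit F W s W' s'"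
    if s': "s' \<in> str F W'" and e: "W \<circ> Some = W' \<circ> Some" for W' s'
  proof
    assume "?q W s = ?q W' s'"
    hence k: "fcard (W None) = fcard (W' None)"
      and "Abs_fset (std_orbit F W s) = Abs_fset (std_orbit F W' s')" by simp_all
    hence "std_orbit F W s = std_orbit F W' s'"
      using finite_std_orbit[OF F s] finite_std_orbit[OF F s'] by (simp add: Abs_fset_inject)
    moreover have "t \<in> std_orbit F W s" using t by (simp add: std_orbit_def)
    ultimately have "same_orbit F W' s' ?W t" using e k by (simp add: std_orbit_def)
    from same_orbit_sym[OF F s' this] show "same_orbit F W s W' s'" by (rule same_orbit_trans[OF F s t])
  next
    assume "same_orbit F W s W' s'"
    thus "?q W s = ?q W' s'" using std_orbit_cong[OF F s] same_orbit_fcard by metis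
  qed
  show "?q (relabel \<sigma> W) (transport F W \<sigma> s) = transport (at_one F) (W \<circ> Some) (\<sigma> \<circ> Some) (?q W s)"
    if \<sigma>: "bij_tuple W \<sigma>" for \<sigma>
  proof -
    let ?\<sigma> = "case_option id (\<sigma> \<circ> Some) :: 'a option \<Rightarrow> nat \<Rightarrow> nat"
    have k: "fcard (relabel \<sigma> W None) = fcard (W None)"
      using shape_relabel[OF \<sigma>] unfolding shape_def by metis
    have \<sigma>': "bij_tuple ?W ?\<sigma>" using bij_tuple_o[OF \<sigma>, of Some] by (simp add: bij_tuple_option)
    have W': "relabel ?\<sigma> ?W = std_ext (fcard (W None)) (relabel \<sigma> W \<circ> Some)"
      by (rule option_labels_eqI) (simp_all add: relabel_o, simp add: relabel_def std_ext_def)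
    have "std_orbit F (relabel \<sigma> W) (transport F W \<sigma> s) = transport F ?W ?\<sigma> ` std_orbit F W s"
    proof (intro set_eqI iffI)
      fix u assume "u \<in> transport F ?W ?\<sigma> ` std_orbit F W s"
      then obtain v where v: "same_orbit F W s ?W v" "u = transport F ?W ?\<sigma> v"
        by (auto simp: std_orbit_def)
      show "u \<in> std_orbit F (relabel \<sigma> W) (transport F W \<sigma> s)"
        using same_orbit_transport[OF F s v(1) \<sigma> \<sigma>'] v(2) by (simp add: std_orbit_def k W')
    next
      fix u assume "u \<in> std_orbit F (relabel \<sigma> W) (transport F W \<sigma> s)"
      hence u: "same_orbit F (relabel \<sigma> W) (transport F W \<sigma> s) (relabel ?\<sigma> ?W) u"
        by (simp add: std_orbit_def k W')
      have u': "u \<in> str F (relabel ?\<sigma> ?W)" by (rule same_orbit_in[OF F u transport_in[OF F \<sigma> s]])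
      then obtain v where v: "v \<in> str F ?W" "u = transport F ?W ?\<sigma> v"
        using transport_bij[OF F \<sigma>'] by (auto simp: bij_betw_def)
      \<comment> \<open>The orbit relation is carried back along inverses of \<open>\<sigma>\<close>
        and \<open>?\<sigma>\<close>, which again agree on the remaining sorts.\<close>
      obtain \<tau> where \<tau>: "bij_tuple (relabel \<sigma> W) \<tau>" "relabel \<tau> (relabel \<sigma> W) = W"
        "\<And>i x. x \<in> fset (W i) \<Longrightarrow> \<tau> i (\<sigma> i x) = x"
        using bij_tuple_inverse[OF \<sigma>] by metis
      let ?\<tau> = "case_option id (\<tau> \<circ> Some) :: 'a option \<Rightarrow> nat \<Rightarrow> nat"
      have \<tau>': "bij_tuple (relabel ?\<sigma> ?W) ?\<tau>"
        using bij_tuple_o[OF \<tau>(1), of Some] by (simp add: bij_tuple_option relabel_o)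
      have inv: "?\<tau> i (?\<sigma> i x) = x" if "x \<in> fset (?W i)" for i x
        using that \<tau>(3) by (cases i) auto
      have "relabel ?\<tau> (relabel ?\<sigma> ?W) = ?W"
        unfolding relabel_comp using inv by (intro relabel_eq_self) simp
      moreover have "transport F (relabel ?\<sigma> ?W) ?\<tau> u = v"
        unfolding v(2) by (rule transport_inverse[OF F v(1) \<sigma>' \<tau>' inv])
      moreover have "transport F (relabel \<sigma> W) \<tau> (transport F W \<sigma> s) = s"
        by (rule transport_inverse[OF F s \<sigma> \<tau>(1,3)])
      ultimately have "same_orbit F W s ?W v"
        using same_orbit_transport[OF F transport_in[OF F \<sigma> s] u \<tau>(1) \<tau>'] \<tau>(2) by simp
      thus "u \<in> transport F ?W ?\<sigma> ` std_orbit F W s" using v(2) by (auto simp: std_orbit_def)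
    qed
    hence "Abs_fset (std_orbit F (relabel \<sigma> W) (transport F W \<sigma> s))
        = transport F ?W ?\<sigma> |`| Abs_fset (std_orbit F W s)"
      using finite_std_orbit[OF F s] by (simp add: fimage_def Abs_fset_inverse map_fun_def)
    thus ?thesis unfolding at_one_def spec.simps k by simp
  qed
next
  fix U c assume "c \<in> str (at_one F) U"
  then obtain k s where "c = to_nat (k, Abs_fset (std_orbit F (std_ext k U) s))" "s \<in> str F (std_ext k U)"
    unfolding str_at_one[OF F] by blast
  thus "\<exists>W s. W \<circ> Some = U \<and> s \<in> str F W \<and> ?q W s = c"
    by (intro exI[of _ "std_ext k U"] exI[of _ s]) simp
qed

lemma functorial_at_one: "functorial F \<Longrightarrow> functorial (at_one F)"
  using quot_functorial quot_at_one by blast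

section \<open>The atomic species and the marking of size-zero structures\<close>

lemma zero_simps [simp]: "str zero_sp U = {}" "is_zero zero_sp"
  by (simp_all add: zero_sp_def is_zero_def)

lemma species_zero: "species zero_sp"
  unfolding species_iff by (auto intro!: functorialI)

lemma quot_zero: "quot zero_sp zero_sp (\<lambda>_ s. s)"
  by (rule quotI) simp_all

lemma sort_sp_simps:
  "s \<in> str (sort_sp i) U \<longleftrightarrow> s = 0 \<and> fcard (U i) = 1 \<and> (\<forall>j. j \<noteq> i \<longrightarrow> U j = {||})"
  "transport (sort_sp i) U \<sigma> s = s"
  by (simp_all add: sort_sp_def)

lemma species_sort: "species (sort_sp i)"
  unfolding species_iff
proof (intro conjI allI functorialI)
  show "transport (sort_sp i) U \<sigma> s \<in> str (sort_sp i) (relabel \<sigma> U)"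
    if "bij_tuple U \<sigma>" "s \<in> str (sort_sp i) U" for U \<sigma> s
    using that by (auto simp: sort_sp_simps relabel_def bij_tuple_def fcard.rep_eq card_image)
  show "finite (str (sort_sp i) U)" for U
    by (rule finite_subset[of _ "{0}"]) (auto simp: sort_sp_simps)
qed (simp_all add: sort_sp_simps)

text \<open>A structure of the old sort \<open>Some i\<close> has no label of sort
  \<open>None\<close>, so its orbit is a single structure.\<close>

lemma quot_sort: "quot (sort_sp (Some i)) (sort_sp i) (\<lambda>_ s. s)"
proof (rule quotI)
  fix U c assume "c \<in> str (sort_sp i) U"
  hence "c \<in> str (sort_sp (Some i)) (case_option {||} U)"
    by (auto simp: sort_sp_simps split: option.split)
  thus "\<exists>W s. W \<circ> Some = U \<and> s \<in> str (sort_sp (Some i)) W \<and> s = c"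
    by (intro exI[of _ "case_option {||} U"]) simp
next
  fix W s W' s'
  assume s: "s \<in> str (sort_sp (Some i)) W" "s' \<in> str (sort_sp (Some i)) W'" and e: "W \<circ> Some = W' \<circ> Some"
  have "W = W'" using s e by (intro option_labels_eqI) (auto simp: sort_sp_simps)
  moreover have "s = s'" using s by (simp add: sort_sp_simps)
  ultimately show "s = s' \<longleftrightarrow> same_orbit (sort_sp (Some i)) W s W' s'"
    using same_orbit_refl[OF species_functorial[OF species_sort] s(1)] by simp
qed (simp_all add: sort_sp_simps)

text \<open>\<open>unmarked\<close> and \<open>marked\<close> are the codes that
  \<open>plus_sp\<close> and \<open>times_sp\<close> give to the two summands of
  \<open>mark_zero\<close>: an old structure, or a structure \<open>h\<close> of size 0 beside the
  structure 0 of the new sort, which occupies all of \<open>V\<close>.\<close>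

definition unmarked :: "nat \<Rightarrow> nat" where
  "unmarked y = to_nat (Inl y :: nat + nat)"

definition marked :: "'b::finite labels \<Rightarrow> nat \<Rightarrow> nat" where
  "marked V h = to_nat (Inr (to_nat (V, no_labels :: 'b labels, 0 :: nat, h)) :: nat + nat)"

lemma marked_simps [simp]:
  "unmarked y = unmarked y' \<longleftrightarrow> y = y'" "marked V h = marked V' h' \<longleftrightarrow> V = V' \<and> h = h'"
  "unmarked y \<noteq> marked V h" "marked V h \<noteq> unmarked y"
  by (simp_all add: unmarked_def marked_def)

text \<open>In a structure of the product, the second factor has size 0, so the first factor
  receives all labels and \<open>V\<close> consists of one label of sort \<open>X\<close>.\<close>

lemma str_mark_zero:
  "s \<in> str (mark_zero \<iota> X F) V \<longleftrightarrow>
     (\<exists>y. s = unmarked y \<and> (\<forall>j. j \<notin> range \<iota> \<longrightarrow> V j = {||}) \<and> V \<circ> \<iota> \<noteq> no_labels \<and> y \<in> str F (V \<circ> \<iota>)) \<or>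
     (\<exists>h. s = marked V h \<and> fcard (V X) = 1 \<and> (\<forall>j. j \<noteq> X \<longrightarrow> V j = {||}) \<and> h \<in> str F no_labels)"
  (is "?L \<longleftrightarrow> ?A \<or> ?B")
proof
  assume ?L
  then consider (l) y where "y \<in> str (embed_sp \<iota> (minus_sp F (at_zero F))) V" "s = to_nat (Inl y :: nat + nat)"
    | (r) y where "y \<in> str (times_sp (sort_sp X) (embed_sp \<iota> (at_zero F))) V" "s = to_nat (Inr y :: nat + nat)"
    unfolding mark_zero_def plus_sp_def by auto
  thus "?A \<or> ?B"
  proof cases
    case l
    thus ?thesis
      by (auto simp: embed_sp_def minus_sp_def at_zero_def unmarked_def split: if_splits)
  next
    case r
    then obtain V1 V2 f h where y: "y = to_nat (V1, V2, f, h)"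
      and V: "\<And>i. V1 i |\<union>| V2 i = V i" and f: "f \<in> str (sort_sp X) V1"
      and h: "h \<in> str (embed_sp \<iota> (at_zero F)) V2"
      unfolding times_sp_def by auto
    have h': "\<And>j. j \<notin> range \<iota> \<Longrightarrow> V2 j = {||}" "V2 \<circ> \<iota> = no_labels" "h \<in> str F no_labels"
      using h by (auto simp: embed_sp_def at_zero_def split: if_splits)
    have V2: "V2 = no_labels"
    proof
      fix j show "V2 j = no_labels j"
        using h'(1)[of j] h'(2) by (cases "j \<in> range \<iota>") (auto simp: fun_eq_iff no_labels_def)
    qed
    have "V1 = V" using V by (auto simp: V2 no_labels_def)
    thus ?thesis using r f y V2 h' by (auto simp: sort_sp_simps marked_def)
  qed
next
  assume "?A \<or> ?B"
  thus ?L
  proof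
    assume ?A
    thus ?thesis
      by (auto simp: mark_zero_def plus_sp_def embed_sp_def minus_sp_def at_zero_def unmarked_def)
  next
    assume ?B
    then obtain h where h: "s = marked V h" "fcard (V X) = 1" "\<forall>j. j \<noteq> X \<longrightarrow> V j = {||}" "h \<in> str F no_labels"
      by blast
    have "h \<in> str (embed_sp \<iota> (at_zero F)) no_labels"
      using h(4) by (auto simp: embed_sp_def at_zero_def no_labels_def comp_def)
    moreover have "0 \<in> str (sort_sp X) V" using h by (simp add: sort_sp_simps)
    ultimately have "to_nat (V, no_labels :: 'a labels, 0 :: nat, h) \<in> str (times_sp (sort_sp X) (embed_sp \<iota> (at_zero F))) V"
      unfolding times_sp_def spec.simps
      by (intro CollectI exI[of _ V] exI[of _ no_labels] exI[of _ 0] exI[of _ h]) (simp add: no_labels_def)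
    thus ?thesis by (auto simp: mark_zero_def plus_sp_def h(1) marked_def)
  qed
qed

lemma transport_unmarked:
  "transport (mark_zero \<iota> X F) V \<sigma> (unmarked y) = unmarked (transport F (V \<circ> \<iota>) (\<sigma> \<circ> \<iota>) y)"
  by (simp add: mark_zero_def plus_sp_def unmarked_def embed_sp_def minus_sp_def)

lemma transport_marked:
  assumes "functorial F" "h \<in> str F no_labels"
  shows "transport (mark_zero \<iota> X F) V \<sigma> (marked V h) = marked (relabel \<sigma> V) h"
proof -
  have "no_labels \<circ> \<iota> = no_labels" by (simp add: no_labels_def fun_eq_iff)
  moreover have "transport F no_labels (\<sigma> \<circ> \<iota>) h = h"
    by (rule transport_fix[OF assms]) (simp add: no_labels_def)
  ultimately show ?thesis
    by (simp add: mark_zero_def plus_sp_def marked_def times_sp_def sort_sp_simps embed_sp_def at_zero_def)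
qed

lemma functorial_mark_zero:
  assumes F: "functorial F"
  shows "functorial (mark_zero \<iota> X F)"
proof (rule functorialI)
  fix V \<sigma> s assume \<sigma>: "bij_tuple V \<sigma>" and "s \<in> str (mark_zero \<iota> X F) V"
  then consider (l) y where "s = unmarked y" "\<forall>j. j \<notin> range \<iota> \<longrightarrow> V j = {||}" "V \<circ> \<iota> \<noteq> no_labels" "y \<in> str F (V \<circ> \<iota>)"
    | (r) h where "s = marked V h" "fcard (V X) = 1" "\<forall>j. j \<noteq> X \<longrightarrow> V j = {||}" "h \<in> str F no_labels"
    unfolding str_mark_zero by blast
  note cases = this
  note \<sigma>\<iota> = bij_tuple_o[OF \<sigma>, of \<iota>]
  show "transport (mark_zero \<iota> X F) V \<sigma> s \<in> str (mark_zero \<iota> X F) (relabel \<sigma> V)"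
  proof (cases rule: cases)
    case l
    thus ?thesis using transport_in[OF F \<sigma>\<iota>] unfolding str_mark_zero
      by (auto simp: transport_unmarked relabel_o)
  next
    case r
    thus ?thesis using \<sigma> shape_relabel[OF \<sigma>] unfolding str_mark_zero
      by (auto simp: transport_marked[OF F] shape_def fun_eq_iff)
  qed
  show "transport (mark_zero \<iota> X F) V \<sigma> s = transport (mark_zero \<iota> X F) V \<tau> s"
    if \<tau>: "\<And>i x. x \<in> fset (V i) \<Longrightarrow> \<sigma> i x = \<tau> i x" for \<tau>
  proof (cases rule: cases)
    case l
    thus ?thesis using transport_cong[OF F \<sigma>\<iota>, of y "\<tau> \<circ> \<iota>"] \<tau> by (simp add: transport_unmarked)
  next
    case r
    thus ?thesis using relabel_cong[of V \<sigma> \<tau>] \<tau> by (simp add: transport_marked[OF F])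
  qed
  show "transport (mark_zero \<iota> X F) V (\<lambda>i. \<tau> i \<circ> \<sigma> i) s =
      transport (mark_zero \<iota> X F) (relabel \<sigma> V) \<tau> (transport (mark_zero \<iota> X F) V \<sigma> s)"
    if \<tau>: "bij_tuple (relabel \<sigma> V) \<tau>" for \<tau>
  proof (cases rule: cases)
    case l
    have e: "(\<lambda>i. \<tau> i \<circ> \<sigma> i) \<circ> \<iota> = (\<lambda>i. (\<tau> \<circ> \<iota>) i \<circ> (\<sigma> \<circ> \<iota>) i)" by (simp add: fun_eq_iff)
    show ?thesis using l transport_comp[OF F \<sigma>\<iota>, of "\<tau> \<circ> \<iota>" y] bij_tuple_o[OF \<tau>, of \<iota>]
      by (simp add: transport_unmarked relabel_o e)
  next
    case r
    thus ?thesis by (simp add: transport_marked[OF F] relabel_comp)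
  qed
next
  fix V s assume "s \<in> str (mark_zero \<iota> X F) V"
  moreover have "transport F (V \<circ> \<iota>) ((\<lambda>_. id) \<circ> \<iota>) y = y" if "y \<in> str F (V \<circ> \<iota>)" for y
    by (rule transport_fix[OF F that]) simp
  ultimately show "transport (mark_zero \<iota> X F) V (\<lambda>_. id) s = s"
    unfolding str_mark_zero by (auto simp: transport_unmarked transport_marked[OF F])
qed

lemma species_mark_zero:
  assumes F: "species F"
  shows "species (mark_zero \<iota> X F)"
  unfolding species_iff
proof (intro conjI allI)
  show "functorial (mark_zero \<iota> X F)" by (rule functorial_mark_zero[OF species_functorial[OF F]])
  fix V
  have "str (mark_zero \<iota> X F) V \<subseteq> unmarked ` str F (V \<circ> \<iota>) \<union> marked V ` str F no_labels"
    by (auto simp: str_mark_zero)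
  thus "finite (str (mark_zero \<iota> X F) V)" using species_finite[OF F] by (auto intro: finite_subset)
qed

lemma mark_zero_no_labels: "str (mark_zero \<iota> X F) no_labels = {}"
proof -
  have "no_labels \<circ> \<iota> = no_labels" by (simp add: no_labels_def fun_eq_iff)
  moreover have "fset (no_labels X) = {}" by (simp add: no_labels_def)
  ultimately show ?thesis by (auto simp: str_mark_zero fcard.rep_eq)
qed

text \<open>Over nonempty labels the new sort is empty and orbits are single structures. Over
  \<open>no_labels\<close> there is exactly one new label, and relabelling it joins the structures
  with the same \<open>h\<close>. Setting the new sort to 1 therefore gives back
  \<open>Y\<close>.\<close>

lemma quot_mark_zero:
  assumes Y: "functorial Y"
  shows "\<exists>q. quot (mark_zero Some None Y) Y q"
proof -
  define q :: "'a option labels \<Rightarrow> nat \<Rightarrow> nat" where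
    "q = (\<lambda>V s. if \<exists>y. s = unmarked y then THE y. s = unmarked y else THE h. s = marked V h)"
  have q [simp]: "q V (unmarked y) = y" "q V (marked V h) = h" for V y h by (auto simp: q_def)
  let ?M = "mark_zero Some None Y"
  have st: "(\<exists>y. s = unmarked y \<and> V None = {||} \<and> V \<circ> Some \<noteq> no_labels \<and> y \<in> str Y (V \<circ> Some)) \<or>
     (\<exists>h. s = marked V h \<and> fcard (V None) = 1 \<and> V \<circ> Some = no_labels \<and> h \<in> str Y no_labels)"
    if "s \<in> str ?M V" for s V
    using that unfolding str_mark_zero by (auto simp: fun_eq_iff no_labels_def)
  have "quot ?M Y q"
  proof (rule quotI)
    fix V s assume s: "s \<in> str ?M V"
    show "q V s \<in> str Y (V \<circ> Some)" using st[OF s] by auto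
    show "q (relabel \<sigma> V) (transport ?M V \<sigma> s) = transport Y (V \<circ> Some) (\<sigma> \<circ> Some) (q V s)"
      if \<sigma>: "bij_tuple V \<sigma>" for \<sigma>
      using st[OF s]
    proof (elim disjE exE conjE)
      fix h assume h: "s = marked V h" "V \<circ> Some = no_labels" "h \<in> str Y no_labels"
      have "transport Y no_labels (\<sigma> \<circ> Some) h = h"
        by (rule transport_fix[OF Y h(3)]) (simp add: no_labels_def)
      thus ?thesis using h by (simp add: transport_marked[OF Y])
    qed (simp add: transport_unmarked)
    show "q V s = q V' s' \<longleftrightarrow> same_orbit ?M V s V' s'"
      if s': "s' \<in> str ?M V'" and e: "V \<circ> Some = V' \<circ> Some" for V' s'
    proof (cases "V \<circ> Some = no_labels")
      case True
      obtain h where h: "s = marked V h" "fcard (V None) = 1" "h \<in> str Y no_labels"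
        using st[OF s] True by auto
      obtain h' where h': "s' = marked V' h'" "fcard (V' None) = 1"
        using st[OF s'] True e by auto
      have "same_orbit ?M V s V' s' \<longleftrightarrow> h = h'"
      proof
        assume "same_orbit ?M V s V' s'"
        thus "h = h'" unfolding same_orbit_def h(1) transport_marked[OF Y h(3)] h' by auto
      next
        assume hh: "h = h'"
        obtain a where a: "V None = {|a|}" using h(2) by (rule fcard_eq_1E)
        obtain b where b: "V' None = {|b|}" using h'(2) by (rule fcard_eq_1E)
        \<comment> \<open>A constant map is injective on the one-element set
          \<open>V None\<close>.\<close>
        have "relabel (on_None (\<lambda>_. b)) V = V'"
          by (rule option_labels_eqI) (simp_all add: a b e)
        thus "same_orbit ?M V s V' s'" unfolding same_orbit_def
          using transport_marked[OF Y h(3), of Some None V "on_None (\<lambda>_. b)"]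
          by (intro exI[of _ "\<lambda>_. b"]) (simp add: a h(1) h'(1) hh)
      qed
      thus ?thesis using h h' by simp
    next
      case False
      obtain y where y: "s = unmarked y" "V None = {||}" "y \<in> str Y (V \<circ> Some)"
        using st[OF s] False by auto
      obtain y' where y': "s' = unmarked y'" "V' None = {||}"
        using st[OF s'] False e by auto
      have VV: "V = V'" using y y' e by (intro option_labels_eqI) auto
      have "transport Y (V \<circ> Some) (on_None \<beta> \<circ> Some) y = y" for \<beta>
        using transport_id[OF Y y(3)] by simp
      moreover have "relabel (on_None \<beta>) V = V" for \<beta>
        by (rule option_labels_eqI) (simp_all add: y)
      ultimately have "same_orbit ?M V s V' s' \<longleftrightarrow> y = y'"
        unfolding same_orbit_def y y' transport_unmarked using VV y(2) by auto
      thus ?thesis using y y' by simp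
    qed
  next
    fix U c assume c: "c \<in> str Y U"
    show "\<exists>W s. W \<circ> Some = U \<and> s \<in> str ?M W \<and> q W s = c"
    proof (cases "U = no_labels")
      case True
      let ?W = "case_option {|0|} U"
      have "marked ?W c \<in> str ?M ?W"
        unfolding str_mark_zero using c True by (auto simp: no_labels_def fcard.rep_eq split: option.split)
      thus ?thesis by (intro exI[of _ ?W] exI[of _ "marked ?W c"]) simp
    next
      case False
      let ?W = "case_option {||} U"
      have "unmarked c \<in> str ?M ?W"
        unfolding str_mark_zero using c False by (auto split: option.split)
      thus ?thesis by (intro exI[of _ ?W] exI[of _ "unmarked c"]) simp
    qed
  qed
  thus ?thesis by blast
qed

section \<open>Composition and quotients\<close>

definition matching ::
  "('i \<Rightarrow> 'k option labels \<Rightarrow> nat \<Rightarrow> nat) \<Rightarrow> ('i \<Rightarrow> 'k option labels fset) \<Rightarrow> ('i \<Rightarrow> 'k option labels \<Rightarrow> nat)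
   \<Rightarrow> ('i \<Rightarrow> 'k option labels \<Rightarrow> nat \<Rightarrow> nat) \<Rightarrow> ('i \<Rightarrow> 'k option labels fset) \<Rightarrow> ('i \<Rightarrow> 'k option labels \<Rightarrow> nat)
   \<Rightarrow> ('i \<Rightarrow> 'k option labels \<Rightarrow> 'k option labels) \<Rightarrow> bool" where
  "matching q P g q' P' g' b \<longleftrightarrow>
     (\<forall>j. bij_betw (b j) (fset (P j)) (fset (P' j))) \<and>
     (\<forall>j B. B |\<in>| P j \<longrightarrow> b j B \<circ> Some = B \<circ> Some \<and> q' j (b j B) (g' j (b j B)) = q j B (g j B))"

text \<open>Two assemblies are related if a bijection of their blocks respects the outer structure, the labels
  other than those of sort \<open>None\<close>, and the classes of the inner structures. For \<open>G = G'\<close> this is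
  \<open>same_orbit\<close>, since bijections of the \<open>None\<close> labels can be chosen block by block.\<close>

definition comp_rel where
  "comp_rel H G q G' q' W s W' s' \<longleftrightarrow> W \<circ> Some = W' \<circ> Some \<and>
     (\<exists>P g f P' g' f' b. s = enc P g f \<and> assembly H G W P g f \<and> s' = enc P' g' f' \<and>
        assembly H G' W' P' g' f' \<and> matching q P g q' P' g' b \<and>
        f' = transport H (codes P) (on_codes b) f)"

lemma comp_relI:
  assumes "W \<circ> Some = W' \<circ> Some" "assembly H G W P g f" "assembly H G' W' P' g' f'"
    "matching q P g q' P' g' b" "f' = transport H (codes P) (on_codes b) f"
  shows "comp_rel H G q G' q' W (enc P g f) W' (enc P' g' f')"
  unfolding comp_rel_def using assms
  by (intro conjI exI[of _ P] exI[of _ g] exI[of _ f] exI[of _ P'] exI[of _ g'] exI[of _ f'] exI[of _ b]) simp_all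

lemma matching_image: "matching q P g q' P' g' b \<Longrightarrow> b j |`| P j = P' j"
  unfolding matching_def bij_betw_def by (metis fimage.rep_eq fset_inject)

lemma matching_codes:
  assumes "matching q P g q' P' g' b"
  shows "bij_tuple (codes P) (on_codes b)" "relabel (on_codes b) (codes P) = codes P'"
proof -
  show "bij_tuple (codes P) (on_codes b)"
    using assms by (simp add: bij_tuple_on_codes matching_def bij_betw_def)
  show "relabel (on_codes b) (codes P) = codes P'"
    by (simp add: relabel_on_codes matching_image[OF assms])
qed

lemma comp_rel_sym:
  assumes H: "functorial H" and r: "comp_rel H G q G' q' W s W' s'"
  shows "comp_rel H G' q' G q W' s' W s"
proof -
  obtain P g f P' g' f' b where W: "W \<circ> Some = W' \<circ> Some" and s: "s = enc P g f" and a: "assembly H G W P g f"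
    and s': "s' = enc P' g' f'" and a': "assembly H G' W' P' g' f'" and m: "matching q P g q' P' g' b"
    and f': "f' = transport H (codes P) (on_codes b) f"
    using r unfolding comp_rel_def by blast
  let ?c = "\<lambda>j. inv_into (fset (P j)) (b j)"
  have b: "bij_betw (b j) (fset (P j)) (fset (P' j))" for j using m by (simp add: matching_def)
  have inv: "?c j (b j B) = B" if "B |\<in>| P j" for j B
    by (rule bij_betw_inv_into_left[OF b that])
  have m': "matching q' P' g' q P g ?c"
    unfolding matching_def
  proof (intro conjI allI impI)
    show "bij_betw (?c j) (fset (P' j)) (fset (P j))" for j by (rule bij_betw_inv_into[OF b])
    fix j C assume "C |\<in>| P' j"
    then obtain B where B: "B |\<in>| P j" "C = b j B" using matching_image[OF m, of j] by auto
    show "?c j C \<circ> Some = C \<circ> Some" "q j (?c j C) (g j (?c j C)) = q' j C (g' j C)"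
      using m B inv by (simp_all add: matching_def)
  qed
  have "transport H (codes P') (on_codes ?c) f' = f"
    unfolding f' matching_codes(2)[OF m, symmetric]
  proof (rule transport_inverse[OF H])
    show "bij_tuple (relabel (on_codes b) (codes P)) (on_codes ?c)"
      unfolding matching_codes(2)[OF m] by (rule matching_codes(1)[OF m'])
  qed (use a matching_codes(1)[OF m] inv in \<open>auto simp: assembly_def fset_codes\<close>)
  thus ?thesis unfolding s s' by (intro comp_relI[OF W[symmetric] a' a m']) simp
qed

lemma comp_rel_trans:
  assumes H: "functorial H"
    and r: "comp_rel H G q G' q' W s W' s'" "comp_rel H G' q' G'' q'' W' s' W'' s''"
  shows "comp_rel H G q G'' q'' W s W'' s''"
proof -
  obtain P g f P' g' f' b where W: "W \<circ> Some = W' \<circ> Some" and s: "s = enc P g f" and a: "assembly H G W P g f"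
    and s': "s' = enc P' g' f'" and a': "assembly H G' W' P' g' f'" and m: "matching q P g q' P' g' b"
    and f': "f' = transport H (codes P) (on_codes b) f"
    using r(1) unfolding comp_rel_def by blast
  obtain P0 g0 f0 P'' g'' f'' c where W': "W' \<circ> Some = W'' \<circ> Some" and s0: "s' = enc P0 g0 f0"
    and s'': "s'' = enc P'' g'' f''" and a'': "assembly H G'' W'' P'' g'' f''"
    and m0: "matching q' P0 g0 q'' P'' g'' c"
    and f'': "f'' = transport H (codes P0) (on_codes c) f0"
    using r(2) unfolding comp_rel_def by blast
  have e: "P0 = P'" "f0 = f'" "\<And>j B. B |\<in>| P' j \<Longrightarrow> g0 j B = g' j B"
    using s' s0 by (auto simp: enc_eq_iff)
  let ?d = "\<lambda>j. c j \<circ> b j"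
  have m'': "matching q P g q'' P'' g'' ?d"
    unfolding matching_def
  proof (intro conjI allI impI)
    show "bij_betw (?d j) (fset (P j)) (fset (P'' j))" for j
      using m m0 by (intro bij_betw_trans[of _ _ "fset (P' j)"]) (simp_all add: matching_def e)
    fix j B assume B: "B |\<in>| P j"
    have "b j B |\<in>| P' j" using matching_image[OF m, of j] B by auto
    thus "?d j B \<circ> Some = B \<circ> Some" "q'' j (?d j B) (g'' j (?d j B)) = q j B (g j B)"
      using m m0 B e by (simp_all add: matching_def)
  qed
  have f: "f \<in> str H (codes P)" using a by (simp add: assembly_def)
  have "f'' = transport H (codes P) (\<lambda>i. on_codes c i \<circ> on_codes b i) f"
    using transport_comp[OF H matching_codes(1)[OF m], of "on_codes c" f]
      matching_codes[OF m] matching_codes[OF m0] f by (simp add: f'' f' e)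
  also have "\<dots> = transport H (codes P) (on_codes ?d) f"
    using matching_codes[OF m] matching_codes[OF m0] f
    by (intro transport_cong[OF H] bij_tuple_comp) (auto simp: e fset_codes)
  finally show ?thesis
    unfolding s s'' using comp_relI[OF _ a a'' m''] W W' by simp
qed

text \<open>The relabelling of \<open>W\<close> acts on the blocks, and this action is the matching:
  it stays within the orbit of each inner structure.\<close>

lemma same_orbit_comp_rel:
  assumes H: "functorial H" and G: "\<And>j. functorial (G j)" and q: "\<And>j. quot (G j) (Q j) (q j)"
    and s: "s \<in> str (comp_sp H G) W" and o: "same_orbit (comp_sp H G) W s W' s'"
  shows "comp_rel H G q G q W s W' s'"
proof -
  obtain P g f where s: "s = enc P g f" and a: "assembly H G W P g f"
    using s unfolding str_comp_iff by blast
  obtain \<beta> where \<beta>: "inj_on \<beta> (fset (W None))" and W': "W' = relabel (on_None \<beta>) W"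
    and s': "s' = transport (comp_sp H G) W (on_None \<beta>) s"
    using o unfolding same_orbit_def by blast
  let ?\<sigma> = "on_None \<beta> :: 'b option \<Rightarrow> nat \<Rightarrow> nat"
  have \<sigma>: "bij_tuple W ?\<sigma>" using \<beta> by simp
  have P: "sorted_partition W P" and g: "\<And>j B. B |\<in>| P j \<Longrightarrow> g j B \<in> str (G j) B"
    and f: "f \<in> str H (codes P)" using a by (auto simp: assembly_def)
  let ?g = "transport_blocks G ?\<sigma> P g"
  note eq = transport_blocks_eq[OF P \<sigma>, of _ _ G g]
  have T: "s' = enc (\<lambda>j. relabel ?\<sigma> |`| P j) ?g (transport H (codes P) (on_codes (\<lambda>_. relabel ?\<sigma>)) f)"
    unfolding s s' by (rule transport_enc) (rule eq)
  have a': "assembly H G W' (\<lambda>j. relabel ?\<sigma> |`| P j) ?g (transport H (codes P) (on_codes (\<lambda>_. relabel ?\<sigma>)) f)"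
    unfolding W' by (rule assembly_transport[OF H G a \<sigma> eq])
  have m: "matching q P g q (\<lambda>j. relabel ?\<sigma> |`| P j) ?g (\<lambda>_. relabel ?\<sigma>)"
    unfolding matching_def
  proof (intro conjI allI impI)
    show "bij_betw (relabel ?\<sigma>) (fset (P j)) (fset (relabel ?\<sigma> |`| P j))" for j
      using relabel_inj_on_blocks[OF P \<sigma>] by (simp add: bij_betw_def)
    fix j B assume B: "B |\<in>| P j"
    show "relabel ?\<sigma> B \<circ> Some = B \<circ> Some" by simp
    have \<sigma>B: "bij_tuple B ?\<sigma>" by (rule bij_tuple_mono[OF \<sigma> sorted_partition_subset[OF P B]])
    hence "same_orbit (G j) B (g j B) (relabel ?\<sigma> B) (?g j (relabel ?\<sigma> B))"
      unfolding same_orbit_def eq[OF B] by auto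
    thus "q j (relabel ?\<sigma> B) (?g j (relabel ?\<sigma> B)) = q j B (g j B)"
      using quot_eq_iff[OF q g[OF B] same_orbit_in[OF G _ g[OF B]]] by simp
  qed
  have "W \<circ> Some = W' \<circ> Some" unfolding W' by simp
  thus ?thesis unfolding s T by (rule comp_relI[OF _ a a' m refl])
qed

text \<open>Each pair of matched blocks has its own bijection of labels of sort \<open>None\<close>.
  The blocks being disjoint, these are pasted to one bijection of \<open>W None\<close>, which
  realises the matching on all blocks simultaneously.\<close>

lemma comp_rel_same_orbit:
  assumes H: "functorial H" and G: "\<And>j. functorial (G j)" and q: "\<And>j. quot (G j) (Q j) (q j)"
    and r: "comp_rel H G q G q W s W' s'"
  shows "same_orbit (comp_sp H G) W s W' s'"
proof -
  obtain P g f P' g' f' b where W: "W \<circ> Some = W' \<circ> Some" and s: "s = enc P g f" and a: "assembly H G W P g f"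
    and s': "s' = enc P' g' f'" and a': "assembly H G W' P' g' f'" and m: "matching q P g q P' g' b"
    and f': "f' = transport H (codes P) (on_codes b) f"
    using r unfolding comp_rel_def by blast
  have P: "sorted_partition W P" and g: "\<And>j B. B |\<in>| P j \<Longrightarrow> g j B \<in> str (G j) B"
    and f: "f \<in> str H (codes P)" using a by (auto simp: assembly_def)
  have P': "sorted_partition W' P'" and g': "\<And>j B. B |\<in>| P' j \<Longrightarrow> g' j B \<in> str (G j) B"
    using a' by (auto simp: assembly_def)
  have bP: "b j B |\<in>| P' j" if "B |\<in>| P j" for j B using matching_image[OF m, of j] that by auto
  have orb: "same_orbit (G j) B (g j B) (b j B) (g' j (b j B))" if B: "B |\<in>| P j" for j B
    using quot_eq_iff[OF q g[OF B] g'[OF bP[OF B]]] m B by (simp add: matching_def)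
  define c where "c = (\<lambda>j B. SOME \<beta>. inj_on \<beta> (fset (B None)) \<and>
     relabel (on_None \<beta>) B = b j B \<and> transport (G j) B (on_None \<beta>) (g j B) = g' j (b j B))"
  have c: "inj_on (c j B) (fset (B None)) \<and> relabel (on_None (c j B)) B = b j B \<and>
     transport (G j) B (on_None (c j B)) (g j B) = g' j (b j B)" if "B |\<in>| P j" for j B
    unfolding c_def by (rule someI_ex[OF orb[OF that, unfolded same_orbit_def]])
  define \<beta> where "\<beta> = (\<lambda>u. case (SOME (j, B). B |\<in>| P j \<and> u |\<in>| B None) of (j, B) \<Rightarrow> c j B u)"
  have \<beta>: "\<beta> u = c j B u" if "B |\<in>| P j" "u |\<in>| B None" for j B u
  proof -
    have "(SOME (j, B). B |\<in>| P j \<and> u |\<in>| B None) = (j, B)"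
      using that sorted_partition_unique[OF P] by (intro some_equality) auto
    thus ?thesis by (simp add: \<beta>_def)
  qed
  let ?\<sigma> = "on_None \<beta> :: 'b option \<Rightarrow> nat \<Rightarrow> nat"
  have same: "?\<sigma> i x = on_None (c j B) i x" if "B |\<in>| P j" "x \<in> fset (B i)" for j B i x
    using that \<beta> by (cases i) auto
  have rel: "relabel ?\<sigma> B = b j B" if B: "B |\<in>| P j" for j B
    using relabel_cong[of B ?\<sigma> "on_None (c j B)"] same[OF B] c[OF B] by simp
  have img: "\<beta> u |\<in>| b j B None" if "B |\<in>| P j" "u |\<in>| B None" for j B u
    using rel[OF that(1)] that(2) by (metis fimageI relabel_on_None_None)
  have inj: "inj_on \<beta> (fset (W None))"
  proof (rule inj_onI)
    fix u v assume uv: "u \<in> fset (W None)" "v \<in> fset (W None)" "\<beta> u = \<beta> v"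
    obtain j B where B: "B |\<in>| P j" "u |\<in>| B None" using sorted_partition_cover[OF P uv(1)] .
    obtain i C where C: "C |\<in>| P i" "v |\<in>| C None" using sorted_partition_cover[OF P uv(2)] .
    \<comment> \<open>A common image lies in only one block of \<open>P'\<close>, and this is the
      image of only one block of \<open>P\<close>.\<close>
    have e: "j = i \<and> b j B = b i C"
      using sorted_partition_unique[OF P' bP[OF B(1)] bP[OF C(1)], of "\<beta> u" None] img[OF B] img[OF C] uv(3)
      by auto
    hence "B = C" using m B(1) C(1) by (auto simp: matching_def bij_betw_def dest: inj_onD)
    hence "c j B u = c j B v" using \<beta>[OF B] \<beta>[OF C] e uv(3) by simp
    thus "u = v" using c[OF B(1)] B C \<open>B = C\<close> by (auto dest: inj_onD)
  qed
  have "relabel ?\<sigma> W = W'"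
  proof (rule option_labels_eqI)
    show "relabel ?\<sigma> W None = W' None"
    proof (rule fset_eqI)
      fix x
      have "x |\<in>| W' None \<longleftrightarrow> (\<exists>u. u |\<in>| W None \<and> x = \<beta> u)"
      proof
        assume "x |\<in>| W' None"
        then obtain j C where C: "C |\<in>| P' j" "x |\<in>| C None" using sorted_partition_cover[OF P'] by blast
        then obtain B where B: "B |\<in>| P j" "C = b j B" using matching_image[OF m, of j] by auto
        then obtain u where "u |\<in>| B None" "x = \<beta> u" using C rel[OF B(1)] by (metis fimageE relabel_on_None_None)
        thus "\<exists>u. u |\<in>| W None \<and> x = \<beta> u" using sorted_partition_subset[OF P B(1), of None] by auto
      next
        assume "\<exists>u. u |\<in>| W None \<and> x = \<beta> u"
        then obtain u where u: "u |\<in>| W None" "x = \<beta> u" by blast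
        then obtain j B where B: "B |\<in>| P j" "u |\<in>| B None" using sorted_partition_cover[OF P] by blast
        show "x |\<in>| W' None"
          using img[OF B] sorted_partition_subset[OF P' bP[OF B(1)], of None] u(2) by auto
      qed
      thus "x |\<in>| relabel ?\<sigma> W None \<longleftrightarrow> x |\<in>| W' None" by auto
    qed
  qed (simp add: W)
  moreover have "transport (comp_sp H G) W ?\<sigma> s = s'"
  proof -
    have "transport (comp_sp H G) W ?\<sigma> s =
        enc (\<lambda>j. relabel ?\<sigma> |`| P j) g' (transport H (codes P) (on_codes (\<lambda>_. relabel ?\<sigma>)) f)"
      unfolding s
    proof (rule transport_enc)
      fix j B assume B: "B |\<in>| P j"
      have "bij_tuple B ?\<sigma>"
        using inj sorted_partition_subset[OF P B, of None] by (auto intro: inj_on_subset)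
      hence "transport (G j) B ?\<sigma> (g j B) = transport (G j) B (on_None (c j B)) (g j B)"
        using same[OF B] by (intro transport_cong[OF G _ g[OF B]])
      thus "g' j (relabel ?\<sigma> B) = transport (G j) B ?\<sigma> (g j B)" using c[OF B] rel[OF B] by simp
    qed
    moreover have "(\<lambda>j. relabel ?\<sigma> |`| P j) = P'"
    proof
      fix j
      have "relabel ?\<sigma> |`| P j = b j |`| P j" using rel by (intro fset.map_cong) auto
      thus "relabel ?\<sigma> |`| P j = P' j" using matching_image[OF m] by simp
    qed
    moreover have "transport H (codes P) (on_codes (\<lambda>_. relabel ?\<sigma>)) f = f'"
      unfolding f' using rel matching_codes(1)[OF m] f
      by (intro transport_cong[OF H, symmetric]) (auto simp: fset_codes)
    ultimately show ?thesis by (simp add: s')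
  qed
  ultimately show ?thesis unfolding same_orbit_def using inj by blast
qed

text \<open>The relabelled partitions are matched by \<open>b\<close> conjugated with the two
  relabellings of blocks. Classes still correspond, as \<open>q\<close> and \<open>q'\<close> are
  equivariant over the same \<open>Q\<close>.\<close>

lemma comp_rel_transport:
  assumes H: "functorial H" and G: "\<And>j. functorial (G j)" and G': "\<And>j. functorial (G' j)"
    and q: "\<And>j. quot (G j) (Q j) (q j)" and q': "\<And>j. quot (G' j) (Q j) (q' j)"
    and r: "comp_rel H G q G' q' W s W' s'"
    and \<sigma>: "bij_tuple W \<sigma>" and \<sigma>': "bij_tuple W' \<sigma>'" and eq\<sigma>: "\<sigma> \<circ> Some = \<sigma>' \<circ> Some"
  shows "comp_rel H G q G' q' (relabel \<sigma> W) (transport (comp_sp H G) W \<sigma> s)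
    (relabel \<sigma>' W') (transport (comp_sp H G') W' \<sigma>' s')"
proof -
  obtain P g f P' g' f' b where W: "W \<circ> Some = W' \<circ> Some" and s: "s = enc P g f" and a: "assembly H G W P g f"
    and s': "s' = enc P' g' f'" and a': "assembly H G' W' P' g' f'" and m: "matching q P g q' P' g' b"
    and f': "f' = transport H (codes P) (on_codes b) f"
    using r unfolding comp_rel_def by blast
  have P: "sorted_partition W P" and g: "\<And>j B. B |\<in>| P j \<Longrightarrow> g j B \<in> str (G j) B"
    and f: "f \<in> str H (codes P)" using a by (auto simp: assembly_def)
  have P': "sorted_partition W' P'" and g': "\<And>j B. B |\<in>| P' j \<Longrightarrow> g' j B \<in> str (G' j) B"
    using a' by (auto simp: assembly_def)
  let ?h = "transport_blocks G \<sigma> P g" and ?h' = "transport_blocks G' \<sigma>' P' g'"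
  let ?S = "\<lambda>j. relabel \<sigma> |`| P j" and ?S' = "\<lambda>j. relabel \<sigma>' |`| P' j"
  let ?f = "transport H (codes P) (on_codes (\<lambda>_. relabel \<sigma>)) f"
  let ?f' = "transport H (codes P') (on_codes (\<lambda>_. relabel \<sigma>')) f'"
  let ?b = "\<lambda>j C. relabel \<sigma>' (b j (inv_into (fset (P j)) (relabel \<sigma>) C))"
  note eq = transport_blocks_eq[OF P \<sigma>, of _ _ G g]
  note eq' = transport_blocks_eq[OF P' \<sigma>', of _ _ G' g']
  have T: "transport (comp_sp H G) W \<sigma> s = enc ?S ?h ?f" unfolding s by (rule transport_enc) (rule eq)
  have T': "transport (comp_sp H G') W' \<sigma>' s' = enc ?S' ?h' ?f'"
    unfolding s' by (rule transport_enc) (rule eq')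
  note A = assembly_transport[OF H G a \<sigma> eq] and A' = assembly_transport[OF H G' a' \<sigma>' eq']
  have b_eq: "?b j (relabel \<sigma> B) = relabel \<sigma>' (b j B)" if "B |\<in>| P j" for j B
    using relabel_inj_on_blocks[OF P \<sigma>] that by (simp add: inv_into_f_f)
  have bP: "b j B |\<in>| P' j" if "B |\<in>| P j" for j B using matching_image[OF m, of j] that by auto
  have M: "matching q ?S ?h q' ?S' ?h' ?b"
    unfolding matching_def
  proof (intro conjI allI impI)
    fix j
    have i1: "bij_betw (inv_into (fset (P j)) (relabel \<sigma>)) (relabel \<sigma> ` fset (P j)) (fset (P j))"
      using relabel_inj_on_blocks[OF P \<sigma>] by (intro bij_betw_inv_into) (simp add: bij_betw_def)
    have i2: "bij_betw (b j) (fset (P j)) (fset (P' j))" using m by (simp add: matching_def)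
    have i3: "bij_betw (relabel \<sigma>') (fset (P' j)) (relabel \<sigma>' ` fset (P' j))"
      using relabel_inj_on_blocks[OF P' \<sigma>'] by (simp add: bij_betw_def)
    show "bij_betw (?b j) (fset (?S j)) (fset (?S' j))"
      using bij_betw_trans[OF bij_betw_trans[OF i1 i2] i3] by (simp add: comp_def)
    fix C assume "C |\<in>| ?S j"
    then obtain B where B: "B |\<in>| P j" "C = relabel \<sigma> B" by auto
    have BS: "b j B \<circ> Some = B \<circ> Some" and qq: "q' j (b j B) (g' j (b j B)) = q j B (g j B)"
      using m B by (simp_all add: matching_def)
    show "?b j C \<circ> Some = C \<circ> Some"
      unfolding B(2) b_eq[OF B(1)] relabel_o BS eq\<sigma> ..
    have \<sigma>B: "bij_tuple B \<sigma>" by (rule bij_tuple_mono[OF \<sigma> sorted_partition_subset[OF P B(1)]])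
    have \<sigma>B': "bij_tuple (b j B) \<sigma>'"
      by (rule bij_tuple_mono[OF \<sigma>' sorted_partition_subset[OF P' bP[OF B(1)]]])
    show "q' j (?b j C) (?h' j (?b j C)) = q j C (?h j C)"
      unfolding B(2) b_eq[OF B(1)] eq[OF B(1)] eq'[OF bP[OF B(1)]]
        quot_transport[OF q \<sigma>B g[OF B(1)]] quot_transport[OF q' \<sigma>B' g'[OF bP[OF B(1)]]] qq BS eq\<sigma> ..
  qed
  note C1 = matching_codes[OF m]
  have C2: "bij_tuple (codes P) (on_codes (\<lambda>_. relabel \<sigma>))"
    unfolding bij_tuple_on_codes using relabel_inj_on_blocks[OF P \<sigma>] by blast
  have C3: "bij_tuple (codes P') (on_codes (\<lambda>_. relabel \<sigma>'))"
    unfolding bij_tuple_on_codes using relabel_inj_on_blocks[OF P' \<sigma>'] by blast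
  have C4: "bij_tuple (relabel (on_codes (\<lambda>_. relabel \<sigma>)) (codes P)) (on_codes ?b)"
    unfolding relabel_on_codes by (rule matching_codes(1)[OF M])
  have "?f' = transport H (codes P) (\<lambda>i. on_codes (\<lambda>_. relabel \<sigma>') i \<circ> on_codes b i) f"
    using transport_comp[OF H C1(1), of "on_codes (\<lambda>_. relabel \<sigma>')" f] C3 f unfolding C1(2) f' by blast
  also have "\<dots> = transport H (codes P) (\<lambda>i. on_codes ?b i \<circ> on_codes (\<lambda>_. relabel \<sigma>) i) f"
    using b_eq C1 C3 f by (intro transport_cong[OF H] bij_tuple_comp) (auto simp: fset_codes)
  also have "\<dots> = transport H (codes ?S) (on_codes ?b) ?f"
    using transport_comp[OF H C2 C4 f] by (simp only: relabel_on_codes)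
  finally have F: "?f' = transport H (codes ?S) (on_codes ?b) ?f" .
  have "relabel \<sigma> W \<circ> Some = relabel \<sigma>' W' \<circ> Some" by (simp only: relabel_o W eq\<sigma>)
  thus ?thesis unfolding T T' by (rule comp_relI[OF _ A A' M F])
qed

section \<open>Exchanging inner components with the same quotients\<close>

lemma no_labels_iff: "B = no_labels \<longleftrightarrow> (\<forall>k u. u |\<notin>| B k)"
  by (auto simp: no_labels_def fun_eq_iff)

text \<open>Each inner structure is replaced by a \<open>G'\<close>-representative of its class.
  Representatives for different blocks could share labels of sort \<open>None\<close>, so these are
  renamed apart. Emptiness of \<open>G' j\<close> on \<open>no_labels\<close> keeps the new blocks
  nonempty, as a partition requires.\<close>

lemma comp_rel_total:
  fixes G G' :: "'i::finite \<Rightarrow> 'k::finite option spec"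
  assumes H: "functorial H" and G': "\<And>j. functorial (G' j)"
    and q: "\<And>j. quot (G j) (Q j) (q j)" and q': "\<And>j. quot (G' j) (Q j) (q' j)"
    and z: "\<And>j. str (G' j) no_labels = {}" and s: "s \<in> str (comp_sp H G) W"
  shows "\<exists>W' s'. comp_rel H G q G' q' W s W' s'"
proof -
  obtain P g f where s: "s = enc P g f" and a: "assembly H G W P g f"
    using s unfolding str_comp_iff by blast
  have P: "sorted_partition W P" and g: "\<And>j B. B |\<in>| P j \<Longrightarrow> g j B \<in> str (G j) B"
    and f: "f \<in> str H (codes P)" using a by (auto simp: assembly_def)
  define ok where "ok = (\<lambda>j B p. fst p \<circ> Some = B \<circ> Some \<and> snd p \<in> str (G' j) (fst p)
      \<and> q' j (fst p) (snd p) = q j B (g j B))"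
  define p where "p = (\<lambda>j B. SOME p. ok j B p)"
  have p: "ok j B (p j B)" if B: "B |\<in>| P j" for j B
  proof -
    obtain V t where "V \<circ> Some = B \<circ> Some" "t \<in> str (G' j) V" "q' j V t = q j B (g j B)"
      using quot_surj[OF q' quot_in[OF q g[OF B]]] by blast
    hence "ok j B (V, t)" by (simp add: ok_def)
    thus ?thesis unfolding p_def by (rule someI)
  qed
  \<comment> \<open>Tagging every new label with the old block \<open>B\<close> makes different
    blocks disjoint; the sort of a block is determined by \<open>B\<close>.\<close>
  define \<tau> :: "'k option labels \<Rightarrow> nat \<Rightarrow> nat" where "\<tau> = (\<lambda>B x. to_nat (B, x))"
  have \<tau>: "inj_on (\<tau> B) A" for B A by (auto simp: \<tau>_def inj_on_def)
  define b where "b = (\<lambda>j B. relabel (on_None (\<tau> B)) (fst (p j B)))"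
  define h where "h = (\<lambda>j B. transport (G' j) (fst (p j B)) (on_None (\<tau> B)) (snd (p j B)))"
  have bS: "b j B \<circ> Some = B \<circ> Some" if "B |\<in>| P j" for j B
    using p[OF that] by (simp add: b_def ok_def)
  have bSome: "b j B (Some k) = B (Some k)" if "B |\<in>| P j" for j B k
    using bS[OF that] by (simp add: fun_eq_iff)
  have h: "h j B \<in> str (G' j) (b j B)" if "B |\<in>| P j" for j B
    using p[OF that] transport_in[OF G', of "fst (p j B)" "on_None (\<tau> B)"] \<tau> by (simp add: h_def b_def ok_def)
  have qh: "q' j (b j B) (h j B) = q j B (g j B)" if B: "B |\<in>| P j" for j B
  proof -
    have "same_orbit (G' j) (fst (p j B)) (snd (p j B)) (b j B) (h j B)"
      unfolding same_orbit_def b_def h_def using \<tau> by blast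
    hence "q' j (fst (p j B)) (snd (p j B)) = q' j (b j B) (h j B)"
      using p[OF B] h[OF B] bS[OF B] by (subst quot_eq_iff[OF q']) (auto simp: ok_def)
    thus ?thesis using p[OF B] by (simp add: ok_def)
  qed
  have uniq: "j = j' \<and> B = B'" if B: "B |\<in>| P j" "B' |\<in>| P j'" and u: "u |\<in>| b j B k" "u |\<in>| b j' B' k"
    for j B j' B' u k
  proof (cases k)
    case None
    hence "B = B'" using u by (auto simp: b_def \<tau>_def)
    moreover obtain i v where "v |\<in>| B i"
      using sorted_partition_nonempty[OF P B(1)] unfolding no_labels_iff by blast
    ultimately show ?thesis using sorted_partition_unique[OF P B, of v i] by simp
  next
    case (Some i)
    thus ?thesis using sorted_partition_unique[OF P B, of u k] u bSome[OF B(1)] bSome[OF B(2)] by simp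
  qed
  have ne: "b j B \<noteq> no_labels" if "B |\<in>| P j" for j B
    using h[OF that] z by auto
  have inj: "inj_on (b j) (fset (P j))" for j
  proof (rule inj_onI)
    fix B B' assume B: "B |\<in>| P j" "B' |\<in>| P j" "b j B = b j B'"
    obtain i v where "v |\<in>| b j B i" using ne[OF B(1)] unfolding no_labels_iff by blast
    thus "B = B'" using uniq[OF B(1,2), of v i] B(3) by simp
  qed
  define P' where "P' = (\<lambda>j. b j |`| P j)"
  define g' where "g' = (\<lambda>j C. h j (inv_into (fset (P j)) (b j) C))"
  have g': "g' j (b j B) = h j B" if "B |\<in>| P j" for j B
    using inj that by (simp add: g'_def inv_into_f_f)
  define N where "N = Abs_fset (\<Union>j. \<Union>B\<in>fset (P j). fset (b j B None))"
  have N: "fset N = (\<Union>j. \<Union>B\<in>fset (P j). fset (b j B None))"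
    unfolding N_def by (simp add: Abs_fset_inverse)
  define W' where "W' = case_option N (\<lambda>k. W (Some k))"
  have W': "W' None = N" "W' (Some k) = W (Some k)" for k by (simp_all add: W'_def)
  have PP: "sorted_partition W' P'"
  proof (rule sorted_partitionI)
    show "C \<noteq> no_labels" if "C |\<in>| P' j" for j C using that ne by (auto simp: P'_def)
    show "fset (C k) \<subseteq> fset (W' k)" if "C |\<in>| P' j" for j C k
    proof -
      obtain B where B: "B |\<in>| P j" "C = b j B" using \<open>C |\<in>| P' j\<close> by (auto simp: P'_def)
      show ?thesis
      proof (cases k)
        case None
        thus ?thesis using B by (auto simp: W' N)
      next
        case (Some i)
        thus ?thesis using B bSome[OF B(1)] sorted_partition_subset[OF P B(1), of k] by (simp add: W')
      qed
    qed
    show "\<exists>j C. C |\<in>| P' j \<and> u |\<in>| C k" if "u |\<in>| W' k" for k u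
    proof (cases k)
      case None
      hence "u \<in> fset N" using that by (simp add: W')
      then obtain j B where "B |\<in>| P j" "u |\<in>| b j B None" unfolding N by blast
      thus ?thesis using None by (auto simp: P'_def)
    next
      case (Some i)
      hence "u |\<in>| W k" using that by (simp add: W')
      then obtain j B where "B |\<in>| P j" "u |\<in>| B k" using sorted_partition_cover[OF P] by blast
      thus ?thesis using Some bSome by (auto simp: P'_def)
    qed
    show "j = j' \<and> C = C'" if C: "C |\<in>| P' j" "C' |\<in>| P' j'" "u |\<in>| C k" "u |\<in>| C' k" for k u j C j' C'
    proof -
      obtain B B' where "B |\<in>| P j" "C = b j B" "B' |\<in>| P j'" "C' = b j' B'"
        using C(1,2) by (auto simp: P'_def)
      with uniq[of B j B' j' u k] C(3,4) show ?thesis by auto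
    qed
  qed
  have m: "matching q P g q' P' g' b"
    unfolding matching_def using inj bS qh g' by (auto simp: P'_def bij_betw_def)
  have a': "assembly H G' W' P' g' (transport H (codes P) (on_codes b) f)"
    unfolding assembly_def
  proof (intro conjI allI impI)
    show "g' j C \<in> str (G' j) C" if "C |\<in>| P' j" for j C using that h g' by (auto simp: P'_def)
    show "transport H (codes P) (on_codes b) f \<in> str H (codes P')"
      using transport_in[OF H matching_codes(1)[OF m] f] by (simp add: matching_codes(2)[OF m])
  qed (rule PP)
  have "W \<circ> Some = W' \<circ> Some" by (simp add: fun_eq_iff W')
  from comp_relI[OF this a a' m refl] show ?thesis unfolding s by blast
qed

text \<open>With the new sort set to 1, a composition depends on its inner components only through
  their quotients \<open>Q j\<close>. Orbits on one side are carried to the other by composing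
  \<open>comp_rel\<close> with its inverse.\<close>

lemma quot_comp_transfer:
  fixes G G' :: "'i::finite \<Rightarrow> 'k::finite option spec"
  assumes H: "functorial H" and G: "\<And>j. functorial (G j)" and G': "\<And>j. functorial (G' j)"
    and q: "\<And>j. quot (G j) (Q j) (q j)" and q': "\<And>j. quot (G' j) (Q j) (q' j)"
    and z: "\<And>j. str (G j) no_labels = {}" and z': "\<And>j. str (G' j) no_labels = {}"
    and x: "quot (comp_sp H G) X x"
  shows "\<exists>x'. quot (comp_sp H G') X x'"
proof (rule quot_transfer[OF functorial_comp[OF H G] functorial_comp[OF H G'] x,
      of "comp_rel H G q G' q'"])
  note sym = comp_rel_sym[OF H] and trans = comp_rel_trans[OF H]
  fix W s W' s' assume r: "comp_rel H G q G' q' W s W' s'"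
  show st: "s \<in> str (comp_sp H G) W \<and> s' \<in> str (comp_sp H G') W' \<and> W \<circ> Some = W' \<circ> Some"
    using r unfolding comp_rel_def str_comp_iff by blast
  show "same_orbit (comp_sp H G) W s V t \<longleftrightarrow> same_orbit (comp_sp H G') W' s' V' t'"
    if r2: "comp_rel H G q G' q' V t V' t'" for V t V' t'
  proof
    assume "same_orbit (comp_sp H G) W s V t"
    with st have "comp_rel H G q G q W s V t"
      by (intro same_orbit_comp_rel[where Q = Q] H G q) blast+
    from trans[OF trans[OF sym[OF r] this] r2]
    show "same_orbit (comp_sp H G') W' s' V' t'"
      by (intro comp_rel_same_orbit[where Q = Q and q = q'] H G' q')
  next
    assume "same_orbit (comp_sp H G') W' s' V' t'"
    with st have "comp_rel H G' q' G' q' W' s' V' t'"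
      by (intro same_orbit_comp_rel[where Q = Q] H G' q') blast+
    from trans[OF trans[OF r this] sym[OF r2]]
    show "same_orbit (comp_sp H G) W s V t"
      by (intro comp_rel_same_orbit[where Q = Q and q = q] H G q)
  qed
  show "\<exists>\<sigma>. bij_tuple W \<sigma> \<and> \<sigma> \<circ> Some = \<sigma>' \<circ> Some \<and>
      comp_rel H G q G' q' (relabel \<sigma> W) (transport (comp_sp H G) W \<sigma> s)
        (relabel \<sigma>' W') (transport (comp_sp H G') W' \<sigma>' s')"
    if \<sigma>': "bij_tuple W' \<sigma>'" for \<sigma>'
  proof (intro exI conjI)
    let ?\<sigma> = "case_option id (\<sigma>' \<circ> Some)"
    show \<sigma>: "bij_tuple W ?\<sigma>" using st bij_tuple_o[OF \<sigma>', of Some] by (simp add: bij_tuple_option)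
    show eq: "?\<sigma> \<circ> Some = \<sigma>' \<circ> Some" by simp
    show "comp_rel H G q G' q' (relabel ?\<sigma> W) (transport (comp_sp H G) W ?\<sigma> s)
        (relabel \<sigma>' W') (transport (comp_sp H G') W' \<sigma>' s')"
      by (intro comp_rel_transport[where Q = Q] H G G' q q' r \<sigma> \<sigma>' eq)
  qed
next
  fix W s assume "s \<in> str (comp_sp H G) W"
  thus "\<exists>W' s'. comp_rel H G q G' q' W s W' s'" by (intro comp_rel_total[where Q = Q] H G' q q' z')
next
  fix W' s' assume "s' \<in> str (comp_sp H G') W'"
  hence "\<exists>W s. comp_rel H G' q' G q W' s' W s" by (intro comp_rel_total[where Q = Q] H G q q' z)
  thus "\<exists>W s. comp_rel H G q G' q' W s W' s'" using comp_rel_sym[OF H] by blast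
qed

section \<open>The companion system\<close>

text \<open>Moves families indexed by the sorts of \<open>H\<close> to the sorts of the companion
  system; \<open>d\<close> is the value at the new sort.\<close>

definition extend_sorts :: "'c \<Rightarrow> ('z + 'm \<Rightarrow> 'c) \<Rightarrow> 'z option + 'm \<Rightarrow> 'c" where
  "extend_sorts d P = case_sum (case_option d (P \<circ> Inl)) (P \<circ> Inr)"

lemma extend_sorts_simps [simp]:
  "extend_sorts d P (Inl None) = d" "extend_sorts d P (Inl (Some z)) = P (Inl z)" "extend_sorts d P (Inr i) = P (Inr i)"
  "extend_sorts d P (map_sum Some id j) = P j"
  by (simp_all add: extend_sorts_def split: sum.split) (cases j; simp)

lemma extend_sorts_o [simp]: "extend_sorts d P \<circ> map_sum Some id = P"
  by (simp add: fun_eq_iff)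

lemma extend_sorts_eta: "P (Inl None) = d \<Longrightarrow> extend_sorts d (P \<circ> map_sum Some id) = P"
  by (simp add: fun_eq_iff extend_sorts_def split: sum.split option.split)

lemma sort_cases [case_names new old]:
  fixes j :: "'z option + 'm"
  obtains "j = Inl None" | i where "j = map_sum Some id i"
proof (cases j)
  case (Inl x) thus thesis by (cases x) (use that(1) that(2)[of "Inl _"] in auto)
next
  case (Inr x) thus thesis using that(2)[of "Inr x"] by simp
qed

lemma map_sum_Some_neq [simp]: "map_sum Some id i \<noteq> Inl None" "Inl None \<noteq> map_sum Some id i"
  by (cases i; simp)+

lemma not_range_iff: "j \<notin> range (map_sum Some id) \<longleftrightarrow> j = Inl None"
  by (cases j rule: sort_cases) auto

lemma codes_o: "codes P \<circ> \<iota> = codes (P \<circ> \<iota>)"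
  by (simp add: codes_def fun_eq_iff)

lemma sorted_partition_extend_sorts: "sorted_partition W (extend_sorts {||} P) \<longleftrightarrow> sorted_partition W P"
proof
  assume P: "sorted_partition W (extend_sorts {||} P)"
  show "sorted_partition W P"
  proof (rule sorted_partitionI)
    fix j B assume B: "B |\<in>| P j"
    hence B': "B |\<in>| extend_sorts {||} P (map_sum Some id j)" by simp
    show "B \<noteq> no_labels" by (rule sorted_partition_nonempty[OF P B'])
    show "fset (B k) \<subseteq> fset (W k)" for k by (rule sorted_partition_subset[OF P B'])
    show "j = j' \<and> B = C" if "C |\<in>| P j'" "u |\<in>| B k" "u |\<in>| C k" for j' C u k
    proof -
      have "C |\<in>| extend_sorts {||} P (map_sum Some id j')" using that(1) by simp
      from sorted_partition_unique[OF P B' this that(2,3)]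
      have "map_sum Some id j = map_sum Some id j' \<and> B = C" .
      thus ?thesis by (cases j; cases j') auto
    qed
  next
    fix k u assume "u |\<in>| W k"
    then obtain j B where "B |\<in>| extend_sorts {||} P j" "u |\<in>| B k" using sorted_partition_cover[OF P] by blast
    thus "\<exists>j B. B |\<in>| P j \<and> u |\<in>| B k" by (cases j rule: sort_cases) auto
  qed
next
  assume P: "sorted_partition W P"
  show "sorted_partition W (extend_sorts {||} P)"
  proof (rule sorted_partitionI)
    fix j B assume B: "B |\<in>| extend_sorts {||} P j"
    then obtain i where i: "j = map_sum Some id i" "B |\<in>| P i" by (cases j rule: sort_cases) auto
    show "B \<noteq> no_labels" by (rule sorted_partition_nonempty[OF P i(2)])
    show "fset (B k) \<subseteq> fset (W k)" for k by (rule sorted_partition_subset[OF P i(2)])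
    show "j = j' \<and> B = C" if C: "C |\<in>| extend_sorts {||} P j'" "u |\<in>| B k" "u |\<in>| C k" for j' C u k
    proof -
      obtain i' where i': "j' = map_sum Some id i'" "C |\<in>| P i'" using C(1) by (cases j' rule: sort_cases) auto
      show ?thesis using sorted_partition_unique[OF P i(2) i'(2) C(2,3)] i i' by simp
    qed
  next
    fix k u assume "u |\<in>| W k"
    then obtain j B where "B |\<in>| P j" "u |\<in>| B k" using sorted_partition_cover[OF P] by blast
    thus "\<exists>j B. B |\<in>| extend_sorts {||} P j \<and> u |\<in>| B k"
      by (intro exI[of _ "map_sum Some id j"] exI[of _ B]) simp
  qed
qed

lemma sorted_partition_single:
  assumes "B \<noteq> no_labels"
  shows "sorted_partition U (\<lambda>i. if i = j then {|B|} else {||}) \<longleftrightarrow> U = B"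
proof
  assume P: "sorted_partition U (\<lambda>i. if i = j then {|B|} else {||})"
  show "U = B"
  proof (rule labels_eqI)
    fix k
    have "fset (B k) \<subseteq> fset (U k)" by (rule sorted_partition_subset[OF P, of _ j]) simp
    moreover have "u |\<in>| B k" if u: "u |\<in>| U k" for u
    proof -
      obtain i C where "C |\<in>| (if i = j then {|B|} else {||})" "u |\<in>| C k"
        using sorted_partition_cover[OF P u] .
      thus ?thesis by (auto split: if_splits)
    qed
    ultimately show "fset (U k) = fset (B k)" by blast
  qed
next
  assume "U = B"
  thus "sorted_partition U (\<lambda>i. if i = j then {|B|} else {||})"
    using assms by (intro sorted_partitionI) (auto split: if_splits)
qed

lemma sorted_partition_empty: "sorted_partition U (\<lambda>_. {||}) \<longleftrightarrow> U = no_labels"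
  unfolding sorted_partition_def no_labels_iff by auto

text \<open>\<open>mark_assembly\<close> and \<open>mark_constant\<close> provide the two kinds of
  structures of the companion composition: an assembly of \<open>H\<close> with at least one block,
  kept as it is, or a structure of \<open>H\<close> of size 0 carried by a single block of the new
  sort. In the latter, the inner value 0 is the structure of \<open>sort_sp None\<close> on that
  block.\<close>

definition mark_assembly where
  "mark_assembly P g f = enc (extend_sorts {||} P) (extend_sorts (\<lambda>_. 0) g) (unmarked f)"

definition new_block :: "'k labels \<Rightarrow> 'z option + 'm \<Rightarrow> 'k labels fset" where
  "new_block W = (\<lambda>j. if j = Inl None then {|W|} else {||})"

definition mark_constant where
  "mark_constant P f = enc P (\<lambda>_ _. 0) (marked (codes P) f)"

lemma mark_assembly_eq_iff:
  fixes P P' :: "'z::finite + 'm::finite \<Rightarrow> 'k::finite labels fset"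
  shows "mark_assembly P g f = mark_assembly P' g' f' \<longleftrightarrow> enc P g f = enc P' g' f'"
proof
  assume "mark_assembly P g f = mark_assembly P' g' f'"
  hence e: "extend_sorts {||} P = extend_sorts {||} P'" "f = f'"
    and g: "\<And>j B. B |\<in>| extend_sorts {||} P j \<Longrightarrow> extend_sorts (\<lambda>_. 0) g j B = extend_sorts (\<lambda>_. 0) g' j B"
    by (auto simp: mark_assembly_def enc_eq_iff)
  have "P = P'" using arg_cong[OF e(1), of "\<lambda>P. P \<circ> map_sum Some id"] by simp
  moreover have "g j B = g' j B" if "B |\<in>| P j" for j B using g[of B "map_sum Some id j"] that by simp
  ultimately show "enc P g f = enc P' g' f'" using e by (simp add: enc_eq_iff)
next
  assume "enc P g f = enc P' g' f'"
  hence e: "P = P'" "f = f'" and g: "\<And>j B. B |\<in>| P j \<Longrightarrow> g j B = g' j B"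
    by (auto simp: enc_eq_iff)
  have "extend_sorts (\<lambda>_. 0) g j B = extend_sorts (\<lambda>_. 0) g' j B" if "B |\<in>| extend_sorts {||} P j" for j B
    using that g by (cases j rule: sort_cases) auto
  thus "mark_assembly P g f = mark_assembly P' g' f'" using e by (auto simp: mark_assembly_def enc_eq_iff)
qed

context
  fixes H :: "('z::finite + 'm::finite) spec" and Y :: "'m \<Rightarrow> 'z option spec"
  assumes H: "functorial H" and Y: "\<And>i. functorial (Y i)"
begin

private abbreviation "K \<equiv> mark_zero (map_sum Some id) (Inl None) H"
private abbreviation "E \<equiv> case_sum sort_sp Y"
private abbreviation "G \<equiv> case_sum (sort_sp \<circ> Some) Y"
private abbreviation "nb W \<equiv> (new_block W :: 'z option + 'm \<Rightarrow> 'z option labels fset)"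

private abbreviation "no_blocks \<equiv> (\<lambda>_ :: 'z + 'm. {||} :: 'z option labels fset)"

private lemma E_old: "E (map_sum Some id j) = G j"
  by (cases j) simp_all

private lemma functorial_E: "functorial (E j)"
  by (cases j) (simp_all add: Y species_functorial species_sort)

private lemma functorial_G: "functorial (G j)"
  by (cases j) (simp_all add: Y species_functorial species_sort)

private lemma codes_eq_no_labels: "codes P = no_labels \<longleftrightarrow> P = (\<lambda>_. {||})"
  by (auto simp: codes_def no_labels_def fun_eq_iff)

private lemma assembly_marked:
  assumes "P \<noteq> (\<lambda>_. {||})"
  shows "assembly K E W (extend_sorts {||} P) (extend_sorts (\<lambda>_. 0) g) (unmarked f) \<longleftrightarrow> assembly H G W P g f"
proof -
  have "unmarked f \<in> str K (codes (extend_sorts {||} P)) \<longleftrightarrow> f \<in> str H (codes P)"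
    using assms by (simp add: str_mark_zero codes_o codes_eq_no_labels not_range_iff) (simp add: codes_def)
  moreover have "(\<forall>j B. B |\<in>| extend_sorts {||} P j \<longrightarrow> extend_sorts (\<lambda>_. 0) g j B \<in> str (E j) B)
      \<longleftrightarrow> (\<forall>j B. B |\<in>| P j \<longrightarrow> g j B \<in> str (G j) B)" (is "?l \<longleftrightarrow> ?r")
  proof
    assume ?l
    show ?r
    proof (intro allI impI)
      fix j B assume "B |\<in>| P j"
      thus "g j B \<in> str (G j) B" using \<open>?l\<close>[rule_format, of B "map_sum Some id j"] by (simp add: E_old)
    qed
  next
    assume ?r
    show ?l
    proof (intro allI impI)
      fix j B assume "B |\<in>| extend_sorts {||} P j"
      thus "extend_sorts (\<lambda>_. 0) g j B \<in> str (E j) B"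
        using \<open>?r\<close> by (cases j rule: sort_cases) (simp_all add: E_old)
    qed
  qed
  ultimately show ?thesis unfolding assembly_def sorted_partition_extend_sorts by blast
qed

text \<open>The summand of the outer structure decides. Unmarked means no block of the new sort and
  at least one other block; marked means exactly one block, of the new sort, which has to be all of
  \<open>W\<close> and hence a single label of sort \<open>None\<close>.\<close>

private lemma comp_companion_cases:
  assumes "s \<in> str (comp_sp K E) W"
  obtains P g f where "P \<noteq> (\<lambda>_. {||})" "assembly H G W P g f" "s = mark_assembly P g f"
  | f where "f \<in> str H no_labels" "W \<circ> Some = no_labels" "fcard (W None) = 1" "s = mark_constant (nb W) f"
proof -
  obtain P g f where s: "s = enc P g f" and a: "assembly K E W P g f"
    using assms unfolding str_comp_iff by blast
  from a have f: "f \<in> str K (codes P)" by (simp add: assembly_def)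
  then consider (l) y where "f = unmarked y" "codes P (Inl None) = {||}" "codes P \<circ> map_sum Some id \<noteq> no_labels"
    | (r) h where "f = marked (codes P) h" "fcard (codes P (Inl None)) = 1" "\<forall>j. j \<noteq> Inl None \<longrightarrow> codes P j = {||}" "h \<in> str H no_labels"
    unfolding str_mark_zero not_range_iff by blast
  thus thesis
  proof cases
    case l
    have P: "P (Inl None) = {||}" using l(2) by (simp add: codes_def)
    let ?P = "P \<circ> map_sum Some id" and ?g = "g \<circ> map_sum Some id"
    have ne: "?P \<noteq> (\<lambda>_. {||})" using l(3) unfolding codes_o codes_eq_no_labels .
    have eP: "extend_sorts {||} ?P = P" using P by (rule extend_sorts_eta)
    have "extend_sorts (\<lambda>_. 0) ?g j B = g j B" if "B |\<in>| P j" for j B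
      using that P by (cases j rule: sort_cases) auto
    hence s': "s = mark_assembly ?P ?g y" by (simp add: s mark_assembly_def enc_eq_iff eP l(1))
    \<comment> \<open>The extension of \<open>?g\<close> by 0 agrees with \<open>g\<close> on all
      blocks, so both give the same code, and being an assembly depends only on the code.\<close>
    have "enc (extend_sorts {||} ?P) (extend_sorts (\<lambda>_. 0) ?g) (unmarked y) \<in> str (comp_sp K E) W"
      using assms s' by (simp add: mark_assembly_def)
    then obtain P2 g2 f2 where e: "enc (extend_sorts {||} ?P) (extend_sorts (\<lambda>_. 0) ?g) (unmarked y) = enc P2 g2 f2"
      and a2: "assembly K E W P2 g2 f2" unfolding str_comp_iff by blast
    have "assembly K E W (extend_sorts {||} ?P) (extend_sorts (\<lambda>_. 0) ?g) (unmarked y)"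
      using a2 e unfolding assembly_def enc_eq_iff by auto
    hence "assembly H G W ?P ?g y" using assembly_marked[OF ne] by simp
    thus thesis using that(1) ne s' by blast
  next
    case r
    obtain B where B: "P (Inl None) = {|B|}"
    proof -
      have "fcard (P (Inl None)) = 1" using r(2) shape_codes[of P] by (metis shape_def)
      thus thesis by (rule fcard_eq_1E) (rule that)
    qed
    have P: "P = nb B"
    proof
      fix j show "P j = nb B j" using r(3) B by (auto simp: new_block_def codes_def)
    qed
    have p: "sorted_partition W (nb B)" using a by (simp add: assembly_def P)
    have "B \<noteq> no_labels" using sorted_partition_nonempty[OF p, of B "Inl None"] by (simp add: new_block_def)
    hence WB: "W = B" using p sorted_partition_single[of B W "Inl None :: 'z option + 'm"] unfolding new_block_def by simp
    have g: "g (Inl None) B \<in> str (E (Inl None)) B" using a B unfolding assembly_def by (metis finsertI1)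
    hence g: "g (Inl None) B = 0" "fcard (B None) = 1" "B \<circ> Some = no_labels"
      by (auto simp: sort_sp_simps fun_eq_iff no_labels_def)
    have "s = mark_constant (nb W) h" unfolding s mark_constant_def
      using g P WB r(1) by (auto simp: enc_eq_iff new_block_def)
    thus thesis using that(2) r(4) g WB by blast
  qed
qed

private lemma mark_constant_in:
  assumes "f \<in> str H no_labels" "W \<circ> Some = no_labels" "fcard (W None) = 1"
  shows "assembly K E W (nb W) (\<lambda>_ _. 0) (marked (codes (nb W)) f)"
proof -
  have "W \<noteq> no_labels" using assms(3) by (auto simp: no_labels_def fcard.rep_eq)
  hence "sorted_partition W (nb W)" unfolding new_block_def by (simp add: sorted_partition_single)
  moreover have "0 \<in> str (sort_sp None) W"
    using assms(2,3) by (auto simp: sort_sp_simps no_labels_def fun_eq_iff)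
  moreover have "fcard (codes (nb W) (Inl None)) = 1"
    by (simp add: codes_def new_block_def fcard.rep_eq)
  ultimately show ?thesis using assms(1) unfolding assembly_def str_mark_zero
    by (auto simp: new_block_def codes_def split: if_splits)
qed

private lemma transport_mark_assembly:
  assumes a: "assembly H G W P g f" and \<sigma>: "bij_tuple W \<sigma>" and ne: "P \<noteq> (\<lambda>_. {||})"
  obtains P' g' f' where "P' \<noteq> (\<lambda>_. {||})" "assembly H G (relabel \<sigma> W) P' g' f'"
    "transport (comp_sp H G) W \<sigma> (enc P g f) = enc P' g' f'"
    "transport (comp_sp K E) W \<sigma> (mark_assembly P g f) = mark_assembly P' g' f'"
proof -
  have P: "sorted_partition W P" using a by (simp add: assembly_def)
  let ?P = "\<lambda>j. relabel \<sigma> |`| P j" and ?g = "transport_blocks G \<sigma> P g"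
  let ?f = "transport H (codes P) (on_codes (\<lambda>_. relabel \<sigma>)) f"
  note eq = transport_blocks_eq[OF P \<sigma>, of _ _ G g]
  have 1: "?P \<noteq> (\<lambda>_. {||})" using ne by (auto simp: fun_eq_iff)
  have 2: "assembly H G (relabel \<sigma> W) ?P ?g ?f"
    by (rule assembly_transport[OF H functorial_G a \<sigma> eq])
  have 3: "transport (comp_sp H G) W \<sigma> (enc P g f) = enc ?P ?g ?f"
    by (rule transport_enc) (rule eq)
  have "transport (comp_sp K E) W \<sigma> (mark_assembly P g f) =
    enc (\<lambda>j. relabel \<sigma> |`| extend_sorts {||} P j) (extend_sorts (\<lambda>_. 0) ?g)
      (transport K (codes (extend_sorts {||} P)) (on_codes (\<lambda>_. relabel \<sigma>)) (unmarked f))"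
    unfolding mark_assembly_def
  proof (rule transport_enc)
    fix j B assume "B |\<in>| extend_sorts {||} P j"
    thus "extend_sorts (\<lambda>_. 0) ?g j (relabel \<sigma> B) = transport (E j) B \<sigma> (extend_sorts (\<lambda>_. 0) g j B)"
      using eq by (cases j rule: sort_cases) (simp_all add: E_old)
  qed
  moreover have "(\<lambda>j. relabel \<sigma> |`| extend_sorts {||} P j) = extend_sorts {||} ?P"
  proof
    fix j show "relabel \<sigma> |`| extend_sorts {||} P j = extend_sorts {||} ?P j" by (cases j rule: sort_cases) simp_all
  qed
  moreover have "transport K (codes (extend_sorts {||} P)) (on_codes (\<lambda>_. relabel \<sigma>)) (unmarked f) = unmarked ?f"
  proof -
    have "on_codes (\<lambda>_ :: 'z option + 'm. relabel \<sigma>) \<circ> (map_sum Some id :: 'z + 'm \<Rightarrow> _)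
        = on_codes (\<lambda>_. relabel \<sigma>)"
      by (simp add: on_codes_def fun_eq_iff)
    thus ?thesis by (simp add: transport_unmarked codes_o)
  qed
  ultimately have "transport (comp_sp K E) W \<sigma> (mark_assembly P g f) = mark_assembly ?P ?g ?f"
    by (simp add: mark_assembly_def)
  with 1 2 3 show thesis by (rule that)
qed

private lemma transport_mark_constant:
  assumes "f \<in> str H no_labels"
  shows "transport (comp_sp K E) W \<sigma> (mark_constant (nb W) f) = mark_constant (nb (relabel \<sigma> W)) f"
proof -
  have "transport (comp_sp K E) W \<sigma> (mark_constant (nb W) f) = enc (\<lambda>j. relabel \<sigma> |`| nb W j) (\<lambda>_ _. 0)
     (transport K (codes (nb W)) (on_codes (\<lambda>_. relabel \<sigma>)) (marked (codes (nb W)) f))"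
    unfolding mark_constant_def
    by (rule transport_enc) (auto simp: new_block_def sort_sp_simps split: if_splits)
  moreover have "(\<lambda>j. relabel \<sigma> |`| nb W j) = nb (relabel \<sigma> W)"
    by (simp add: new_block_def fun_eq_iff)
  ultimately show ?thesis
    by (simp add: transport_marked[OF H assms] relabel_on_codes mark_constant_def)
qed

private lemma transport_constant:
  assumes "f \<in> str H no_labels"
  shows "transport (comp_sp H G) no_labels \<sigma> (enc no_blocks (\<lambda>_ _. 0) f) = enc no_blocks (\<lambda>_ _. 0) f"
proof (rule transport_fix[OF functorial_comp[OF H functorial_G]])
  have "codes no_blocks = no_labels" by (simp add: codes_eq_no_labels)
  thus "enc no_blocks (\<lambda>_ _. 0) f \<in> str (comp_sp H G) no_labels"
    using assms by (intro enc_in_comp) (simp add: assembly_def sorted_partition_empty)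
qed (simp add: no_labels_def)

text \<open>Constants sit over \<open>no_labels\<close> on the side of \<open>H\<close>, but over
  one label of sort \<open>None\<close> on the companion side; for all other structures the labels
  agree.\<close>

private definition R where
  "R W s W' s' \<longleftrightarrow>
    (\<exists>P g f. P \<noteq> (\<lambda>_. {||}) \<and> assembly H G W P g f \<and> W' = W \<and> s = enc P g f \<and> s' = mark_assembly P g f) \<or>
    (\<exists>f. f \<in> str H no_labels \<and> W = no_labels \<and> s = enc no_blocks (\<lambda>_ _. 0) f \<and>
       W' \<circ> Some = no_labels \<and> fcard (W' None) = 1 \<and> s' = mark_constant (nb W') f)"

private lemma R_cases:
  assumes "R W s W' s'"
  obtains P g f where "P \<noteq> (\<lambda>_. {||})" "assembly H G W P g f" "W' = W" "s = enc P g f"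
      "s' = mark_assembly P g f" "W \<noteq> no_labels"
  | f where "f \<in> str H no_labels" "W = no_labels" "s = enc no_blocks (\<lambda>_ _. 0) f"
      "W' \<circ> Some = no_labels" "fcard (W' None) = 1" "s' = mark_constant (nb W') f"
proof -
  have "W \<noteq> no_labels" if ne: "P \<noteq> (\<lambda>_. {||})" and a: "assembly H G W P g f" for P g f
  proof
    assume W: "W = no_labels"
    from a have P: "sorted_partition W P" by (simp add: assembly_def)
    obtain j B where B: "B |\<in>| P j" using ne by (auto simp: fun_eq_iff)
    have "fset (B k) \<subseteq> {}" for k
      using sorted_partition_subset[OF P B, of k] by (simp add: W no_labels_def)
    hence "B = no_labels" by (auto simp: no_labels_iff)
    thus False using sorted_partition_nonempty[OF P B] by simp
  qed
  thus thesis using assms that unfolding R_def by blast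
qed

text \<open>Assemblies with blocks and constants never share an orbit, on either side. For
  assemblies the same \<open>\<beta>\<close> works on both sides; for constants the orbit is
  determined by \<open>f\<close>, since the one new label moves freely.\<close>

private lemma R_orbit:
  assumes r: "R W s W' s'" and r2: "R V t V' t'" and e: "W \<circ> Some = V \<circ> Some"
  shows "same_orbit (comp_sp H G) W s V t \<longleftrightarrow> same_orbit (comp_sp K E) W' s' V' t'"
  using r
proof (cases rule: R_cases)
  case (1 P g f)
  note one = this
  show ?thesis using r2
  proof (cases rule: R_cases)
    case (1 P2 g2 f2)
    have "transport (comp_sp H G) W (on_None \<beta>) s = t \<longleftrightarrow> transport (comp_sp K E) W (on_None \<beta>) s' = t'"
      if "inj_on \<beta> (fset (W None))" for \<beta>
    proof -
      have "bij_tuple W (on_None \<beta>)" using that by simp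
      from transport_mark_assembly[OF one(2) this one(1)] show ?thesis
        unfolding one(4,5) 1(4,5) by (metis mark_assembly_eq_iff)
    qed
    thus ?thesis unfolding same_orbit_def one(3) 1(3) by blast
  next
    case (2 f2)
    have "\<not> same_orbit (comp_sp H G) W s V t"
      using one(6) 2(2) relabel_eq_no_labels unfolding same_orbit_def by metis
    moreover have "\<not> same_orbit (comp_sp K E) W' s' V' t'"
    proof
      assume "same_orbit (comp_sp K E) W' s' V' t'"
      then obtain \<beta> where \<beta>: "inj_on \<beta> (fset (W None))" "transport (comp_sp K E) W (on_None \<beta>) s' = t'"
        unfolding same_orbit_def one(3) by blast
      hence "bij_tuple W (on_None \<beta>)" by simp
      from transport_mark_assembly[OF one(2) this one(1)] \<beta>(2)
      obtain P' :: "'z + 'm \<Rightarrow> 'z option labels fset" and g' f' where "t' = mark_assembly P' g' f'"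
        unfolding one(5) by metis
      thus False using 2(6) by (simp add: mark_assembly_def mark_constant_def enc_eq_iff)
    qed
    ultimately show ?thesis by blast
  qed
next
  case (2 f)
  note two = this
  show ?thesis using r2
  proof (cases rule: R_cases)
    case (1 P2 g2 f2)
    have "\<not> same_orbit (comp_sp H G) W s V t"
      using 1(6) two(2) relabel_no_labels unfolding same_orbit_def by metis
    moreover have "\<not> same_orbit (comp_sp K E) W' s' V' t'"
    proof
      assume "same_orbit (comp_sp K E) W' s' V' t'"
      then obtain W2 where "t' = mark_constant (nb W2) f"
        unfolding same_orbit_def two(6) transport_mark_constant[OF two(1)] by blast
      thus False using 1(5) by (simp add: mark_assembly_def mark_constant_def enc_eq_iff)
    qed
    ultimately show ?thesis by blast
  next
    case (2 f2)
    have "same_orbit (comp_sp H G) W s V t \<longleftrightarrow> f = f2"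
      unfolding same_orbit_def two(2,3) 2(2,3) transport_constant[OF two(1)]
      by (auto simp: enc_eq_iff intro!: exI[of _ id])
    moreover have "same_orbit (comp_sp K E) W' s' V' t' \<longleftrightarrow> f = f2"
    proof
      assume "same_orbit (comp_sp K E) W' s' V' t'"
      then obtain W2 where "mark_constant (nb V') f2 = mark_constant (nb W2) f"
        unfolding same_orbit_def two(6) transport_mark_constant[OF two(1)] 2(6) by metis
      thus "f = f2" by (simp add: mark_constant_def enc_eq_iff)
    next
      assume ff: "f = f2"
      obtain a where a: "W' None = {|a|}" using two(5) by (rule fcard_eq_1E)
      obtain b where b: "V' None = {|b|}" using 2(5) by (rule fcard_eq_1E)
      have "relabel (on_None (\<lambda>_. b)) W' = V'"
        by (rule option_labels_eqI) (simp_all add: a b two(4) 2(4))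
      thus "same_orbit (comp_sp K E) W' s' V' t'" unfolding same_orbit_def two(6) transport_mark_constant[OF two(1)]
        using ff 2(6) a by (intro exI[of _ "\<lambda>_. b"]) simp
    qed
    ultimately show ?thesis by simp
  qed
qed

text \<open>The companion only attaches a new label to each structure of size 0, and this label is
  forgotten when the new sort is set to 1. As \<open>Y\<close> may itself use the new sort,
  \<open>H\<close> is composed here over all sorts including \<open>None\<close>, with the sorts of
  \<open>Z\<close> entering as \<open>sort_sp (Some z)\<close>.\<close>

lemma quot_companion:
  assumes x: "quot (comp_sp H (case_sum (sort_sp \<circ> Some) Y)) X x"
  shows "\<exists>x'. quot (comp_sp (mark_zero (map_sum Some id) (Inl None) H) (case_sum sort_sp Y)) X x'"
proof (rule quot_transfer[OF _ _ x, of _ R])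
  show "functorial (comp_sp H G)" by (rule functorial_comp[OF H functorial_G])
  show "functorial (comp_sp K E)" by (rule functorial_comp[OF functorial_mark_zero[OF H] functorial_E])
  show "\<exists>W' s'. R W s W' s'" if s: "s \<in> str (comp_sp H G) W" for W s
  proof -
    obtain P g f where s: "s = enc P g f" and a: "assembly H G W P g f"
      using s unfolding str_comp_iff by blast
    show ?thesis
    proof (cases "P = (\<lambda>_. {||})")
      case True
      have 1: "f \<in> str H no_labels" "W = no_labels"
        using a by (auto simp: assembly_def True codes_eq_no_labels[THEN iffD2] sorted_partition_empty)
      have 2: "s = enc no_blocks (\<lambda>_ _. 0) f" by (simp add: s True enc_eq_iff)
      let ?W = "case_option {|0|} no_labels"
      have "R W s ?W (mark_constant (nb ?W) f)" unfolding R_def using 1 2 by (auto simp: fcard.rep_eq)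
      thus ?thesis by blast
    next
      case False
      hence "R W s W (mark_assembly P g f)" unfolding R_def using s a by blast
      thus ?thesis by blast
    qed
  qed
  show "\<exists>W s. R W s W' s'" if "s' \<in> str (comp_sp K E) W'" for W' s'
    using that
  proof (cases rule: comp_companion_cases)
    case (1 P g f)
    hence "R W' (enc P g f) W' s'" unfolding R_def by blast
    thus ?thesis by blast
  next
    case (2 f)
    hence "R no_labels (enc no_blocks (\<lambda>_ _. 0) f) W' s'" unfolding R_def by blast
    thus ?thesis by blast
  qed
  fix W s W' s' assume r: "R W s W' s'"
  show "same_orbit (comp_sp H G) W s V t \<longleftrightarrow> same_orbit (comp_sp K E) W' s' V' t'"
    if "R V t V' t'" "W \<circ> Some = V \<circ> Some" for V t V' t'
    by (rule R_orbit[OF r that])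
  show "s \<in> str (comp_sp H G) W \<and> s' \<in> str (comp_sp K E) W' \<and> W \<circ> Some = W' \<circ> Some"
    using r
  proof (cases rule: R_cases)
    case (1 P g f)
    have "s' \<in> str (comp_sp K E) W'"
      unfolding 1(3,5) mark_assembly_def using assembly_marked[OF 1(1)] 1(2) by (intro enc_in_comp) blast
    thus ?thesis using enc_in_comp[OF 1(2)] 1 by simp
  next
    case (2 f)
    have "s' \<in> str (comp_sp K E) W'"
      unfolding 2(6) mark_constant_def by (rule enc_in_comp[OF mark_constant_in[OF 2(1,4,5)]])
    moreover have "s \<in> str (comp_sp H G) W"
      unfolding 2(2,3) using 2(1)
      by (intro enc_in_comp) (simp add: assembly_def sorted_partition_empty codes_eq_no_labels[THEN iffD2])
    moreover have "W \<circ> Some = W' \<circ> Some" unfolding 2(2,4) by (simp add: no_labels_def fun_eq_iff)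
    ultimately show ?thesis by blast
  qed
  show "\<exists>\<sigma>. bij_tuple W \<sigma> \<and> \<sigma> \<circ> Some = \<sigma>' \<circ> Some \<and>
      R (relabel \<sigma> W) (transport (comp_sp H G) W \<sigma> s) (relabel \<sigma>' W') (transport (comp_sp K E) W' \<sigma>' s')"
    if \<sigma>': "bij_tuple W' \<sigma>'" for \<sigma>'
    using r
  proof (cases rule: R_cases)
    case (1 P g f)
    have \<sigma>: "bij_tuple W \<sigma>'" using \<sigma>' 1(3) by simp
    from transport_mark_assembly[OF 1(2) \<sigma> 1(1)] obtain P' g' f' where
      "P' \<noteq> (\<lambda>_. {||})" "assembly H G (relabel \<sigma>' W) P' g' f'"
      "transport (comp_sp H G) W \<sigma>' s = enc P' g' f'"
      "transport (comp_sp K E) W \<sigma>' s' = mark_assembly P' g' f'" unfolding 1(4,5) by blast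
    hence "R (relabel \<sigma>' W) (transport (comp_sp H G) W \<sigma>' s) (relabel \<sigma>' W') (transport (comp_sp K E) W' \<sigma>' s')"
      unfolding R_def 1(3) by blast
    thus ?thesis using \<sigma> by blast
  next
    case (2 f)
    have "relabel \<sigma>' W' \<circ> Some = no_labels" unfolding relabel_o 2(4) by simp
    moreover have "fcard (relabel \<sigma>' W' None) = 1"
      using shape_relabel[OF \<sigma>'] 2(5) unfolding shape_def by metis
    ultimately have "R (relabel \<sigma>' W) (transport (comp_sp H G) W \<sigma>' s) (relabel \<sigma>' W') (transport (comp_sp K E) W' \<sigma>' s')"
      unfolding R_def 2(2,3,6) transport_constant[OF 2(1)] transport_mark_constant[OF 2(1)]
      using 2(1) by auto
    moreover have "bij_tuple W \<sigma>'" by (simp add: 2(2))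
    ultimately show ?thesis by blast
  qed
qed

end

text \<open>By definition \<open>gcomp_sp\<close> is the quotient of \<open>H\<close> composed with
  marked copies of \<open>Z i\<close>. A marked copy and \<open>Y i\<close> have the same quotient
  \<open>Z i\<close>, so the copies can be exchanged for the \<open>Y i\<close>, and then
  \<open>H\<close> for its companion.\<close>

lemma quot_iteration_step:
  fixes H :: "('z::finite + 'm::finite) spec"
  assumes H: "functorial H" and Y: "\<And>i. functorial (Y i)" and Z: "\<And>i. functorial (Z i)"
    and q: "\<And>i. quot (Y i) (Z i) (q i)" and zero: "\<And>i. str (Y i) no_labels = {}"
  shows "\<exists>x. quot (comp_sp (mark_zero (map_sum Some id) (Inl None) H) (case_sum sort_sp Y))
    (gcomp_sp H (case_sum sort_sp Z)) x"
proof -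
  let ?M = "\<lambda>j. mark_zero Some None (case_sum sort_sp Z j)"
  let ?G = "case_sum (sort_sp \<circ> Some) Y"
  let ?Q = "case_sum sort_sp Z :: 'z + 'm \<Rightarrow> 'z spec"
  have Q: "functorial (?Q j)" for j by (cases j) (simp_all add: Z species_functorial species_sort)
  hence M: "functorial (?M j)" for j by (rule functorial_mark_zero)
  obtain m where m: "\<And>j. quot (?M j) (?Q j) (m j)" using quot_mark_zero[OF Q] by metis
  have G: "functorial (?G j)" for j by (cases j) (simp_all add: Y species_functorial species_sort)
  have g: "quot (?G j) (?Q j) (case_sum (\<lambda>_ _ s. s) q j)" for j
    by (cases j) (simp_all add: q quot_sort)
  have zero': "str (?G j) no_labels = {}" for j
  proof (cases j)
    case Inl
    thus ?thesis by (auto simp: sort_sp_simps no_labels_def fcard.rep_eq)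
  qed (simp add: zero)
  have "\<exists>x. quot (comp_sp H ?G) (gcomp_sp H ?Q) x"
    unfolding gcomp_sp_def
    by (rule quot_comp_transfer[where Q = ?Q, OF H M G m g mark_zero_no_labels zero'
          quot_at_one[OF functorial_comp[OF H M]]])
  then obtain x where "quot (comp_sp H ?G) (gcomp_sp H ?Q) x" by blast
  thus ?thesis by (intro quot_companion H Y)
qed

section \<open>Systems that are well founded at zero\<close>

lemma species_case_sum: "(\<And>i. species (Y i)) \<Longrightarrow> species (case_sum sort_sp Y j)"
  by (cases j) (simp_all add: species_sort)

lemma species_iteration_at_0: "(\<And>i. species (K i)) \<Longrightarrow> species (iteration_at_0 K n i)"
proof (induction n arbitrary: i)
  case (Suc n)
  show ?case unfolding iteration_at_0.simps
    by (intro species_comp species_case_sum Suc.prems Suc.IH)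
qed (simp add: species_zero)

lemma emb_at_zero: "emb_at k zero_sp F"
  unfolding emb_at_def by (intro exI[of _ "\<lambda>_ s. s"] natural_atI) simp_all

lemma emb_at_case_sum:
  "(\<And>i. emb_at k (Y i) (Y' i)) \<Longrightarrow> emb_at k (case_sum sort_sp Y j) (case_sum sort_sp Y' j)"
  by (cases j) (simp_all add: emb_at_iso)

text \<open>Composition preserves embeddings of the inner components, and the iteration starts from
  the empty species, which embeds into everything.\<close>

lemma iteration_at_0_emb_Suc:
  assumes K: "\<And>i. species (K i)"
  shows "emb_at k (iteration_at_0 K n i) (iteration_at_0 K (Suc n) i)"
proof (induction n arbitrary: i k)
  case 0
  show ?case by (simp add: emb_at_zero)
next
  case (Suc n)
  let ?G = "\<lambda>n. case_sum sort_sp (iteration_at_0 K n)"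
  have "emb_at k (comp_sp (K i) (?G n)) (comp_sp (K i) (?G (Suc n)))"
  proof (rule comp_emb_at[where D = "\<lambda>_. UNIV"])
    show "functorial (?G n j)" for j
      by (intro species_functorial species_case_sum species_iteration_at_0 K)
    show "emb_at k' (?G n j) (?G (Suc n) j)" for j k' by (rule emb_at_case_sum[OF Suc.IH])
  qed (simp_all add: species_functorial K)
  thus ?case by simp
qed

lemma emb_at_refl: "emb_at k F F"
  by (rule emb_at_iso[OF iso_at_refl])

lemma iteration_at_0_emb:
  assumes K: "\<And>i. species (K i)" and "n \<le> m"
  shows "emb_at k (iteration_at_0 K n i) (iteration_at_0 K m i)"
  using assms(2)
proof (induction m rule: dec_induct)
  case base show ?case by (rule emb_at_refl)
next
  case (step m)
  show ?case by (rule emb_at_trans[OF step.IH iteration_at_0_emb_Suc[OF K]])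
qed

lemma comp_no_labels:
  assumes "str F no_labels = {}"
  shows "str (comp_sp F G) no_labels = {}"
proof -
  have False if a: "assembly F G no_labels P g f" for P g f
  proof -
    from a have P: "sorted_partition no_labels P" by (simp add: assembly_def)
    have "P j = {||}" for j
    proof (rule ccontr)
      assume "P j \<noteq> {||}"
      then obtain B where B: "B |\<in>| P j" by auto
      have "fset (B k) \<subseteq> {}" for k
        using sorted_partition_subset[OF P B, of k] by (simp add: no_labels_def)
      hence "B = no_labels" by (auto simp: no_labels_iff)
      thus False using sorted_partition_nonempty[OF P B] by simp
    qed
    hence "codes P = no_labels" by (simp add: codes_def no_labels_def)
    thus False using a assms by (simp add: assembly_def)
  qed
  thus ?thesis by (auto simp: str_comp_iff)
qed

lemma is_zero_at_zero_iff: "is_zero (at_zero F) \<longleftrightarrow> str F no_labels = {}"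
  by (auto simp: is_zero_def at_zero_def)

lemma sum_shape_mono:
  fixes B U :: "'i::finite labels"
  assumes "\<And>k. fset (B k) \<subseteq> fset (U k)"
  shows "(\<Sum>i\<in>UNIV. shape B i) \<le> (\<Sum>i\<in>UNIV. shape U i)"
  by (rule sum_mono) (simp add: shape_def fcard.rep_eq card_mono assms)

lemma sum_shape_eq_imp_eq:
  fixes B U :: "'i::finite labels"
  assumes s: "\<And>k. fset (B k) \<subseteq> fset (U k)" and e: "(\<Sum>i\<in>UNIV. shape B i) = (\<Sum>i\<in>UNIV. shape U i)"
  shows "B = U"
proof (rule labels_eqI)
  fix k
  have le: "shape B i \<le> shape U i" for i by (simp add: shape_def fcard.rep_eq card_mono s)
  have "shape B k = shape U k"
  proof (rule ccontr)
    assume "shape B k \<noteq> shape U k"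
    hence "shape B k < shape U k" using le[of k] by simp
    hence "(\<Sum>i\<in>UNIV. shape B i) < (\<Sum>i\<in>UNIV. shape U i)" using le by (intro sum_strict_mono_ex1) auto
    thus False using e by simp
  qed
  thus "fset (B k) = fset (U k)" using s by (intro card_subset_eq) (simp_all add: shape_def fcard.rep_eq)
qed

text \<open>A block as large as \<open>U\<close> equals \<open>U\<close> and leaves no label for
  another nonempty block. Such a partition carries only a linear outer structure, which is why
  linear terms govern uniqueness.\<close>

lemma sorted_partition_full_block:
  fixes P :: "'j \<Rightarrow> 'i::finite labels fset"
  assumes P: "sorted_partition U P" and B: "B |\<in>| P j"
    and e: "(\<Sum>i\<in>UNIV. shape B i) = (\<Sum>i\<in>UNIV. shape U i)"
  shows "B = U" "P = (\<lambda>i. if i = j then {|U|} else {||})"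
proof -
  show BU: "B = U" by (rule sum_shape_eq_imp_eq[OF sorted_partition_subset[OF P B] e])
  have *: "i = j \<and> C = U" if C: "C |\<in>| P i" for i C
  proof -
    obtain k u where u: "u |\<in>| C k" using sorted_partition_nonempty[OF P C] unfolding no_labels_iff by blast
    hence "u |\<in>| B k" using sorted_partition_subset[OF P C, of k] BU by auto
    thus ?thesis using sorted_partition_unique[OF P C B u] BU by simp
  qed
  show "P = (\<lambda>i. if i = j then {|U|} else {||})"
  proof
    fix i
    have "C |\<in>| P i \<longleftrightarrow> i = j \<and> C = U" for C using *[of C i] B BU by blast
    thus "P i = (if i = j then {|U|} else {||})" by (intro fset_eqI) simp
  qed
qed

lemma sorted_partition_sum_shape:
  fixes P :: "'j \<Rightarrow> 'i::finite labels fset"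
  assumes "sorted_partition U P" "B |\<in>| P j"
  shows "(\<Sum>i\<in>UNIV. shape B i) \<le> (\<Sum>i\<in>UNIV. shape U i)"
  by (rule sum_shape_mono) (rule sorted_partition_subset[OF assms])

section \<open>Limits as solutions, and the linear terms of a system\<close>

lemma has_limit_iso:
  assumes "has_limit Y L"
  shows "\<exists>N. \<forall>n k i. (\<Sum>z\<in>UNIV. k z) \<le> p \<longrightarrow> n \<ge> N \<longrightarrow> iso_at k (Y n i) (L i)"
  using assms unfolding has_limit_def contact_iff by meson

lemma has_limit_species: "has_limit Y L \<Longrightarrow> species (L i)"
  unfolding has_limit_def by blast

text \<open>Every iterate embeds into all later ones, and these eventually agree with the limit in
  the given shape.\<close>

lemma has_limit_emb:
  assumes K: "\<And>i. species (K i)" and L: "has_limit (iteration_at_0 K) L"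
  shows "emb_at k (iteration_at_0 K n i) (L i)"
proof -
  obtain N where N: "\<And>n k' i. (\<Sum>z\<in>UNIV. k' z) \<le> (\<Sum>z\<in>UNIV. k z) \<Longrightarrow> n \<ge> N \<Longrightarrow> iso_at k' (iteration_at_0 K n i) (L i)"
    using has_limit_iso[OF L, where p = "(\<Sum>z\<in>UNIV. k z)"] by blast
  have "emb_at k (iteration_at_0 K n i) (iteration_at_0 K (max n N) i)"
    by (rule iteration_at_0_emb[OF K]) simp
  moreover have "emb_at k (iteration_at_0 K (max n N) i) (L i)"
    by (rule emb_at_iso[OF N]) simp_all
  ultimately show ?thesis by (rule emb_at_trans)
qed

lemma iteration_at_0_no_labels:
  assumes "\<And>i. str (K i) no_labels = {}"
  shows "str (iteration_at_0 K n i) no_labels = {}"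
  by (cases n) (simp_all add: comp_no_labels assms)

text \<open>Blocks are no larger than \<open>U\<close>, so agreement of an iterate with
  \<open>L\<close> up to the size of \<open>U\<close> passes through the composition with
  \<open>K i\<close>.\<close>

lemma limit_is_solution:
  fixes K :: "'m::finite \<Rightarrow> ('z::finite + 'm) spec"
  assumes K: "\<And>i. species (K i)" and K0: "\<And>i. str (K i) no_labels = {}"
    and L: "has_limit (iteration_at_0 K) L"
  shows "solution_at_0 K L"
  unfolding solution_at_0_def is_zero_at_zero_iff iso_sp_iff
proof (intro conjI allI)
  show sL: "species (L i)" for i by (rule has_limit_species[OF L])
  fix i
  show "iso_at k (L i) (comp_sp (K i) (case_sum sort_sp L))" for k
  proof -
    obtain N where N: "\<And>n k' i. (\<Sum>z\<in>UNIV. k' z) \<le> (\<Sum>z\<in>UNIV. k z) \<Longrightarrow> n \<ge> N \<Longrightarrow> iso_at k' (iteration_at_0 K n i) (L i)"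
      using has_limit_iso[OF L, where p = "(\<Sum>z\<in>UNIV. k z)"] by blast
    have "iso_at k (L i) (iteration_at_0 K (Suc N) i)"
      by (rule iso_at_sym[OF species_functorial[OF species_iteration_at_0[OF K]] N]) simp_all
    moreover have "iso_at k (comp_sp (K i) (case_sum sort_sp (iteration_at_0 K N))) (comp_sp (K i) (case_sum sort_sp L))"
    proof (rule comp_iso_at[where D = "\<lambda>_. {k'. (\<Sum>z\<in>UNIV. k' z) \<le> (\<Sum>z\<in>UNIV. k z)}"])
      show "iso_at k' (case_sum sort_sp (iteration_at_0 K N) j) (case_sum sort_sp L j)"
        if "k' \<in> {k'. (\<Sum>z\<in>UNIV. k' z) \<le> (\<Sum>z\<in>UNIV. k z)}" for j k'
        using that N[of k' N] by (cases j) simp_all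
      show "shape B \<in> {k'. (\<Sum>z\<in>UNIV. k' z) \<le> (\<Sum>z\<in>UNIV. k z)}"
        if U: "shape U = k" and P: "sorted_partition U P" and B: "B |\<in>| P j"
        for U :: "'z labels" and P :: "'z + 'm \<Rightarrow> 'z labels fset" and j B
        using sorted_partition_sum_shape[OF P B] U by simp
    qed (intro species_case_sum species_iteration_at_0 K sL)+
    ultimately show ?thesis unfolding iteration_at_0.simps by (rule iso_at_trans)
  qed
  obtain N where N: "\<And>n k' i. (\<Sum>z\<in>UNIV. k' z) \<le> 0 \<Longrightarrow> n \<ge> N \<Longrightarrow> iso_at k' (iteration_at_0 K n i) (L i)"
    using has_limit_iso[OF L, where p = "0"] by blast
  have "iso_at (shape no_labels) (iteration_at_0 K N i) (L i)"
    by (rule N) (simp_all add: shape_def no_labels_def fcard.rep_eq)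
  from iso_at_empty[OF this refl] show "str (L i) no_labels = {}"
    by (simp add: iteration_at_0_no_labels[OF K0])
qed

text \<open>For \<open>F = K i\<close> this says that the entry \<open>(i, j)\<close> of the
  Jacobian matrix of the system at 0 is nonzero. Over a finite index type, well-foundedness of this
  relation amounts to nilpotence of that matrix.\<close>

definition linear_in :: "('z + 'm) spec \<Rightarrow> 'm \<Rightarrow> bool" where
  "linear_in F j \<longleftrightarrow> (\<exists>U. shape U = (\<lambda>l. if l = Inr j then 1 else 0) \<and> str F U \<noteq> {})"

lemma linear_inD:
  assumes "linear_in F j" "functorial F" "shape U = (\<lambda>l. if l = Inr j then 1 else 0)"
  shows "str F U \<noteq> {}"
  using assms str_empty_shape[OF assms(2)] unfolding linear_in_def by metis

lemma shape_codes_single: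
  "shape (codes (\<lambda>i. if i = j then {|V|} else {||})) = (\<lambda>l. if l = j then 1 else 0)"
  by (auto simp: shape_codes fun_eq_iff fcard.rep_eq)

text \<open>A linear term turns every \<open>G (Inr j)\<close>-structure on \<open>V\<close> into a
  structure of the composition with the single block \<open>V\<close>. If the cardinalities agree,
  these are all structures, so every assembly has this partition.\<close>

lemma linear_card:
  fixes F :: "('z::finite + 'm::finite) spec" and G :: "'z + 'm \<Rightarrow> 'k::finite spec"
  assumes F: "species F" and G: "\<And>j. species (G j)" and lin: "linear_in F j" and V: "V \<noteq> no_labels"
  shows "card (str (G (Inr j)) V) \<le> card (str (comp_sp F G) V)"
    and "card (str (comp_sp F G) V) \<le> card (str (G (Inr j)) V) \<Longrightarrow> assembly F G V P g f
      \<Longrightarrow> P = (\<lambda>i. if i = Inr j then {|V|} else {||})"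
proof -
  let ?P = "\<lambda>i :: 'z + 'm. if i = Inr j then {|V|} else {||}"
  obtain h where h: "h \<in> str F (codes ?P)"
    using linear_inD[OF lin species_functorial[OF F] shape_codes_single[of "Inr j" V]] by blast
  let ?e = "\<lambda>x. enc ?P (\<lambda>_ _. x) h"
  have inj: "inj_on ?e (str (G (Inr j)) V)" by (auto simp: inj_on_def enc_eq_iff)
  have sub: "?e ` str (G (Inr j)) V \<subseteq> str (comp_sp F G) V"
  proof
    fix s assume "s \<in> ?e ` str (G (Inr j)) V"
    then obtain x where x: "x \<in> str (G (Inr j)) V" "s = ?e x" by blast
    have "assembly F G V ?P (\<lambda>_ _. x) h"
      unfolding assembly_def using x h sorted_partition_single[OF V, of V "Inr j :: 'z + 'm"] by (auto split: if_splits)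
    thus "s \<in> str (comp_sp F G) V" unfolding x(2) by (rule enc_in_comp)
  qed
  have fin: "finite (str (comp_sp F G) V)" by (rule species_finite[OF species_comp[OF F G]])
  show "card (str (G (Inr j)) V) \<le> card (str (comp_sp F G) V)" by (rule card_inj_on_le[OF inj sub fin])
  assume le: "card (str (comp_sp F G) V) \<le> card (str (G (Inr j)) V)" and a: "assembly F G V P g f"
  have "?e ` str (G (Inr j)) V = str (comp_sp F G) V"
    using le card_image[OF inj] by (intro card_seteq[OF fin sub]) simp
  hence "enc P g f \<in> ?e ` str (G (Inr j)) V" using enc_in_comp[OF a] by simp
  thus "P = ?P" by (auto simp: enc_eq_iff)
qed

text \<open>Along an infinite chain of linear terms, the numbers of limit structures on a fixed label set \<open>V\<close>
  decrease, and they take the value belonging to a recurrent index infinitely often. From then on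
  all structures on \<open>V\<close> come from the linear terms, so none of them is ever created by the iteration.\<close>

lemma wf_linear:
  fixes K :: "'m::finite \<Rightarrow> ('z::finite + 'm) spec"
  assumes K: "\<And>i. species (K i)" and K0: "\<And>i. str (K i) no_labels = {}"
    and L: "has_limit (iteration_at_0 K) L" and ne: "\<And>i. \<not> is_zero (L i)"
  shows "wf {(j, i). linear_in (K i) j}"
  unfolding wf_iff_no_infinite_down_chain
proof
  assume "\<exists>c. \<forall>r. (c (Suc r), c r) \<in> {(j, i). linear_in (K i) j}"
  then obtain c where c: "\<And>r. linear_in (K (c r)) (c (Suc r))" by auto
  obtain i where inf: "infinite {r. c r = i}"
    using pigeonhole_infinite[of "UNIV :: nat set" c] by auto
  have sol: "solution_at_0 K L" by (rule limit_is_solution[OF K K0 L])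
  have sL: "species (L i)" for i by (rule has_limit_species[OF L])
  have G: "species (case_sum sort_sp L j)" for j by (rule species_case_sum[OF sL])
  have L0: "str (L i) no_labels = {}" for i using sol by (simp add: solution_at_0_def is_zero_at_zero_iff)
  obtain V where V: "str (L i) V \<noteq> {}" using ne[of i] unfolding is_zero_def by blast
  have V0: "V \<noteq> no_labels" using V L0 by auto
  define l where "l = (\<lambda>r. card (str (L (c r)) V))"
  have comp_card: "card (str (comp_sp (K i) (case_sum sort_sp L)) V) = card (str (L i) V)" for i
    using sol iso_at_card[of "shape V" "L i" "comp_sp (K i) (case_sum sort_sp L)" V]
    by (simp add: solution_at_0_def iso_sp_iff)
  have "l (Suc r) \<le> l r" for r
    using linear_card(1)[where G = "case_sum sort_sp L", OF K G c[of r] V0] comp_card by (simp add: l_def)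
  hence anti: "l r' \<le> l r" if "r \<le> r'" for r r' using that by (rule lift_Suc_antimono_le)
  obtain R where R: "c R = i" using inf by (metis (mono_tags) empty_Collect_eq finite.emptyI)
  have eq: "l r = l R" if "r \<ge> R" for r
  proof -
    obtain r' where r': "r' \<ge> r" "c r' = i" using inf finite_nat_set_iff_bounded_le[of "{r. c r = i}"] by (metis mem_Collect_eq nat_le_linear)
    have "l r' \<le> l r" "l r \<le> l R" using anti r'(1) that by auto
    thus ?thesis using r' R by (simp add: l_def)
  qed
  have empty: "str (iteration_at_0 K n (c r)) V = {}" if "r \<ge> R" for n r
    using that
  proof (induction n arbitrary: r)
    case (Suc n)
    show ?case
    proof (rule ccontr)
      assume "str (iteration_at_0 K (Suc n) (c r)) V \<noteq> {}"
      then obtain P g f where a: "assembly (K (c r)) (case_sum sort_sp (iteration_at_0 K n)) V P g f"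
        by (auto simp: str_comp_iff)
      \<comment> \<open>Iterates embed into \<open>L\<close>, so the partition and the outer
        structure also occur in an assembly over \<open>L\<close>, to which the count
        applies.\<close>
      have "\<exists>x. x \<in> str (case_sum sort_sp L j) B" if "B |\<in>| P j" for j B
      proof -
        have "str (case_sum sort_sp (iteration_at_0 K n) j) B \<noteq> {}" using a that by (auto simp: assembly_def)
        moreover have "emb_at (shape B) (case_sum sort_sp (iteration_at_0 K n) j) (case_sum sort_sp L j)"
          by (rule emb_at_case_sum) (rule has_limit_emb[OF K L])
        ultimately have "str (case_sum sort_sp L j) B \<noteq> {}" using emb_at_empty[OF _ refl] by blast
        thus ?thesis by blast
      qed
      hence "(SOME x. x \<in> str (case_sum sort_sp L j) B) \<in> str (case_sum sort_sp L j) B"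
        if "B |\<in>| P j" for j B using that by (metis someI_ex)
      hence "assembly (K (c r)) (case_sum sort_sp L) V P (\<lambda>j B. SOME x. x \<in> str (case_sum sort_sp L j) B) f"
        using a by (simp add: assembly_def)
      moreover have "card (str (comp_sp (K (c r)) (case_sum sort_sp L)) V) \<le> card (str (L (c (Suc r))) V)"
        using comp_card[of "c r"] eq[of r] eq[of "Suc r"] Suc.prems by (simp add: l_def)
      ultimately have "P = (\<lambda>i. if i = Inr (c (Suc r)) then {|V|} else {||})"
        using linear_card(2)[where G = "case_sum sort_sp L", OF K G c[of r] V0] by simp
      \<comment> \<open>The structure thus comes from one on the same \<open>V\<close>, one
        iteration earlier and one step further along the chain.\<close>
      hence "str (iteration_at_0 K n (c (Suc r))) V \<noteq> {}"
        using a unfolding assembly_def by (metis empty_iff finsertI1 sum.case(2))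
      thus False using Suc.IH[of "Suc r"] Suc.prems by simp
    qed
  qed simp
  obtain N where N: "\<And>n k' i. (\<Sum>z\<in>UNIV. k' z) \<le> (\<Sum>z\<in>UNIV. shape V z) \<Longrightarrow> n \<ge> N \<Longrightarrow> iso_at k' (iteration_at_0 K n i) (L i)"
    using has_limit_iso[OF L, where p = "(\<Sum>z\<in>UNIV. shape V z)"] by blast
  have "str (iteration_at_0 K N i) V = {} \<longleftrightarrow> str (L i) V = {}"
    by (rule iso_at_empty[OF N refl]) simp_all
  thus False using empty[of R N] R V by simp
qed

lemma solution_unique:
  fixes K :: "'m::finite \<Rightarrow> ('z::finite + 'm) spec"
  assumes K: "\<And>i. species (K i)" and wf: "wf {(j, i). linear_in (K i) j}"
    and S: "solution_at_0 K S" and T: "solution_at_0 K T"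
  shows "S i \<cong>\<^sub>s T i"
proof -
  have sS: "species (S i)" and sT: "species (T i)" for i using S T by (simp_all add: solution_at_0_def)
  have "iso_at k (S i) (T i)" if "(\<Sum>z\<in>UNIV. k z) = n" for n k i
    using that
  proof (induction n arbitrary: k i rule: less_induct)
    case (less n)
    note outer = less.IH
    from wf less.prems show ?case
    proof (induction i arbitrary: k rule: wf_induct_rule)
      case (less i)
      have "iso_at k (comp_sp (K i) (case_sum sort_sp S)) (comp_sp (K i) (case_sum sort_sp T))"
      \<comment> \<open>A block of sort \<open>Inr j\<close> is either smaller than
        \<open>U\<close>, and the outer induction applies, or all of \<open>U\<close>; then
        \<open>K i\<close> is linear in \<open>j\<close> and the inner induction applies. In the
        sorts of \<open>Z\<close> both systems of components coincide.\<close>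
      proof (rule comp_iso_at[where D = "case_sum (\<lambda>_. UNIV)
            (\<lambda>j. {k'. (\<Sum>z\<in>UNIV. k' z) < n \<or> (\<Sum>z\<in>UNIV. k' z) = n \<and> linear_in (K i) j})"])
        show "iso_at k' (case_sum sort_sp S j) (case_sum sort_sp T j)"
          if "k' \<in> case_sum (\<lambda>_. UNIV)
            (\<lambda>j. {k'. (\<Sum>z\<in>UNIV. k' z) < n \<or> (\<Sum>z\<in>UNIV. k' z) = n \<and> linear_in (K i) j}) j" for j k'
          using that outer less.IH by (cases j) auto
        show "shape B \<in> case_sum (\<lambda>_. UNIV)
            (\<lambda>j. {k'. (\<Sum>z\<in>UNIV. k' z) < n \<or> (\<Sum>z\<in>UNIV. k' z) = n \<and> linear_in (K i) j}) j"
          if U: "shape U = k" and P: "sorted_partition U P" and f: "f \<in> str (K i) (codes P)" and B: "B |\<in>| P j"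
          for U :: "'z labels" and P :: "'z + 'm \<Rightarrow> 'z labels fset" and f j B
        proof (cases j)
          case (Inr l)
          have le: "(\<Sum>z\<in>UNIV. shape B z) \<le> n"
            using sorted_partition_sum_shape[OF P B] U less.prems by simp
          have "linear_in (K i) l" if "(\<Sum>z\<in>UNIV. shape B z) = n"
          proof -
            have "P = (\<lambda>i. if i = j then {|U|} else {||})"
              using sorted_partition_full_block(2)[OF P B] that U less.prems by simp
            hence "shape (codes P) = (\<lambda>i. if i = Inr l then 1 else 0)"
              using shape_codes_single Inr by simp
            thus ?thesis unfolding linear_in_def using f by blast
          qed
          thus ?thesis using le Inr by auto
        qed simp
      qed (intro species_case_sum K sS sT)+
      moreover have "iso_at k (S i) (comp_sp (K i) (case_sum sort_sp S))"
        using S by (simp add: solution_at_0_def iso_sp_iff)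
      moreover have "iso_at k (comp_sp (K i) (case_sum sort_sp T)) (T i)"
        by (rule iso_at_sym[OF species_functorial[OF sT]]) (use T in \<open>simp add: solution_at_0_def iso_sp_iff\<close>)
      ultimately show ?case by (meson iso_at_trans)
    qed
  qed
  thus ?thesis unfolding iso_sp_iff by blast
qed

section \<open>Polynomiality\<close>

lemma sum_option: "(\<Sum>j\<in>UNIV. k j) = k None + (\<Sum>z\<in>UNIV. k (Some z))" for k :: "'z::finite option \<Rightarrow> nat"
  by (simp add: UNIV_option_conv sum.reindex)

lemma sum_not_None: "(\<Sum>j\<in>UNIV - {None}. k j) = (\<Sum>z\<in>UNIV. k (Some z))" for k :: "'z::finite option \<Rightarrow> nat"
  using sum_option[of k] by (simp add: sum_diff1_nat)

lemma finite_bounded_functions: "finite {k :: 'i::finite \<Rightarrow> nat. \<forall>i. k i \<le> n}"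
proof -
  have "{k :: 'i \<Rightarrow> nat. \<forall>i. k i \<le> n} = Pi\<^sub>E UNIV (\<lambda>_. {..n})" by (auto simp: PiE_def)
  thus ?thesis by (simp add: finite_PiE)
qed

lemma finite_sum_le: "finite {k :: 'i::finite \<Rightarrow> nat. (\<Sum>i\<in>UNIV. k i) \<le> n}"
proof (rule finite_subset[OF _ finite_bounded_functions[of n]], clarify)
  fix k :: "'i \<Rightarrow> nat" and i assume "(\<Sum>i\<in>UNIV. k i) \<le> n"
  moreover have "k i \<le> (\<Sum>i\<in>UNIV. k i)" by (rule member_le_sum) simp_all
  ultimately show "k i \<le> n" by simp
qed

text \<open>Structure sets are finite and inhabitedness depends only on the shape, so finiteness
  over all sizes of sort \<open>x\<close> amounts to a bound on these sizes. The other sorts may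
  have total at most \<open>n\<close> instead of exactly \<open>n\<close>, as there are finitely
  many smaller totals.\<close>

lemma polynomial_in_iff:
  fixes F :: "'i::finite spec"
  assumes F: "species F"
  shows "polynomial_in x F \<longleftrightarrow>
    (\<forall>n. \<exists>A. \<forall>W. str F W \<noteq> {} \<and> (\<Sum>j\<in>UNIV - {x}. shape W j) \<le> n \<longrightarrow> shape W x \<le> A)"
proof -
  define T where "T = (\<lambda>n. {(k :: 'i \<Rightarrow> nat, s). (\<Sum>j\<in>UNIV - {x}. k j) = n \<and> s \<in> str F (std_labels k)})"
  have "polynomial_in x F \<longleftrightarrow> (\<forall>n. finite (T n))"
    unfolding polynomial_in_def T_def std_labels_def ..
  also have "\<dots> \<longleftrightarrow> (\<forall>n. \<exists>A. \<forall>W. str F W \<noteq> {} \<and> (\<Sum>j\<in>UNIV - {x}. shape W j) \<le> n \<longrightarrow> shape W x \<le> A)"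
  proof (intro iffI allI)
    fix n assume fin: "\<forall>n. finite (T n)"
    hence "finite ((\<lambda>(k, s). k x) ` (\<Union>m\<le>n. T m))" by simp
    then obtain A where A: "\<And>a. a \<in> (\<lambda>(k, s). k x) ` (\<Union>m\<le>n. T m) \<Longrightarrow> a \<le> A"
      unfolding finite_nat_set_iff_bounded_le by blast
    have "shape W x \<le> A" if ne: "str F W \<noteq> {}" and le: "(\<Sum>j\<in>UNIV - {x}. shape W j) \<le> n" for W
    proof -
      have "str F (std_labels (shape W)) \<noteq> {}"
        using str_empty_shape[OF species_functorial[OF F], of "std_labels (shape W)" W] ne by auto
      then obtain s where "(shape W, s) \<in> T (\<Sum>j\<in>UNIV - {x}. shape W j)" by (auto simp: T_def)
      hence "(shape W, s) \<in> (\<Union>m\<le>n. T m)" using le by blast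
      thus ?thesis by (intro A) force
    qed
    thus "\<exists>A. \<forall>W. str F W \<noteq> {} \<and> (\<Sum>j\<in>UNIV - {x}. shape W j) \<le> n \<longrightarrow> shape W x \<le> A" by blast
  next
    fix n
    assume "\<forall>n. \<exists>A. \<forall>W. str F W \<noteq> {} \<and> (\<Sum>j\<in>UNIV - {x}. shape W j) \<le> n \<longrightarrow> shape W x \<le> A"
    then obtain A where A: "\<And>W. str F W \<noteq> {} \<Longrightarrow> (\<Sum>j\<in>UNIV - {x}. shape W j) \<le> n \<Longrightarrow> shape W x \<le> A"
      by blast
    have "T n \<subseteq> Sigma {k. \<forall>i. k i \<le> n + A} (\<lambda>k. str F (std_labels k))"
    proof clarify
      fix k s assume "(k, s) \<in> T n"
      hence ks: "(\<Sum>j\<in>UNIV - {x}. k j) = n" "s \<in> str F (std_labels k)" by (auto simp: T_def)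
      have "k x \<le> A" using A[of "std_labels k"] ks by auto
      moreover have "k i \<le> n" if "i \<noteq> x" for i
        unfolding ks(1)[symmetric] using that by (intro member_le_sum) auto
      ultimately have "k i \<le> n + A" for i by (cases "i = x") (auto intro: trans_le_add1 trans_le_add2)
      thus "k \<in> {k. \<forall>i. k i \<le> n + A} \<and> s \<in> str F (std_labels k)" using ks by simp
    qed
    moreover have "finite \<dots>"
      by (intro finite_SigmaI finite_bounded_functions species_finite[OF F])
    ultimately show "finite (T n)" by (rule finite_subset)
  qed
  finally show ?thesis .
qed

lemma polynomial_in_None_iff:
  assumes F: "species F"
  shows "polynomial_in None F \<longleftrightarrow>
    (\<forall>n. \<exists>A. \<forall>W. str F W \<noteq> {} \<and> (\<Sum>z\<in>UNIV. shape (W \<circ> Some) z) \<le> n \<longrightarrow> fcard (W None) \<le> A)"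
  unfolding polynomial_in_iff[OF F] sum_not_None by (simp add: shape_def)

text \<open>Every class over \<open>U\<close> has a representative on standard labels, with at most
  \<open>A\<close> of them in the new sort.\<close>

lemma quot_finite:
  assumes F: "species F" and q: "quot F Q q"
    and A: "\<And>W. W \<circ> Some = U \<Longrightarrow> str F W \<noteq> {} \<Longrightarrow> fcard (W None) \<le> A"
  shows "finite (str Q U)"
proof (rule finite_subset)
  show "str Q U \<subseteq> (\<Union>a\<le>A. q (std_ext a U) ` str F (std_ext a U))"
  proof
    fix c assume "c \<in> str Q U"
    then obtain W s where W: "W \<circ> Some = U" "s \<in> str F W" "q W s = c" using quot_surj[OF q] by blast
    note f = species_functorial[OF F]
    obtain t where t: "same_orbit F W s (std_ext (fcard (W None)) U) t"
      using ex_same_orbit_std[OF f W(2)] W(1) by metis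
    have t': "t \<in> str F (std_ext (fcard (W None)) U)" by (rule same_orbit_in[OF f t W(2)])
    have "q (std_ext (fcard (W None)) U) t = c"
      using quot_eq_iff[OF q W(2) t'] t W by simp
    moreover have "fcard (W None) \<le> A" using A W by blast
    ultimately show "c \<in> (\<Union>a\<le>A. q (std_ext a U) ` str F (std_ext a U))" using t' by blast
  qed
qed (simp add: species_finite[OF F])

text \<open>An orbit determines its number of labels of sort \<open>None\<close>. One structure for
  each inhabited number therefore gives distinct classes, and finitely many classes leave finitely
  many numbers.\<close>

lemma quot_finite_bound:
  assumes F: "functorial F" and q: "quot F Q q" and fin: "finite (str Q U)"
  shows "\<exists>A. \<forall>W. shape (W \<circ> Some) = shape U \<and> str F W \<noteq> {} \<longrightarrow> fcard (W None) \<le> A"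
proof -
  define D where "D = {a. str F (std_ext a U) \<noteq> {}}"
  define s where "s = (\<lambda>a. SOME s. s \<in> str F (std_ext a U))"
  have s: "s a \<in> str F (std_ext a U)" if "a \<in> D" for a
    using that by (simp add: D_def s_def some_in_eq)
  have "inj_on (\<lambda>a. q (std_ext a U) (s a)) D"
  proof (rule inj_onI)
    fix a b assume ab: "a \<in> D" "b \<in> D" "q (std_ext a U) (s a) = q (std_ext b U) (s b)"
    hence "same_orbit F (std_ext a U) (s a) (std_ext b U) (s b)"
      using quot_eq_iff[OF q s[OF ab(1)] s[OF ab(2)]] by simp
    from same_orbit_fcard[OF this] show "a = b" by simp
  qed
  moreover have "(\<lambda>a. q (std_ext a U) (s a)) ` D \<subseteq> str Q U" using quot_in[OF q s] by auto
  ultimately have "finite D" using fin by (rule inj_on_finite)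
  then obtain A where A: "\<And>a. a \<in> D \<Longrightarrow> a \<le> A" unfolding finite_nat_set_iff_bounded_le by blast
  have "fcard (W None) \<le> A" if W: "shape (W \<circ> Some) = shape U" "str F W \<noteq> {}" for W
  proof -
    have "shape W = shape (std_ext (fcard (W None)) U)"
    proof
      fix i show "shape W i = shape (std_ext (fcard (W None)) U) i"
        using W(1) by (cases i) (auto simp: shape_def fun_eq_iff)
    qed
    hence "fcard (W None) \<in> D" unfolding D_def using str_empty_shape[OF F, of "std_ext (fcard (W None)) U" W] W(2) by auto
    thus ?thesis by (rule A)
  qed
  thus ?thesis by blast
qed

lemma species_at_one:
  fixes F :: "'a::finite option spec"
  assumes F: "species F" and p: "polynomial_in None F"
  shows "species (at_one F)"
  unfolding species_iff
proof (intro conjI allI)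
  show "functorial (at_one F)" by (rule functorial_at_one[OF species_functorial[OF F]])
  fix U :: "'a labels"
  obtain A where "\<And>W. str F W \<noteq> {} \<Longrightarrow> (\<Sum>z\<in>UNIV. shape (W \<circ> Some) z) \<le> (\<Sum>z\<in>UNIV. shape U z) \<Longrightarrow> fcard (W None) \<le> A"
    using p unfolding polynomial_in_None_iff[OF F] by blast
  thus "finite (str (at_one F) U)"
    by (intro quot_finite[OF F quot_at_one[OF species_functorial[OF F]], of _ A]) auto
qed

lemma polynomial_in_iso:
  assumes F: "species F" and G: "species G" and iso: "\<And>k. iso_at k F G" and p: "polynomial_in x F"
  shows "polynomial_in x G"
  using p unfolding polynomial_in_iff[OF F] polynomial_in_iff[OF G] using iso_at_empty[OF iso refl] by simp

section \<open>Inhabited compositions\<close>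

text \<open>Every label of sort \<open>l\<close> in \<open>V\<close> is blown up to a disjoint copy
  of \<open>B l\<close>. The numbers of labels obtained are exact, so that a bound for the
  composition can be turned into a bound on \<open>V\<close>.\<close>

lemma comp_inhabited:
  fixes F :: "'i::finite spec" and G :: "'i \<Rightarrow> 'k::finite spec"
  assumes F: "functorial F" and G: "\<And>l. functorial (G l)" and V: "str F V \<noteq> {}"
    and B: "\<And>l. V l \<noteq> {||} \<Longrightarrow> str (G l) (B l) \<noteq> {} \<and> B l \<noteq> no_labels"
  obtains W where "str (comp_sp F G) W \<noteq> {}" "\<And>k. shape W k = (\<Sum>l\<in>UNIV. fcard (V l) * shape (B l) k)"
proof -
  obtain e :: "'i \<Rightarrow> nat" where e: "inj e"
    using finite_imp_inj_to_nat_seg[of "UNIV :: 'i set"] by auto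
  \<comment> \<open>An injective code of a sort \<open>l\<close>, a label \<open>x\<close> of
    \<open>V\<close> and a label \<open>u\<close> of the block put in place of
    \<open>x\<close>.\<close>
  define c where "c = (\<lambda>l x u. to_nat (e l, x :: nat, u :: nat))"
  have c: "c l x u = c l' x' u' \<longleftrightarrow> l = l' \<and> x = x' \<and> u = u'" for l x u l' x' u'
    using e by (auto simp: c_def dest: injD)
  define b where "b = (\<lambda>l x. relabel (\<lambda>_. c l x) (B l))"
  define P where "P = (\<lambda>l. b l |`| V l)"
  define S where "S = (\<lambda>k. SIGMA l:UNIV. fset (V l) \<times> fset (B l k))"
  define W :: "'k labels" where "W = (\<lambda>k. Abs_fset ((\<lambda>(l, x, u). c l x u) ` S k))"
  have W: "fset (W k) = (\<lambda>(l, x, u). c l x u) ` S k" for k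
    unfolding W_def S_def by (simp add: Abs_fset_inverse)
  have mem: "v |\<in>| b l x k \<longleftrightarrow> (\<exists>u. u |\<in>| B l k \<and> v = c l x u)" for v l x k
    by (auto simp: b_def)
  have card: "shape W k = (\<Sum>l\<in>UNIV. fcard (V l) * shape (B l) k)" for k
  proof -
    have "inj_on (\<lambda>(l, x, u). c l x u) (S k)" by (auto simp: inj_on_def c)
    hence "shape W k = card (S k)" by (simp add: shape_def fcard.rep_eq W card_image)
    also have "\<dots> = (\<Sum>l\<in>UNIV. fcard (V l) * shape (B l) k)"
      unfolding S_def by (simp add: card_cartesian_product shape_def fcard.rep_eq)
    finally show ?thesis .
  qed
  have P: "sorted_partition W P"
  proof (rule sorted_partitionI)
    fix l C assume "C |\<in>| P l"
    then obtain x where x: "x |\<in>| V l" "C = b l x" by (auto simp: P_def)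
    show "C \<noteq> no_labels" unfolding x(2) b_def using B[of l] x(1) by auto
    show "fset (C k) \<subseteq> fset (W k)" for k
      unfolding x(2) W S_def using x(1) by (force simp: mem image_iff)
    show "l = l' \<and> C = C'" if C': "C' |\<in>| P l'" "v |\<in>| C k" "v |\<in>| C' k" for l' C' v k
    proof -
      obtain x' where x': "C' = b l' x'" using C'(1) by (auto simp: P_def)
      show ?thesis using C'(2,3) unfolding x(2) x' mem by (auto simp: c)
    qed
  next
    fix k v assume "v |\<in>| W k"
    hence "v \<in> (\<lambda>(l, x, u). c l x u) ` S k" using W by simp
    then obtain l x u where "x |\<in>| V l" "u |\<in>| B l k" "v = c l x u" by (auto simp: S_def)
    thus "\<exists>l C. C |\<in>| P l \<and> v |\<in>| C k"
      by (intro exI[of _ l] exI[of _ "b l x"]) (auto simp: P_def mem)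
  qed
  have "\<exists>g. g \<in> str (G l) C" if C: "C |\<in>| P l" for l C
  proof -
    obtain x where x: "x |\<in>| V l" "C = b l x" using C by (auto simp: P_def)
    obtain g where g: "g \<in> str (G l) (B l)" using B[of l] x(1) by auto
    have "bij_tuple (B l) (\<lambda>_. c l x)" by (auto simp: bij_tuple_def inj_on_def c)
    from transport_in[OF G this g] show ?thesis unfolding x(2) b_def by blast
  qed
  hence g: "(SOME g. g \<in> str (G l) C) \<in> str (G l) C" if "C |\<in>| P l" for l C
    using that by (metis someI_ex)
  have "shape (codes P) = shape V"
  proof
    fix l
    have "inj_on (b l) (fset (V l))"
    proof (rule inj_onI)
      fix x y assume xy: "x \<in> fset (V l)" "y \<in> fset (V l)" "b l x = b l y"
      obtain k u where "u |\<in>| B l k" using B[of l] xy(1) unfolding no_labels_iff by auto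
      hence "c l x u |\<in>| b l x k" by (auto simp: mem)
      hence "c l x u |\<in>| b l y k" using xy(3) by simp
      thus "x = y" by (auto simp: mem c)
    qed
    thus "shape (codes P) l = shape V l"
      unfolding shape_codes by (simp add: P_def shape_def fcard.rep_eq card_image)
  qed
  then obtain f where "f \<in> str F (codes P)" using str_empty_shape[OF F] V by (metis all_not_in_conv)
  hence "assembly F G W P (\<lambda>l C. SOME g. g \<in> str (G l) C) f" using P g by (simp add: assembly_def)
  from enc_in_comp[OF this] show thesis using that[OF _ card] by blast
qed

section \<open>The companion system and the iteration\<close>

lemma species_companion: "species (H i) \<Longrightarrow> species (companion H i)"
  unfolding companion_def by (rule species_mark_zero)

lemma companion_no_labels: "str (companion H i) no_labels = {}"
  unfolding companion_def by (rule mark_zero_no_labels)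

text \<open>Functoriality of \<open>iteration H n\<close> is inherited from the quotient at each
  step, so the relation holds even while the structure sets of the iteration may be
  infinite.\<close>

lemma quot_iteration:
  assumes H: "\<And>i. species (H i)"
  shows "\<exists>q. quot (iteration_at_0 (companion H) n i) (iteration H n i) q"
proof (induction n arbitrary: i)
  case 0
  show ?case using quot_zero by auto
next
  case (Suc n)
  have X: "functorial (iteration_at_0 (companion H) n i)" for i
    by (intro species_functorial species_iteration_at_0 species_companion H)
  obtain q where q: "\<And>i. quot (iteration_at_0 (companion H) n i) (iteration H n i) (q i)"
    using Suc.IH by metis
  have Z: "functorial (iteration H n i)" for i using quot_functorial[OF X q] .
  show ?case unfolding iteration_at_0.simps iteration.simps companion_def[of H, THEN fun_cong, of i]
    by (rule quot_iteration_step[OF species_functorial[OF H] X Z q])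
      (rule iteration_at_0_no_labels[OF companion_no_labels])
qed

text \<open>For at most \<open>r\<close> old labels, polynomiality bounds the new labels of
  \<open>L\<close>-structures by some \<open>M\<close>. Up to \<open>M\<close> new labels, contact
  of order \<open>M + r\<close> applies; beyond, \<open>L\<close> is empty, and so are the iterates,
  which embed into it.\<close>

lemma has_limit_at_one:
  fixes H :: "'m::finite \<Rightarrow> ('z::finite + 'm) spec"
  assumes H: "\<And>i. species (H i)" and L: "has_limit (iteration_at_0 (companion H)) L"
    and p: "\<And>i. polynomial_in None (L i)" and S: "\<And>i. species (S i)" and iso: "\<And>i. L i \<cong>\<^sub>s S i"
  shows "has_limit (iteration H) (\<lambda>i. at_one (S i))"
  unfolding has_limit_def contact_iff
proof (intro conjI allI)
  let ?X = "iteration_at_0 (companion H)"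
  have K: "species (companion H i)" for i by (rule species_companion[OF H])
  have sL: "species (L i)" for i by (rule has_limit_species[OF L])
  have iso: "iso_at k (L i) (S i)" for k i using iso by (simp add: iso_sp_iff)
  show "species (at_one (S i))" for i
    by (rule species_at_one[OF S polynomial_in_iso[OF sL S iso p]])
  fix r
  have "\<exists>A. \<forall>W. str (L i) W \<noteq> {} \<and> (\<Sum>z\<in>UNIV. shape (W \<circ> Some) z) \<le> r \<longrightarrow> fcard (W None) \<le> A" for i
    using p unfolding polynomial_in_None_iff[OF sL] by blast
  then obtain A where A: "\<And>i W. str (L i) W \<noteq> {} \<Longrightarrow> (\<Sum>z\<in>UNIV. shape (W \<circ> Some) z) \<le> r \<Longrightarrow> fcard (W None) \<le> A i"
    by metis
  define M where "M = Max (range A)"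
  have M: "A i \<le> M" for i unfolding M_def by simp
  obtain N where N: "\<And>n k i. (\<Sum>z\<in>UNIV. k z) \<le> M + r \<Longrightarrow> n \<ge> N \<Longrightarrow> iso_at k (?X n i) (L i)"
    using has_limit_iso[OF L, where p = "M + r"] by blast
  have "iso_at z (iteration H n i) (at_one (S i))" if n: "n \<ge> N" and z: "(\<Sum>i\<in>UNIV. z i) \<le> r" for n i z
  proof -
    obtain q where q: "quot (?X n i) (iteration H n i) q" using quot_iteration[of H n i] H by blast
    have X: "functorial (?X n i)" by (intro species_functorial species_iteration_at_0 K)
    show ?thesis
    proof (rule quot_iso_at[OF X species_functorial[OF S] q quot_at_one[OF species_functorial[OF S]]])
      fix a
      have "iso_at (case_option a z) (?X n i) (L i)"
      proof (cases "a \<le> M")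
        case True
        thus ?thesis using z n by (intro N) (simp_all add: sum_option)
      next
        case False
        have e: "str (L i) W = {}" if W: "shape W = case_option a z" for W
        proof (rule ccontr)
          assume "str (L i) W \<noteq> {}"
          moreover have "shape (W \<circ> Some) = z" "fcard (W None) = a"
            using fun_cong[OF W, of "Some _"] fun_cong[OF W, of None] by (auto simp: shape_def)
          ultimately show False using A[of i W] z M[of i] False by simp
        qed
        show ?thesis
        proof (rule emb_at_card_iso[OF has_limit_emb[OF K L]])
          show "finite (str (L i) W) \<and> card (str (L i) W) \<le> card (str (?X n i) W)"
            if "shape W = case_option a z" for W using e[OF that] by simp
        qed
      qed
      thus "iso_at (case_option a z) (?X n i) (S i)" using iso by (rule iso_at_trans)
    qed
  qed
  thus "\<exists>N. \<forall>n\<ge>N. \<forall>i k. (\<Sum>i\<in>UNIV. k i) \<le> r \<longrightarrow> iso_at k (iteration H n i) (at_one (S i))" by blast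
qed

lemma companion_inhabited:
  assumes "str (H i) V \<noteq> {}" "V \<noteq> no_labels"
  shows "str (companion H i) (extend_sorts {||} V) \<noteq> {}"
proof -
  obtain y where "y \<in> str (H i) V" using assms by blast
  hence "unmarked y \<in> str (companion H i) (extend_sorts {||} V)"
    unfolding companion_def str_mark_zero using assms(2) by (simp add: not_range_iff)
  thus ?thesis by blast
qed

text \<open>If \<open>L\<^sub>i\<close> has a structure using only labels of the new sort, plugging copies of it into the sort
  \<open>Y\<^sub>i\<close> of an \<open>H\<^sub>j\<close>-structure costs nothing in the other sorts.\<close>

lemma polynomial_in_system:
  fixes H :: "'m::finite \<Rightarrow> ('z::finite + 'm) spec"
  assumes H: "\<And>i. species (H i)" and sol: "solution_at_0 (companion H) L" and ne: "\<And>i. \<not> is_zero (L i)"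
    and p: "\<And>i. polynomial_in None (L i)"
    and W0: "str (L i) W0 \<noteq> {}" "W0 \<circ> Some = no_labels"
  shows "polynomial_in (Inr i) (H j)"
  unfolding polynomial_in_iff[OF H]
proof
  fix n
  have sL: "species (L i)" and L0: "str (L i) no_labels = {}" for i
    using sol by (simp_all add: solution_at_0_def is_zero_at_zero_iff)
  have K: "species (companion H i)" for i by (rule species_companion[OF H])
  have "\<exists>W. str (L l) W \<noteq> {}" for l using ne unfolding is_zero_def by blast
  then obtain B0 where B0: "\<And>l. str (L l) (B0 l) \<noteq> {}" by metis
  \<comment> \<open>For every sort, labels that carry a structure: a single label for the new sort
    and those of \<open>Z\<close>, \<open>W0\<close> for the sort \<open>Inr i\<close>, and an
    arbitrary inhabited tuple for the other components.\<close>
  define B :: "'z option + 'm \<Rightarrow> 'z option labels" where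
    "B = case_sum (\<lambda>x y. if y = x then {|0|} else {||}) (B0(i := W0))"
  have BL: "str (L l) (B (Inr l)) \<noteq> {}" for l using B0 W0 by (simp add: B_def)
  have BG: "str (case_sum sort_sp L l) (B l) \<noteq> {}" for l
  proof (cases l)
    case (Inl x)
    have "0 \<in> str (sort_sp x) (B (Inl x))" by (auto simp: sort_sp_simps B_def fcard.rep_eq)
    thus ?thesis using Inl by auto
  qed (simp add: BL)
  have Bne: "B l \<noteq> no_labels" for l
  proof (cases l)
    case (Inl x)
    show ?thesis unfolding no_labels_iff Inl by (auto simp: B_def intro!: exI[of _ x])
  next
    case (Inr m)
    thus ?thesis using BL[of m] L0 by auto
  qed
  \<comment> \<open>The largest number of old labels spent on one inserted structure. For sort
    \<open>Inr i\<close> this number is 0, so \<open>n\<close> labels of the other sorts cost at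
    most \<open>n * C\<close>.\<close>
  define C where "C = Max (range (\<lambda>l. \<Sum>z\<in>UNIV. shape (B l) (Some z)))"
  have C: "(\<Sum>z\<in>UNIV. shape (B l) (Some z)) \<le> C" for l unfolding C_def by simp
  obtain A where A: "\<And>W. str (L j) W \<noteq> {} \<Longrightarrow> (\<Sum>z\<in>UNIV. shape (W \<circ> Some) z) \<le> n * C \<Longrightarrow> fcard (W None) \<le> A"
    using p[of j] unfolding polynomial_in_None_iff[OF sL] by blast
  have "shape V (Inr i) \<le> A" if V: "str (H j) V \<noteq> {}" and le: "(\<Sum>l\<in>UNIV - {Inr i}. shape V l) \<le> n" for V
  proof (cases "V = no_labels")
    case True
    thus ?thesis by (simp add: shape_def no_labels_def fcard.rep_eq)
  next
    case False
    let ?V = "extend_sorts {||} V"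
    obtain W where W: "str (comp_sp (companion H j) (case_sum sort_sp L)) W \<noteq> {}"
      "\<And>k. shape W k = (\<Sum>l\<in>UNIV. fcard (?V l) * shape (B l) k)"
    proof (rule comp_inhabited[of "companion H j" "case_sum sort_sp L" ?V B])
      show "functorial (case_sum sort_sp L l)" for l
        by (rule species_functorial[OF species_case_sum[OF sL]])
    qed (use companion_inhabited[of H j V, OF V False] BG Bne species_functorial[OF K] in auto)
    have "iso_at (shape W) (L j) (comp_sp (companion H j) (case_sum sort_sp L))"
      using sol by (simp add: solution_at_0_def iso_sp_iff)
    hence LW: "str (L j) W \<noteq> {}" using iso_at_empty W(1) by blast
    have B_i: "shape (B (Inr i)) (Some z) = 0" for z
      using fun_cong[OF W0(2), of z] by (simp add: B_def shape_def no_labels_def fcard.rep_eq)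
    have sumV: "(\<Sum>l\<in>UNIV - {Inr i}. fcard (?V l)) \<le> n"
    proof -
      have "(\<Sum>l\<in>UNIV - {Inr i}. fcard (?V l)) = (\<Sum>l\<in>map_sum Some id ` (UNIV - {Inr i}). fcard (?V l))"
      proof (rule sum.mono_neutral_right)
        show "\<forall>l\<in>UNIV - {Inr i} - map_sum Some id ` (UNIV - {Inr i}). fcard (?V l) = 0"
        proof
          fix l assume l: "l \<in> UNIV - {Inr i} - map_sum Some id ` (UNIV - {Inr i :: 'z + 'm})"
          show "fcard (?V l) = 0"
          proof (cases l rule: sort_cases)
            case new
            thus ?thesis by (simp add: fcard.rep_eq)
          next
            case (old l')
            hence "l' = Inr i" using l by blast
            thus ?thesis using l old by simp
          qed
        qed
        show "map_sum Some id ` (UNIV - {Inr i}) \<subseteq> UNIV - {Inr i :: 'z option + 'm}"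
        proof
          fix l assume "l \<in> map_sum Some id ` (UNIV - {Inr i :: 'z + 'm})"
          then obtain l' where "l = map_sum Some id l'" "l' \<noteq> Inr i" by blast
          thus "l \<in> UNIV - {Inr i}" by (cases l') auto
        qed
      qed simp
      also have "\<dots> = (\<Sum>l\<in>UNIV - {Inr i}. fcard (?V (map_sum Some id l)))"
      proof (rule sum.reindex[unfolded comp_def])
        show "inj_on (map_sum Some id) (UNIV - {Inr i :: 'z + 'm})"
          by (rule inj_on_subset[of _ UNIV]) (simp_all add: sum.inj_map)
      qed
      also have "\<dots> \<le> n" using le by (simp add: shape_def)
      finally show ?thesis .
    qed
    have "(\<Sum>z\<in>UNIV. shape (W \<circ> Some) z) = (\<Sum>z\<in>UNIV. shape W (Some z))" by (simp add: shape_def)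
    also have "\<dots> = (\<Sum>l\<in>UNIV. fcard (?V l) * (\<Sum>z\<in>UNIV. shape (B l) (Some z)))"
      unfolding W(2) by (subst sum.swap) (simp add: sum_distrib_left)
    also have "\<dots> = (\<Sum>l\<in>UNIV - {Inr i}. fcard (?V l) * (\<Sum>z\<in>UNIV. shape (B l) (Some z)))"
      by (rule sum.mono_neutral_right) (auto simp: B_i)
    also have "\<dots> \<le> (\<Sum>l\<in>UNIV - {Inr i}. fcard (?V l) * C)"
      by (intro sum_mono mult_le_mono2 C)
    also have "\<dots> \<le> n * C" using sumV by (simp add: sum_distrib_right[symmetric])
    finally have "fcard (W None) \<le> A" by (rule A[OF LW])
    \<comment> \<open>Each inserted copy of \<open>W0\<close> uses at least one new label, so the
      bound on new labels bounds the labels of sort \<open>Inr i\<close>.\<close>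
    moreover have "shape (B (Inr i)) None \<noteq> 0"
    proof
      assume "shape (B (Inr i)) None = 0"
      hence "shape (B (Inr i)) k = 0" for k using B_i by (cases k) auto
      hence "shape (B (Inr i)) = (\<lambda>_. 0)" by blast
      thus False using Bne shape_zero_iff by blast
    qed
    hence "fcard (?V (Inr i)) \<le> fcard (?V (Inr i)) * shape (B (Inr i)) None" by simp
    hence "fcard (?V (Inr i)) \<le> shape W None"
      unfolding W(2) by (rule order.trans) (rule member_le_sum, simp_all)
    ultimately show ?thesis by (simp add: shape_def)
  qed
  thus "\<exists>A. \<forall>W. str (H j) W \<noteq> {} \<and> (\<Sum>l\<in>UNIV - {Inr i}. shape W l) \<le> n \<longrightarrow> shape W (Inr i) \<le> A" by blast
qed

text \<open>A species may be prescribed independently in each shape, since transport preserves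
  shapes. The limit is assembled in this way from a suitable iterate for each shape.\<close>

definition shapewise :: "(('i \<Rightarrow> nat) \<Rightarrow> 'i spec) \<Rightarrow> 'i spec" where
  "shapewise F = \<lparr>str = \<lambda>U. str (F (shape U)) U, transport = \<lambda>U. transport (F (shape U)) U\<rparr>"

lemma species_shapewise:
  assumes F: "\<And>k. species (F k)"
  shows "species (shapewise F)"
  unfolding species_iff
proof (intro conjI allI functorialI)
  note f = species_functorial[OF F]
  show "finite (str (shapewise F) U)" for U by (simp add: shapewise_def species_finite[OF F])
  fix U \<sigma> s assume \<sigma>: "bij_tuple U \<sigma>" and s: "s \<in> str (shapewise F) U"
  show "transport (shapewise F) U \<sigma> s \<in> str (shapewise F) (relabel \<sigma> U)"
    using transport_in[OF f \<sigma>] s \<sigma> by (simp add: shapewise_def)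
  show "transport (shapewise F) U \<sigma> s = transport (shapewise F) U \<tau> s"
    if "\<And>i x. x \<in> fset (U i) \<Longrightarrow> \<sigma> i x = \<tau> i x" for \<tau>
    using transport_cong[OF f \<sigma>, of s "shape U" \<tau>] s that by (simp add: shapewise_def)
  show "transport (shapewise F) U (\<lambda>i. \<tau> i \<circ> \<sigma> i) s =
      transport (shapewise F) (relabel \<sigma> U) \<tau> (transport (shapewise F) U \<sigma> s)"
    if "bij_tuple (relabel \<sigma> U) \<tau>" for \<tau>
    using transport_comp[OF f \<sigma> that, of s "shape U"] s \<sigma> by (simp add: shapewise_def)
next
  fix U s assume "s \<in> str (shapewise F) U"
  thus "transport (shapewise F) U (\<lambda>_. id) s = s"
    using transport_id[OF species_functorial[OF F]] by (simp add: shapewise_def)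
qed

lemma iso_at_shapewise: "iso_at k (F k) (shapewise F)"
  by (rule iso_atI[of _ _ _ "\<lambda>_ s. s"]) (auto simp: shapewise_def intro!: natural_atI)

text \<open>The numbers of orbits of the structures of the companion iteration stabilise. Since that iteration
  is increasing, so do the structures themselves, for all numbers of labels of the new sort at once.\<close>

lemma companion_limit:
  fixes H :: "'m::finite \<Rightarrow> ('z::finite + 'm) spec"
  assumes H: "\<And>i. species (H i)" and Y: "\<And>n i. species (iteration H n i)"
    and LH: "has_limit (iteration H) L'" and ne: "\<And>i. \<not> is_zero (L' i)"
  obtains L where "has_limit (iteration_at_0 (companion H)) L" "\<And>i. polynomial_in None (L i)"
    "\<And>i. \<not> is_zero (L i)"
proof -
  let ?X = "iteration_at_0 (companion H)"
  have K: "species (companion H i)" for i by (rule species_companion[OF H])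
  have X: "species (?X n i)" for n i by (rule species_iteration_at_0[OF K])
  obtain N where N: "\<And>p n k i. (\<Sum>z\<in>UNIV. k z) \<le> p \<Longrightarrow> n \<ge> N p \<Longrightarrow> iso_at k (iteration H n i) (L' i)"
    using has_limit_iso[OF LH] by metis
  \<comment> \<open>In the old shape \<open>z\<close> both iterates of \<open>H\<close> agree with
    \<open>L'\<close>, hence have equally many structures; the embedding of the companion iterates
    is then an isomorphism for every \<open>a\<close>.\<close>
  have one_step: "iso_at (case_option a z) (?X n i) (?X (Suc n) i)"
    if z: "(\<Sum>i\<in>UNIV. z i) \<le> p" and n: "n \<ge> N p" for a z p n i
  proof -
    obtain q where q: "quot (?X n i) (iteration H n i) q" using quot_iteration[of H n i] H by blast
    obtain q' where q': "quot (?X (Suc n) i) (iteration H (Suc n) i) q'"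
      using quot_iteration[of H "Suc n" i] H by blast
    show ?thesis
    proof (rule quot_emb_iso_at[OF species_functorial[OF X] species_functorial[OF X] q q'])
      show "emb_at (case_option b z) (?X n i) (?X (Suc n) i)" for b by (rule iteration_at_0_emb_Suc[OF K])
      fix U :: "'z labels" assume U: "shape U = z"
      have "card (str (iteration H (Suc n) i) U) = card (str (L' i) U)"
        using N[OF z, of "Suc n"] n U by (intro iso_at_card) auto
      also have "\<dots> = card (str (iteration H n i) U)"
        using N[OF z n] U by (intro iso_at_card[symmetric]) auto
      finally show "finite (str (iteration H (Suc n) i) U) \<and>
          card (str (iteration H (Suc n) i) U) \<le> card (str (iteration H n i) U)"
        using species_finite[OF Y[of "Suc n" i]] by simp
    qed
  qed
  have stable: "iso_at (case_option a z) (?X (N p) i) (?X n i)"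
    if z: "(\<Sum>i\<in>UNIV. z i) \<le> p" and n: "n \<ge> N p" for a z p n i
    using n
  proof (induction n rule: dec_induct)
    case base show ?case by simp
  next
    case (step m)
    show ?case by (rule iso_at_trans[OF step.IH one_step[OF z step.hyps(1)]])
  qed
  \<comment> \<open>Only old labels are counted, so the stage chosen for a shape \<open>k\<close>
    does not depend on \<open>k None\<close>; this makes the limit polynomial in the new
    sort.\<close>
  define d :: "('z option \<Rightarrow> nat) \<Rightarrow> nat" where "d = (\<lambda>k. \<Sum>z\<in>UNIV. k (Some z))"
  have opt: "k = case_option (k None) (\<lambda>z. k (Some z))" for k :: "'z option \<Rightarrow> nat"
    by (auto simp: fun_eq_iff split: option.split)
  define L where "L = (\<lambda>i. shapewise (\<lambda>k. ?X (N (d k)) i))"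
  have sL: "species (L i)" for i unfolding L_def by (rule species_shapewise[OF X])
  have iso: "iso_at k (?X n i) (L i)" if "n \<ge> N (d k)" for n k i
  proof -
    have "iso_at k (?X (N (d k)) i) (?X n i)"
      using stable[of "\<lambda>z. k (Some z)" "d k" n "k None" i] that opt[of k] by (simp add: d_def)
    from iso_at_trans[OF iso_at_sym[OF species_functorial[OF X] this] iso_at_shapewise[of k "\<lambda>k. ?X (N (d k)) i"]]
    show ?thesis by (simp add: L_def)
  qed
  have lim: "has_limit ?X L"
    unfolding has_limit_def contact_iff
  proof (intro conjI allI)
    fix p
    \<comment> \<open>\<open>N\<close> need not be monotone, hence the maximum over all orders up to
      \<open>p\<close>.\<close>
    have "iso_at k (?X n i) (L i)" if k: "(\<Sum>z\<in>UNIV. k z) \<le> p" and n: "n \<ge> Max (N ` {..p})" for n k i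
    proof (rule iso)
      have "d k \<le> p" using k by (simp add: sum_option d_def)
      hence "N (d k) \<le> Max (N ` {..p})" by (intro Max_ge) auto
      thus "n \<ge> N (d k)" using n by (rule order.trans)
    qed
    thus "\<exists>M. \<forall>n\<ge>M. \<forall>i k. (\<Sum>z\<in>UNIV. k z) \<le> p \<longrightarrow> iso_at k (?X n i) (L i)" by blast
  qed (rule sL)
  have "\<not> is_zero (L i)" for i
  proof
    assume zero: "is_zero (L i)"
    obtain U where U: "str (L' i) U \<noteq> {}" using ne[of i] unfolding is_zero_def by blast
    define p where "p = (\<Sum>z\<in>UNIV. shape U z)"
    have "str (iteration H (N p) i) U \<noteq> {}"
      using iso_at_empty[OF N[of "shape U" p "N p" i] refl] U by (simp add: p_def)
    then obtain c where "c \<in> str (iteration H (N p) i) U" by blast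
    moreover obtain q where q: "quot (?X (N p) i) (iteration H (N p) i) q"
      using quot_iteration[of H "N p" i] H by blast
    ultimately obtain W s where W: "W \<circ> Some = U" "s \<in> str (?X (N p) i) W" using quot_surj by blast
    have "d (shape W) = p" unfolding d_def p_def W(1)[symmetric] by (simp add: shape_def)
    hence "s \<in> str (L i) W" using W(2) by (simp add: L_def shapewise_def)
    thus False using zero by (auto simp: is_zero_def)
  qed
  moreover have "polynomial_in None (L i)" for i
    unfolding polynomial_in_None_iff[OF sL]
  proof
    fix n
    \<comment> \<open>For fixed \<open>z\<close> one iterate represents \<open>L\<close>, whatever
      the number of new labels, and its quotient has finitely many structures on labels of shape
      \<open>z\<close>.\<close>
    have "\<exists>A. \<forall>W. shape (W \<circ> Some) = z \<and> str (L i) W \<noteq> {} \<longrightarrow> fcard (W None) \<le> A" for z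
    proof -
      let ?n = "N (\<Sum>x\<in>UNIV. z x)"
      obtain q where q: "quot (?X ?n i) (iteration H ?n i) q" using quot_iteration[of H ?n i] H by blast
      have "str (L i) W = str (?X ?n i) W" if "shape (W \<circ> Some) = z" for W
        using that by (auto simp: L_def shapewise_def d_def shape_def)
      thus ?thesis
        using quot_finite_bound[OF species_functorial[OF X] q species_finite[OF Y], of "std_labels z"]
        by (metis shape_std)
    qed
    then obtain A where A: "\<And>z W. shape (W \<circ> Some) = z \<Longrightarrow> str (L i) W \<noteq> {} \<Longrightarrow> fcard (W None) \<le> A z"
      by metis
    let ?Z = "{z :: 'z \<Rightarrow> nat. (\<Sum>x\<in>UNIV. z x) \<le> n}"
    have "fcard (W None) \<le> Max (A ` ?Z)"
      if W: "str (L i) W \<noteq> {}" "(\<Sum>z\<in>UNIV. shape (W \<circ> Some) z) \<le> n" for W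
    proof -
      have "A (shape (W \<circ> Some)) \<le> Max (A ` ?Z)" using W(2) by (intro Max_ge finite_imageI finite_sum_le) auto
      thus ?thesis using A[OF refl W(1)] by simp
    qed
    thus "\<exists>A. \<forall>W. str (L i) W \<noteq> {} \<and> (\<Sum>z\<in>UNIV. shape (W \<circ> Some) z) \<le> n \<longrightarrow> fcard (W None) \<le> A" by blast
  qed
  ultimately show thesis using that lim by blast
qed

text \<open>For the converse direction, the limit given by well-foundedness at 0 is a solution,
  hence isomorphic to the given polynomial one and itself polynomial. All iterates embed into it, so
  its bounds on new labels make the iterates of \<open>H\<close> species.\<close>

lemma well_founded_iff_companion:
  fixes H :: "'m::finite \<Rightarrow> ('z::finite + 'm) spec"
  assumes H: "\<And>i. species (H i)"
  shows "well_founded H \<longleftrightarrow> well_founded_at_0 (companion H) \<and>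
      (\<exists>S. the_solution_at_0 (companion H) S \<and> (\<forall>i. polynomial_in None (S i)))"
    and "well_founded H \<Longrightarrow> solution_at_0 (companion H) S \<Longrightarrow> has_limit (iteration H) (\<lambda>i. at_one (S i))"
proof -
  let ?X = "iteration_at_0 (companion H)"
  have K: "species (companion H i)" for i by (rule species_companion[OF H])
  have X: "species (?X n i)" for n i by (rule species_iteration_at_0[OF K])
  have forward: "\<exists>L. has_limit ?X L \<and> (\<forall>i. polynomial_in None (L i)) \<and> (\<forall>i. \<not> is_zero (L i)) \<and>
      the_solution_at_0 (companion H) L" if wf: "well_founded H"
  proof -
    obtain L' where "has_limit (iteration H) L'" "\<And>i. \<not> is_zero (L' i)" "\<And>n i. species (iteration H n i)"
      using wf unfolding well_founded_def iteration_well_defined_def by blast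
    then obtain L where L: "has_limit ?X L" "\<And>i. polynomial_in None (L i)" "\<And>i. \<not> is_zero (L i)"
      using companion_limit[of H L'] H by blast
    have sol: "solution_at_0 (companion H) L" by (rule limit_is_solution[OF K companion_no_labels L(1)])
    have "T i \<cong>\<^sub>s L i" if "solution_at_0 (companion H) T" for T i
      by (rule solution_unique[OF K wf_linear[OF K companion_no_labels L(1,3)] that sol])
    thus ?thesis using L sol unfolding the_solution_at_0_def by blast
  qed
  show "has_limit (iteration H) (\<lambda>i. at_one (S i))"
    if wf: "well_founded H" and S: "solution_at_0 (companion H) S"
  proof -
    obtain L where L: "has_limit ?X L" "\<And>i. polynomial_in None (L i)" "\<And>T i. solution_at_0 (companion H) T \<Longrightarrow> T i \<cong>\<^sub>s L i"
      using forward[OF wf] unfolding the_solution_at_0_def by blast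
    have sS: "species (S i)" for i using S by (simp add: solution_at_0_def)
    have LS: "L i \<cong>\<^sub>s S i" for i
      using L(3)[OF S] iso_at_sym[OF species_functorial[OF sS]] by (simp add: iso_sp_iff)
    show ?thesis by (rule has_limit_at_one[OF H L(1,2) sS LS])
  qed
  show "well_founded H \<longleftrightarrow> well_founded_at_0 (companion H) \<and>
      (\<exists>S. the_solution_at_0 (companion H) S \<and> (\<forall>i. polynomial_in None (S i)))"
  proof
    assume "well_founded H"
    then obtain L where L: "has_limit ?X L" "\<And>i. polynomial_in None (L i)" "\<And>i. \<not> is_zero (L i)"
      "the_solution_at_0 (companion H) L" using forward by blast
    have "well_founded_at_0 (companion H)"
      unfolding well_founded_at_0_def is_zero_at_zero_iff using L companion_no_labels by blast
    thus "well_founded_at_0 (companion H) \<and>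
      (\<exists>S. the_solution_at_0 (companion H) S \<and> (\<forall>i. polynomial_in None (S i)))" using L by blast
  next
    assume a: "well_founded_at_0 (companion H) \<and>
      (\<exists>S. the_solution_at_0 (companion H) S \<and> (\<forall>i. polynomial_in None (S i)))"
    then obtain S where S: "the_solution_at_0 (companion H) S" "\<And>i. polynomial_in None (S i)" by blast
    obtain L where L: "has_limit ?X L" "\<And>i. \<not> is_zero (L i)"
      using a unfolding well_founded_at_0_def by blast
    have sol: "solution_at_0 (companion H) L" by (rule limit_is_solution[OF K companion_no_labels L(1)])
    have sS: "species (S i)" for i using S(1) by (simp add: the_solution_at_0_def solution_at_0_def)
    have sL: "species (L i)" for i by (rule has_limit_species[OF L(1)])
    have LS: "L i \<cong>\<^sub>s S i" for i using S(1) sol by (simp add: the_solution_at_0_def)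
    hence iso: "iso_at k (L i) (S i)" for k i by (simp add: iso_sp_iff)
    have pL: "polynomial_in None (L i)" for i
      by (rule polynomial_in_iso[OF sS sL iso_at_sym[OF species_functorial[OF sL] iso] S(2)])
    have lim: "has_limit (iteration H) (\<lambda>i. at_one (S i))"
      by (rule has_limit_at_one[OF H L(1) pL sS LS])
    have q: "\<exists>q. quot (?X n i) (iteration H n i) q" for n i by (rule quot_iteration[OF H])
    have XL: "str (L i) W \<noteq> {}" if "str (?X n i) W \<noteq> {}" for n i W
      using that emb_at_empty[OF has_limit_emb[OF K L(1)] refl] by blast
    have Y: "species (iteration H n i)" for n i
      unfolding species_iff
    proof (intro conjI allI)
      obtain q where q: "quot (?X n i) (iteration H n i) q" using q by blast
      show "functorial (iteration H n i)" by (rule quot_functorial[OF species_functorial[OF X] q])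
      fix U :: "'z labels"
      obtain A where A: "\<And>W. str (L i) W \<noteq> {} \<Longrightarrow> (\<Sum>z\<in>UNIV. shape (W \<circ> Some) z) \<le> (\<Sum>z\<in>UNIV. shape U z)
          \<Longrightarrow> fcard (W None) \<le> A"
        using pL[of i] unfolding polynomial_in_None_iff[OF sL] by blast
      show "finite (str (iteration H n i) U)" by (rule quot_finite[OF X q, of _ A]) (use XL A in auto)
    qed
    \<comment> \<open>A structure of size 0 in component \<open>i\<close> of an iterate is the class
      of one with new labels only. This embeds into \<open>L i\<close>, so the second alternative of
      well-definedness fails only where the first holds.\<close>
    have "polynomial_in (Inr i) (H j)" if n: "\<not> is_zero (at_zero (iteration H n i))" for i j n
    proof -
      obtain c where c: "c \<in> str (iteration H n i) no_labels" using n unfolding is_zero_at_zero_iff by blast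
      obtain q where "quot (?X n i) (iteration H n i) q" using q by blast
      then obtain W s where W: "W \<circ> Some = no_labels" "s \<in> str (?X n i) W" using quot_surj c by blast
      have "str (L i) W \<noteq> {}" using XL W(2) by blast
      thus ?thesis using polynomial_in_system[OF H sol L(2) pL _ W(1)] by blast
    qed
    hence "iteration_well_defined H" unfolding iteration_well_defined_def using Y by blast
    \<comment> \<open>Any structure of \<open>S i\<close>, on whatever labels, has a class in
      \<open>at_one (S i)\<close>.\<close>
    moreover have "\<not> is_zero (at_one (S i))" for i
    proof
      assume z: "is_zero (at_one (S i))"
      obtain W where "str (L i) W \<noteq> {}" using L(2)[of i] unfolding is_zero_def by blast
      hence "str (S i) W \<noteq> {}" using iso_at_empty[OF iso refl] by blast
      then obtain s where "s \<in> str (S i) W" by blast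
      from quot_in[OF quot_at_one[OF species_functorial[OF sS]] this] show False
        using z unfolding is_zero_def by blast
    qed
    ultimately show "well_founded H" unfolding well_founded_def using lim by blast
  qed
qed

text \<open>The single sort of \<open>Z\<close> is given by the type \<open>unit\<close>. The claim
  about the limit is made for every solution that vanishes at 0, so it does not depend on the choice
  of \<open>S1\<close> within its isomorphism class.\<close>

theorem mainTheorem4:
  fixes H :: "'m::finite \<Rightarrow> (unit + 'm) spec"
  assumes "\<forall>i. species (H i)"
  shows "(well_founded H \<longleftrightarrow>
            well_founded_at_0 (companion H) \<and>
            (\<exists>S1. the_solution_at_0 (companion H) S1 \<and> (\<forall>i. polynomial_in None (S1 i)))) \<and>
         (well_founded H \<longrightarrow>
            (\<forall>S1. solution_at_0 (companion H) S1 \<longrightarrow>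
               has_limit (iteration H) (\<lambda>i. at_one (S1 i))))"
  using well_founded_iff_companion[of H] assms by blast

end
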